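(* (Isoperimetric inequality.) Let $\Phi_\lambda$ be the one-mode quantum-limited attenuator of transmissivity $\lambda$. For any one-mode quantum state $\hat\rho$ with finite support, $$\left.\frac{d}{dt}S\left(\Phi_{e^{-t}}(\hat\rho)\right)\right|_{t=0}\ \ge\ f\left(S(\hat\rho)\right),\qquad\text{where } f(S):=-g^{-1}(S)\,g'\left(g^{-1}(S)\right).$$
   Context: The one-mode Hilbert space is that of one harmonic oscillator, with ladder operator $\hat a$ satisfying $[\hat a,\hat a^\dagger]=\hat{\mathbb I}$, and orthonormal Fock basis $|n\rangle=\frac{(\hat a^\dagger)^n}{\sqrt{n!}}|0\rangle$, $n\in\mathbb N=\{0,1,2,\dots\}$, where $\hat a|0\rangle=0$. A quantum state is a positive semidefinite trace-class operator of trace one. It has finite support if it is supported on the span of $|0\rangle,\dots,|N\rangle$ for some $N\in\mathbb N$. $S(\hat\rho)=-\mathrm{Tr}[\hat\rho\ln\hat\rho]$ is the von Neumann entropy. Quantum-limited attenuator: let $B$ be a second mode with ladder operator $\hat b$ and vacuum $|0\rangle_B$. For $0\le\lambda\le1$ let $\hat U_\lambda=\exp\left((\hat a^\dagger\hat b-\hat a\,\hat b^\dagger)\arccos\sqrt\lambda\right)$, a unitary satisfying $\hat U_\lambda^\dagger\,\hat a\,\hat U_\lambda=\sqrt\lambda\,\hat a+\sqrt{1-\lambda}\,\hat b$. Then $\Phi_\lambda(\hat\rho)=\mathrm{Tr}_B\left[\hat U_\lambda(\hat\rho\otimes|0\rangle_B\langle0|)\hat U_\lambda^\dagger\right]$;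 $\Phi_1$ is the identity. The function $g:[0,\infty)\to[0,\infty)$ is $g(E)=(E+1)\ln(E+1)-E\ln E$ with $g(0)=0$; it is a continuous strictly increasing bijection, with inverse $g^{-1}$, and $g'(E)=\ln(1+1/E)$ for $E>0$. The function $f$ is extended by continuity to $S=0$, i.e. $f(0)=0$. The derivative at $t=0$ is the right derivative ($t\ge0$), which is allowed to take the value $+\infty$. *)

theory Defs
  imports "HOL-Analysis.Analysis"
begin

text \<open>
  The Hilbert space of one mode is \<open>\<ell>\<^sup>2(\<nat>)\<close>, the Fock vectors being the standard basis; that of two
  modes is \<open>\<ell>\<^sup>2(\<nat> \<times> \<nat>)\<close>. An operator is given by its matrix elements in the Fock basis:
  \<open>A m n\<close> stands for \<open>\<langle>m|A|n\<rangle>\<close>.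
\<close>

type_synonym 'i op = "'i \<Rightarrow> 'i \<Rightarrow> complex"

definition op_id :: "'i op" where
  "op_id i j = of_bool (i = j)"

definition op_times :: "'i op \<Rightarrow> 'i op \<Rightarrow> 'i op" (infixl "\<odot>" 70) where
  "(A \<odot> B) i j = (\<Sum>\<^sub>\<infinity>k. A i k * B k j)"

definition op_adj :: "'i op \<Rightarrow> 'i op" where
  "op_adj A i j = cnj (A j i)"

definition op_tensor :: "'i op \<Rightarrow> 'j op \<Rightarrow> ('i \<times> 'j) op" (infixl "\<otimes>\<^sub>o" 75) where
  "(A \<otimes>\<^sub>o B) = (\<lambda>(i, k) (j, l). A i j * B k l)"

definition op_diag :: "('i \<Rightarrow> real) \<Rightarrow> 'i op" where
  "op_diag p i j = (if i = j then of_real (p i) else 0)"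

definition op_trace :: "'i op \<Rightarrow> complex" where
  "op_trace A = (\<Sum>\<^sub>\<infinity>i. A i i)"

definition partial_trace_snd :: "('i \<times> 'j) op \<Rightarrow> 'i op" where
  "partial_trace_snd A i j = (\<Sum>\<^sub>\<infinity>k. A (i, k) (j, k))"

definition op_unitary :: "'i op \<Rightarrow> bool" where
  "op_unitary V \<longleftrightarrow> op_adj V \<odot> V = op_id \<and> V \<odot> op_adj V = op_id"

primrec op_power :: "'i op \<Rightarrow> nat \<Rightarrow> 'i op" where
  "op_power A 0 = op_id"
| "op_power A (Suc n) = A \<odot> op_power A n"

text \<open>
  The exponential series is taken matrix element by matrix element. This is also meaningful for the
  unbounded generator of the beam splitter below: it preserves the total photon number, so that it
  is a direct sum of finite-dimensional blocks and all Fock vectors are analytic vectors for it.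
\<close>

definition op_exp :: "'i op \<Rightarrow> 'i op" where
  "op_exp A i j = (\<Sum>n. op_power A n i j / fact n)"


subsection \<open>States and entropy\<close>

text \<open>
  Positive semidefiniteness is tested on the dense span of the Fock vectors. For a positive
  semidefinite matrix, absolute convergence of the trace means that it is the matrix of a
  trace-class operator.
\<close>

definition op_psd :: "nat op \<Rightarrow> bool" where
  "op_psd A \<longleftrightarrow> (\<forall>n c. (\<Sum>i<n. \<Sum>j<n. cnj (c i) * A i j * c j) \<in> \<real>\<^sub>\<ge>\<^sub>0)"

definition quantum_state :: "nat op \<Rightarrow> bool" where
  "quantum_state \<rho> \<longleftrightarrow> op_psd \<rho> \<and> ((\<lambda>n. \<rho> n n) has_sum 1) UNIV"

definition finite_support :: "nat op \<Rightarrow> bool" where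
  "finite_support \<rho> \<longleftrightarrow> (\<exists>N. \<forall>m n. N < m \<or> N < n \<longrightarrow> \<rho> m n = 0)"

text \<open>
  \<open>eigenbasis A V p\<close>: the columns of \<open>V\<close> are an orthonormal basis of eigenvectors of \<open>A\<close> with
  eigenvalues \<open>p\<close>. The eigenvalue equation is used instead of \<open>A = V \<odot> op_diag p \<odot> op_adj V\<close>, because
  the latter could hold for spurious \<open>p\<close>, divergent sums having the value 0. Every state has an
  eigenbasis, and for \<open>f\<close> bounded on the spectrum \<open>op_fun f A\<close> does not depend on its choice.
\<close>

definition eigenbasis :: "'i op \<Rightarrow> 'i op \<Rightarrow> ('i \<Rightarrow> real) \<Rightarrow> bool" where
  "eigenbasis A V p \<longleftrightarrow> op_unitary V \<and> A \<odot> V = V \<odot> op_diag p"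

definition op_fun :: "(real \<Rightarrow> real) \<Rightarrow> 'i op \<Rightarrow> 'i op" where
  "op_fun f A = (let (V, p) = (SOME (V, p). eigenbasis A V p)
                 in V \<odot> op_diag (f \<circ> p) \<odot> op_adj V)"

text \<open>
  The operator \<open>\<rho> ln \<rho>\<close> is the function \<open>x ln x\<close> of \<open>\<rho>\<close>, where \<open>0 ln 0 = 0\<close>. It is bounded even if
  \<open>ln \<rho>\<close> is not. The real-valued entropy is meaningful for the states of finite entropy, among them
  all states with finite support.
\<close>

definition entropy :: "nat op \<Rightarrow> real" where
  "entropy \<rho> = - Re (op_trace (op_fun (\<lambda>x. x * ln x) \<rho>))"


subsection \<open>The quantum-limited attenuator\<close>

text \<open>\<open>ladder |n\<rangle> = \<surd>n |n - 1\<rangle>\<close>\<close>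

definition ladder :: "nat op" where
  "ladder m n = (if n = Suc m then of_real (sqrt (real n)) else 0)"

definition vacuum :: "nat op" where
  "vacuum m n = of_bool (m = 0 \<and> n = 0)"

text \<open>
  The generator is \<open>a\<^sup>\<dagger> b - a b\<^sup>\<dagger>\<close> multiplied by \<open>arccos (sqrt \<tau>)\<close>, where \<open>\<tau>\<close> is the transmissivity.
  The first tensor factor is the input mode \<open>a\<close>; the second one, \<open>b\<close>, is initially in the vacuum and
  is traced out.
\<close>

definition beam_splitter :: "real \<Rightarrow> (nat \<times> nat) op" where
  "beam_splitter \<tau> = op_exp (\<lambda>i j. of_real (arccos (sqrt \<tau>)) *
     ((op_adj ladder \<otimes>\<^sub>o ladder) i j - (ladder \<otimes>\<^sub>o op_adj ladder) i j))"

definition attenuator :: "real \<Rightarrow> nat op \<Rightarrow> nat op" where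
  "attenuator \<tau> \<rho> = partial_trace_snd
     (beam_splitter \<tau> \<odot> (\<rho> \<otimes>\<^sub>o vacuum) \<odot> op_adj (beam_splitter \<tau>))"


subsection \<open>The lower bound\<close>

text \<open>At \<open>E = 0\<close> this uses the library convention \<open>ln 0 = 0\<close>.\<close>

definition g_ent :: "real \<Rightarrow> real" where
  "g_ent E = (E + 1) * ln (E + 1) - E * ln E"

definition g_ent_inv :: "real \<Rightarrow> real" where
  "g_ent_inv = inv_into {0..} g_ent"

definition f_iso :: "real \<Rightarrow> real" where
  "f_iso S = (if S = 0 then 0 else - g_ent_inv S * deriv g_ent (g_ent_inv S))"

text \<open>An infinite derivative is allowed.\<close>

definition has_right_derivative :: "(real \<Rightarrow> real) \<Rightarrow> ereal \<Rightarrow> real \<Rightarrow> bool" where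
  "has_right_derivative F D x \<longleftrightarrow>
     ((\<lambda>h. ereal ((F (x + h) - F x) / h)) \<longlongrightarrow> D) (at_right 0)"

end

theory Submission
  imports Defs "HOL-Real_Asymp.Real_Asymp"
begin

text \<open>
  Let \<open>\<rho> = \<Sum>\<^sub>i p\<^sub>i |u\<^sub>i\<rangle>\<langle>u\<^sub>i|\<close> on the span of finitely many Fock vectors, and put
  \<open>A\<^sub>i\<^sub>j = |\<langle>u\<^sub>i|a|u\<^sub>j\<rangle>|\<^sup>2\<close>. If \<open>a\<close> leaves the range of \<open>\<rho>\<close>, a vanishing eigenvalue grows linearly in
  \<open>t\<close> and the entropy has slope \<open>\<infinity>\<close>. Otherwise Klein's inequality in both directions gives the slope
  \<open>\<Sum> A\<^sub>i\<^sub>j p\<^sub>j (ln p\<^sub>j - ln p\<^sub>i)\<close> over the range. As \<open>[a, a\<^sup>\<dagger>] = 1\<close>, each row sum of \<open>A\<close> exceeds the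
  column sum by at most \<open>1\<close>, and summation by parts bounds the slope from below by its value
  \<open>- \<Sum> n p\<^sub>n ln (p\<^sub>n\<^sub>-\<^sub>1 / p\<^sub>n)\<close> for the passive state with the same, decreasingly ordered, spectrum.

  It remains to bound \<open>F p = \<Sum> n p\<^sub>n ln (p\<^sub>n\<^sub>-\<^sub>1 / p\<^sub>n)\<close> in terms of the entropy \<open>S p\<close>. The bound is the
  tangent inequality \<open>F p - \<mu> S p \<le> z + \<mu> ln (1 - z)\<close> with equality for the geometric distribution of ratio
  \<open>z\<close>. A maximiser of the left side among the distributions on \<open>{0, ..., N - 1}\<close> has full support, and the
  stationarity equations are a recursion for the ratios \<open>r\<^sub>n = p\<^sub>n / p\<^sub>n\<^sub>-\<^sub>1\<close> with fixed point \<open>z\<close> and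
  final value \<open>r\<^sub>N = 0\<close>. It forces \<open>z > r\<^sub>1 \<ge> r\<^sub>2 \<ge> ...\<close>, and a ratio much below \<open>z\<close> would end the
  sequence too early, so that the maximiser tends to the geometric distribution as \<open>N\<close> grows.
\<close>


section \<open>Spectral decomposition of Hermitian matrices\<close>

text \<open>The bound f is what thermal states attain: a geometric distribution of mean E has
  entropy g(E), the attenuator keeps it geometric with mean E exp(-t), and its slope is - E g'(E).
  With z = E / (E + 1), the multiplier \<mu> is the slope of F against S along this family, 1 - (1 -
  z) / (- ln z), so the tangent inequality at the E with g(E) = S p reads F p \<le> E g'(E). The
  obstacle is that F and S are both concave and \<mu> > 0: F - \<mu> S has no concavity that would
  make a stationary point a maximiser, so that all stationary points have to be controlled. A
  maximiser comes from compactness, which forces the truncation to N levels, and the geometric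
  distribution is reached only in the limit. Decreasing order serves twice: it makes F continuous
  where probabilities vanish, and it is the worst case for the flow between eigenvectors. On the
  quantum side, eigenvectors of the evolved state are chosen for each t without any continuity.
  Hence everything is measured in the fixed eigenbasis of \<rho>, and only means and residuals of
  the evolved state in that basis are expanded.\<close>

definition unitary_on :: "nat \<Rightarrow> nat op \<Rightarrow> bool" where
  "unitary_on n U \<longleftrightarrow>
     (\<forall>i<n. \<forall>j<n. (\<Sum>k<n. cnj (U k i) * U k j) = of_bool (i = j)) \<and>
     (\<forall>i<n. \<forall>j<n. (\<Sum>k<n. U i k * cnj (U j k)) = of_bool (i = j))"

definition spectral :: "nat \<Rightarrow> nat op \<Rightarrow> nat op \<Rightarrow> (nat \<Rightarrow> real) \<Rightarrow> bool" where
  "spectral n A U p \<longleftrightarrow> unitary_on n U \<and>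
     (\<forall>i<n. \<forall>j<n. A i j = (\<Sum>k<n. U i k * of_real (p k) * cnj (U j k)))"

definition sesq :: "nat \<Rightarrow> nat op \<Rightarrow> (nat \<Rightarrow> complex) \<Rightarrow> (nat \<Rightarrow> complex) \<Rightarrow> complex" where
  "sesq n A u v = (\<Sum>a<n. \<Sum>b<n. cnj (u a) * A a b * v b)"

lemma sesq_comb_left:
  "sesq n A (\<lambda>x. \<alpha> * u x + \<beta> * v x) w = cnj \<alpha> * sesq n A u w + cnj \<beta> * sesq n A v w"
  unfolding sesq_def sum_distrib_left sum.distrib[symmetric]
  by (intro sum.cong refl) (simp add: ring_distribs mult.assoc)

lemma sesq_comb_right:
  "sesq n A w (\<lambda>x. \<alpha> * u x + \<beta> * v x) = \<alpha> * sesq n A w u + \<beta> * sesq n A w v"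
  unfolding sesq_def sum_distrib_left sum.distrib[symmetric]
  by (intro sum.cong refl) (simp add: ring_distribs ac_simps)

lemma sesq_cnj:
  assumes "\<And>i j. i < n \<Longrightarrow> j < n \<Longrightarrow> A j i = cnj (A i j)"
  shows "sesq n A v u = cnj (sesq n A u v)"
proof -
  have "cnj (sesq n A u v) = (\<Sum>a<n. \<Sum>b<n. u a * cnj (A a b) * cnj (v b))"
    by (simp add: sesq_def)
  also have "\<dots> = (\<Sum>a<n. \<Sum>b<n. cnj (v b) * A b a * u a)"
    using assms by (intro sum.cong refl) (metis lessThan_iff mult.assoc mult.commute)
  also have "\<dots> = sesq n A v u"
    unfolding sesq_def by (rule sum.swap)
  finally show ?thesis by simp
qed

definition givens :: "nat \<Rightarrow> nat \<Rightarrow> real \<Rightarrow> real \<Rightarrow> complex \<Rightarrow> nat op \<Rightarrow> nat op" where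
  "givens p q c s w U = (\<lambda>x k.
     if k = p then of_real c * U x p + of_real s * w * U x q
     else if k = q then - of_real s * cnj w * U x p + of_real c * U x q
     else U x k)"

text \<open>Right multiplication by a unitary 2 x 2 block. Rows and columns are both checked because
  \<open>unitary_on\<close> records both relations instead of deriving one from the other.\<close>

lemma unitary_on_givens:
  assumes U: "unitary_on n U" and pq: "p < n" "q < n" "p \<noteq> q"
    and cs: "c\<^sup>2 + s\<^sup>2 = 1" and w: "cmod w = 1"
  shows "unitary_on n (givens p q c s w U)"
proof -
  define V where "V = givens p q c s w U"
  have ww: "w * cnj w = 1"
    using w complex_norm_square[of w] by simp
  have cs': "complex_of_real c * of_real c = 1 - of_real s * of_real s"
    using cs by (metis add_diff_cancel_right' of_real_1 of_real_diff of_real_mult power2_eq_square)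
  have ww': "w * (cnj w * x) = x" for x using ww by (metis mult.assoc mult_1)
  have col: "(\<Sum>x<n. cnj (U x i) * U x j) = of_bool (i = j)" if "i < n" "j < n" for i j
    using U that by (auto simp: unitary_on_def)
  have row: "(\<Sum>k<n. U i k * cnj (U j k)) = of_bool (i = j)" if "i < n" "j < n" for i j
    using U that by (auto simp: unitary_on_def)
  \<comment> \<open>One formula for the three kinds of columns, so that the Gram matrix expands
    bilinearly before any case split.\<close>
  have colV: "V = (\<lambda>x k. U x k * of_bool (k \<noteq> p \<and> k \<noteq> q)
      + (of_real c * of_bool (k = p) - of_real s * cnj w * of_bool (k = q)) * U x p
      + (of_real s * w * of_bool (k = p) + of_real c * of_bool (k = q)) * U x q)"
    unfolding V_def givens_def using pq by (auto simp: fun_eq_iff)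
  have C: "(\<Sum>x<n. cnj (V x i) * V x j) = of_bool (i = j)" if ij: "i < n" "j < n" for i j
  proof -
    define m where "m k = (of_bool (k \<noteq> p \<and> k \<noteq> q) :: complex)" for k
    define \<alpha> where "\<alpha> k = (of_real c * of_bool (k = p) - of_real s * cnj w * of_bool (k = q))" for k
    define \<beta> where "\<beta> k = (of_real s * w * of_bool (k = p) + of_real c * of_bool (k = q))" for k
    have "(\<Sum>x<n. cnj (V x i) * V x j) =
       cnj (m i) * m j * (\<Sum>x<n. cnj (U x i) * U x j) + cnj (m i) * \<alpha> j * (\<Sum>x<n. cnj (U x i) * U x p)
       + cnj (m i) * \<beta> j * (\<Sum>x<n. cnj (U x i) * U x q)
       + cnj (\<alpha> i) * m j * (\<Sum>x<n. cnj (U x p) * U x j) + cnj (\<alpha> i) * \<alpha> j * (\<Sum>x<n. cnj (U x p) * U x p)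
       + cnj (\<alpha> i) * \<beta> j * (\<Sum>x<n. cnj (U x p) * U x q)
       + cnj (\<beta> i) * m j * (\<Sum>x<n. cnj (U x q) * U x j) + cnj (\<beta> i) * \<alpha> j * (\<Sum>x<n. cnj (U x q) * U x p)
       + cnj (\<beta> i) * \<beta> j * (\<Sum>x<n. cnj (U x q) * U x q)"
      unfolding colV \<alpha>_def[symmetric] \<beta>_def[symmetric] m_def[symmetric] sum_distrib_left sum.distrib[symmetric]
      by (intro sum.cong refl) (simp add: algebra_simps)
    also have "\<dots> = cnj (m i) * m j * of_bool (i = j) + cnj (m i) * \<alpha> j * of_bool (i = p)
       + cnj (m i) * \<beta> j * of_bool (i = q)
       + cnj (\<alpha> i) * m j * of_bool (p = j) + cnj (\<alpha> i) * \<alpha> j + cnj (\<beta> i) * m j * of_bool (q = j)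
       + cnj (\<beta> i) * \<beta> j"
      using ij pq pq(3)[symmetric] by (simp only: col) simp
    also have "\<dots> = of_bool (i = j)"
      using pq by (cases "i = p"; cases "i = q"; cases "j = p"; cases "j = q")
        (auto simp: m_def \<alpha>_def \<beta>_def cs' ww' algebra_simps)
    finally show ?thesis .
  qed
  have R: "(\<Sum>k<n. V i k * cnj (V j k)) = of_bool (i = j)" if ij: "i < n" "j < n" for i j
  proof -
    have split: "(\<Sum>k<n. f k) = f p + f q + (\<Sum>k\<in>{..<n} - {p, q}. f k)" for f :: "nat \<Rightarrow> complex"
    proof -
      have "(\<Sum>k<n. f k) = f p + (\<Sum>k\<in>{..<n} - {p}. f k)"
        using pq by (subst sum.remove[of _ p]) auto
      also have "(\<Sum>k\<in>{..<n} - {p}. f k) = f q + (\<Sum>k\<in>{..<n} - {p} - {q}. f k)"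
        using pq by (subst sum.remove[of _ q]) auto
      also have "{..<n} - {p} - {q} = {..<n} - {p, q}" by auto
      finally show ?thesis by (simp add: ac_simps)
    qed
    have "(\<Sum>k\<in>{..<n} - {p, q}. V i k * cnj (V j k)) = (\<Sum>k\<in>{..<n} - {p, q}. U i k * cnj (U j k))"
      by (intro sum.cong refl) (auto simp: V_def givens_def)
    moreover have "V i p * cnj (V j p) + V i q * cnj (V j q) = U i p * cnj (U j p) + U i q * cnj (U j q)"
    proof -
      have "V i p * cnj (V j p) + V i q * cnj (V j q) =
        (of_real c * of_real c + of_real s * of_real s * (w * cnj w)) * (U i p * cnj (U j p) + U i q * cnj (U j q))"
        using pq unfolding V_def givens_def by (simp add: algebra_simps)
      then show ?thesis by (simp add: ww cs')
    qed
    ultimately have "(\<Sum>k<n. V i k * cnj (V j k)) = (\<Sum>k<n. U i k * cnj (U j k))"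
      unfolding split by simp
    then show ?thesis using row ij by simp
  qed
  show ?thesis
    unfolding unitary_on_def V_def[symmetric] using C R by blast
qed

lemma continuous_on_coord: "continuous_on S (\<lambda>f. f x)"
  by (rule continuous_on_product_then_coordinatewise) (rule continuous_on_id)

text \<open>Tychonoff gives a compact box, from which the unitarity equations cut out a closed
  subset. The box bounds all coordinates, as \<open>unitary_on\<close> leaves those outside the
  block free.\<close>

lemma compact_unitary:
  "compact {f :: nat \<times> nat \<Rightarrow> complex. unitary_on n (curry f) \<and> (\<forall>x. f x \<in> cball 0 1)}"
proof -
  have 1: "compact (Pi\<^sub>E UNIV (\<lambda>_::nat\<times>nat. cball (0::complex) 1))"
    unfolding compactin_euclidean_iff[symmetric] euclidean_product_topology[symmetric]
    by (subst compactin_PiE) auto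
  have "closed {f :: nat \<times> nat \<Rightarrow> complex. unitary_on n (curry f)}"
    unfolding unitary_on_def curry_def
    by (intro closed_Collect_conj closed_Collect_all closed_Collect_imp closed_Collect_eq
        continuous_intros continuous_on_product_coordinates open_Collect_const)
  from compact_Int_closed[OF 1 this] show ?thesis
    by (rule back_subst[of compact]) (auto simp: PiE_def Pi_def)
qed

lemma unitary_on_entry_le:
  assumes "unitary_on n U" "i < n" "j < n"
  shows "cmod (U i j) \<le> 1"
proof -
  have "(\<Sum>k<n. U i k * cnj (U i k)) = 1"
    using assms by (auto simp: unitary_on_def)
  then have "complex_of_real (\<Sum>k<n. (cmod (U i k))\<^sup>2) = 1"
    by (simp only: of_real_sum complex_norm_square)
  then have "(\<Sum>k<n. (cmod (U i k))\<^sup>2) = 1"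
    using of_real_eq_1_iff by blast
  moreover have "(cmod (U i j))\<^sup>2 \<le> (\<Sum>k<n. (cmod (U i k))\<^sup>2)"
    using assms by (intro member_le_sum) auto
  ultimately show ?thesis
    by (simp add: power2_le_iff_abs_le abs_square_le_1)
qed

text \<open>
  A maximiser of \<open>\<Sum>k. k \<langle>u\<^sub>k|A|u\<^sub>k\<rangle>\<close> over all orthonormal bases diagonalises \<open>A\<close>: as the weights are
  distinct, a nonzero element \<open>\<langle>u\<^sub>p|A|u\<^sub>q\<rangle>\<close> would allow an increase by a small rotation.
\<close>

theorem spectral_exists:
  assumes herm: "\<And>i j. i < n \<Longrightarrow> j < n \<Longrightarrow> A j i = cnj (A i j)"
  shows "\<exists>U p. spectral n A U p"
proof -
  define col where "col U k = (\<lambda>x. U x k)" for U :: "nat op" and k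
  define T where "T U = (\<Sum>k<n. real k * Re (sesq n A (col U k) (col U k)))" for U
  let ?X = "{f :: nat \<times> nat \<Rightarrow> complex. unitary_on n (curry f) \<and> (\<forall>x. f x \<in> cball 0 1)}"
  have cont: "continuous_on ?X (\<lambda>f. T (curry f))"
    unfolding T_def sesq_def curry_def col_def
    by (intro continuous_intros continuous_on_coord)
  have "(\<lambda>(i, j). of_bool (i = j)) \<in> ?X"
    by (auto simp: unitary_on_def of_bool_def if_distrib if_distribR cong: if_cong)
  then have "?X \<noteq> {}" by blast
  from continuous_attains_sup[OF compact_unitary this cont]
  obtain f where f: "f \<in> ?X" and fmax: "\<And>g. g \<in> ?X \<Longrightarrow> T (curry g) \<le> T (curry f)"
    by blast
  define U where "U = curry f"
  have U: "unitary_on n U" using f by (simp add: U_def)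
  have T_cong: "T V = T V'" if "\<And>i j. i < n \<Longrightarrow> j < n \<Longrightarrow> V i j = V' i j" for V V'
    unfolding T_def sesq_def col_def using that by (intro sum.cong refl arg_cong2[where f="(*)"] arg_cong[where f=Re]) auto
  have Umax: "T V \<le> T U" if V: "unitary_on n V" for V
  proof -
    define g where "g = (\<lambda>(i, j). if i < n \<and> j < n then V i j else 0)"
    have "g \<in> ?X"
      using V unitary_on_entry_le[OF V] by (auto simp: g_def unitary_on_def)
    then have "T (curry g) \<le> T U" using fmax unfolding U_def by blast
    also have "T (curry g) = T V" by (rule T_cong) (simp add: g_def)
    finally show ?thesis .
  qed
  define B where "B i j = sesq n A (col U i) (col U j)" for i j
  have B_cnj: "B j i = cnj (B i j)" for i j
    unfolding B_def by (rule sesq_cnj[OF herm])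
  have offdiag: "B p q = 0" if pq: "p < n" "q < n" "p \<noteq> q" for p q
  proof (rule ccontr)
    assume b: "B p q \<noteq> 0"
    \<comment> \<open>The phase makes \<open>w * B p q\<close> real with the sign of p - q. As u_p
      has weight p and u_q has weight q, the first-order effect of the rotation is then positive,
      whatever the argument of \<open>B p q\<close>.\<close>
    define w where "w = sgn (real p - real q) * cnj (B p q) / cmod (B p q)"
    \<comment> \<open>For the angle with tangent \<open>d\<close> the gain is
      \<open>c\<^sup>2 * d * (d * K + L)\<close>: \<open>L\<close> is the first-order part,
      \<open>K\<close> the second-order part of unknown sign. The choice of \<open>d\<close> ensures
      \<open>d * \<bar>K\<bar> \<le> L / 2\<close>.\<close>
    define K where "K = (real p - real q) * Re (B q q - B p p)"
    define L where "L = 2 * \<bar>real p - real q\<bar> * cmod (B p q)"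
    have L: "L > 0" using b pq by (simp add: L_def)
    define d where "d = L / (2 * (\<bar>K\<bar> + 1))"
    have d: "d > 0" using L by (simp add: d_def)
    define c where "c = 1 / sqrt (1 + d\<^sup>2)"
    define s where "s = d * c"
    have c0: "c > 0" unfolding c_def by (simp add: add_pos_nonneg)
    have c2: "c\<^sup>2 * (1 + d\<^sup>2) = 1"
      unfolding c_def by (simp add: power_divide add_pos_nonneg add_nonneg_eq_0_iff)
    have cs: "c\<^sup>2 + s\<^sup>2 = 1" using c2 by (simp add: s_def power_mult_distrib algebra_simps)
    have w: "cmod w = 1"
      using b pq by (auto simp: w_def norm_mult norm_divide sgn_real_def)
    define V where "V = givens p q c s w U"
    have V: "unitary_on n V"
      unfolding V_def by (rule unitary_on_givens[OF U pq cs w])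
    have colp: "col V p = (\<lambda>x. of_real c * col U p x + (of_real s * w) * col U q x)"
      by (auto simp: col_def V_def givens_def)
    have colq: "col V q = (\<lambda>x. (- of_real s * cnj w) * col U p x + of_real c * col U q x)"
      using pq by (auto simp: col_def V_def givens_def)
    have wb: "(real p - real q) * Re (w * B p q) = \<bar>real p - real q\<bar> * cmod (B p q)"
    proof -
      have "w * B p q = of_real (sgn (real p - real q) * cmod (B p q))"
        using b by (simp add: w_def field_simps complex_norm_square[symmetric] power2_eq_square)
      then show ?thesis by (simp add: sgn_real_def)
    qed
    have ww: "w * cnj w = 1" using w complex_norm_square[of w] by simp
    have Bpp: "sesq n A (col V p) (col V p) =
       of_real (c\<^sup>2) * B p p + of_real (s\<^sup>2) * (w * cnj w) * B q q + of_real (c * s) * (w * B p q + cnj (w * B p q))"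
      unfolding colp sesq_comb_left sesq_comb_right B_def[symmetric] using B_cnj[of p q]
      by (simp add: algebra_simps power2_eq_square)
    have Bqq: "sesq n A (col V q) (col V q) =
       of_real (s\<^sup>2) * (w * cnj w) * B p p + of_real (c\<^sup>2) * B q q - of_real (c * s) * (w * B p q + cnj (w * B p q))"
      unfolding colq sesq_comb_left sesq_comb_right B_def[symmetric] using B_cnj[of p q]
      by (simp add: algebra_simps power2_eq_square)
    have Rpp: "Re (sesq n A (col V p) (col V p)) = c\<^sup>2 * Re (B p p) + s\<^sup>2 * Re (B q q) + 2 * c * s * Re (w * B p q)"
      unfolding Bpp ww by (simp add: algebra_simps)
    have Rqq: "Re (sesq n A (col V q) (col V q)) = s\<^sup>2 * Re (B p p) + c\<^sup>2 * Re (B q q) - 2 * c * s * Re (w * B p q)"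
      unfolding Bqq ww by (simp add: algebra_simps)
    have split: "(\<Sum>k<n. f k) = f p + f q + (\<Sum>k\<in>{..<n} - {p, q}. f k)" for f :: "nat \<Rightarrow> real"
    proof -
      have "(\<Sum>k<n. f k) = f p + (\<Sum>k\<in>{..<n} - {p}. f k)"
        using pq by (subst sum.remove[of _ p]) auto
      also have "(\<Sum>k\<in>{..<n} - {p}. f k) = f q + (\<Sum>k\<in>{..<n} - {p} - {q}. f k)"
        using pq by (subst sum.remove[of _ q]) auto
      also have "{..<n} - {p} - {q} = {..<n} - {p, q}" by auto
      finally show ?thesis by (simp add: ac_simps)
    qed
    have rest: "(\<Sum>k\<in>{..<n} - {p, q}. real k * Re (sesq n A (col V k) (col V k)))
        = (\<Sum>k\<in>{..<n} - {p, q}. real k * Re (sesq n A (col U k) (col U k)))"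
    proof (intro sum.cong refl)
      fix k assume "k \<in> {..<n} - {p, q}"
      then have "col V k = col U k" by (auto simp: col_def V_def givens_def)
      then show "real k * Re (sesq n A (col V k) (col V k)) = real k * Re (sesq n A (col U k) (col U k))"
        by simp
    qed
    have "T V - T U = real p * (Re (sesq n A (col V p) (col V p)) - Re (B p p))
        + real q * (Re (sesq n A (col V q) (col V q)) - Re (B q q))"
      unfolding T_def split rest B_def by (simp add: algebra_simps)
    also have "\<dots> = s\<^sup>2 * K + 2 * c * s * ((real p - real q) * Re (w * B p q))"
    proof -
      have c2': "c\<^sup>2 = 1 - s\<^sup>2" using cs by simp
      show ?thesis unfolding Rpp Rqq K_def c2' by (simp add: algebra_simps)
    qed
    also have "\<dots> = c\<^sup>2 * d * (d * K + L)"
      unfolding wb s_def L_def by (simp add: power2_eq_square algebra_simps)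
    also have "\<dots> > 0"
    proof -
      have "d * \<bar>K\<bar> \<le> L / 2"
        unfolding d_def using L by (simp add: field_simps)
      moreover have "d * K \<ge> - (d * \<bar>K\<bar>)" using d by (metis abs_ge_minus_self abs_mult abs_of_pos minus_le_iff)
      ultimately have "d * K + L > 0" using L by linarith
      then show ?thesis using d c0 by simp
    qed
    finally show False using Umax[OF V] by simp
  qed
  define p where "p k = Re (B k k)" for k
  have B_diag: "B i j = of_bool (i = j) * of_real (p i)" if "i < n" "j < n" for i j
  proof (cases "i = j")
    case True
    have "Im (B i i) = 0" using B_cnj[of i i] by (simp add: complex_eq_iff)
    then show ?thesis using True by (simp add: p_def complex_eq_iff)
  qed (use offdiag that in auto)
  have row: "(\<Sum>k<n. U i k * cnj (U j k)) = of_bool (i = j)" if "i < n" "j < n" for i j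
    using U that by (auto simp: unitary_on_def)
  have "A i j = (\<Sum>k<n. U i k * of_real (p k) * cnj (U j k))" if ij: "i < n" "j < n" for i j
  proof -
    have "(\<Sum>k<n. U i k * of_real (p k) * cnj (U j k)) = (\<Sum>k<n. \<Sum>l<n. U i k * B k l * cnj (U j l))"
      by (intro sum.cong refl) (simp add: B_diag of_bool_def if_distrib if_distribR cong: if_cong)
    also have "\<dots> = (\<Sum>k<n. \<Sum>l<n. \<Sum>a<n. \<Sum>b<n. (U i k * cnj (U a k)) * A a b * (U b l * cnj (U j l)))"
      unfolding B_def sesq_def col_def by (simp add: sum_distrib_left sum_distrib_right mult.assoc)
    also have "\<dots> = (\<Sum>k<n. \<Sum>a<n. \<Sum>b<n. \<Sum>l<n. (U i k * cnj (U a k)) * A a b * (U b l * cnj (U j l)))"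
      by (rule sum.cong[OF refl], subst sum.swap, rule sum.cong[OF refl], rule sum.swap)
    also have "\<dots> = (\<Sum>k<n. \<Sum>a<n. \<Sum>b<n. (U i k * cnj (U a k)) * A a b * of_bool (b = j))"
      using ij by (intro sum.cong refl) (simp add: row flip: sum_distrib_left)
    also have "\<dots> = (\<Sum>k<n. \<Sum>a<n. (U i k * cnj (U a k)) * A a j)"
      using ij by (intro sum.cong refl) (simp add: of_bool_def if_distrib if_distribR cong: if_cong)
    also have "\<dots> = (\<Sum>a<n. (\<Sum>k<n. U i k * cnj (U a k)) * A a j)"
      unfolding sum_distrib_right by (rule sum.swap)
    also have "\<dots> = A i j"
      using ij by (simp add: row of_bool_def if_distrib if_distribR cong: if_cong)
    finally show ?thesis by simp
  qed
  then show ?thesis unfolding spectral_def using U by blast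
qed


section \<open>Functions of an operator and entropy\<close>

lemma has_sum_finite_sum:
  fixes f :: "'i \<Rightarrow> 'a \<Rightarrow> complex"
  assumes "finite I" "\<And>i. i \<in> I \<Longrightarrow> (f i has_sum s i) A"
  shows "((\<lambda>x. \<Sum>i\<in>I. f i x) has_sum (\<Sum>i\<in>I. s i)) A"
  using assms by (induction I rule: finite_induct) (auto intro: has_sum_add)

lemma infsum_lessThan:
  fixes f :: "nat \<Rightarrow> complex"
  assumes "\<And>k. k \<ge> n \<Longrightarrow> f k = 0"
  shows "infsum f UNIV = (\<Sum>k<n. f k)"
  by (rule infsumI, rule has_sum_finite_neutralI[where B = "{..<n}"]) (use assms in auto)

lemma infsum_single:
  fixes f :: "'a \<Rightarrow> complex"
  assumes "\<And>k. k \<noteq> l \<Longrightarrow> f k = 0"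
  shows "infsum f UNIV = f l"
  by (rule infsumI, rule has_sum_finite_neutralI[where B = "{l}"]) (use assms in auto)

definition supported :: "nat \<Rightarrow> nat op \<Rightarrow> bool" where
  "supported n A \<longleftrightarrow> (\<forall>i j. n \<le> i \<or> n \<le> j \<longrightarrow> A i j = 0)"

lemma spectral_eigen:
  assumes S: "spectral n A U p" and i: "i < n" and l: "l < n"
  shows "(\<Sum>m<n. A i m * U m l) = of_real (p l) * U i l"
    and "(\<Sum>m<n. cnj (U m l) * A m i) = of_real (p l) * cnj (U i l)"
proof -
  have col: "(\<Sum>k<n. cnj (U k i) * U k j) = of_bool (i = j)" if "i < n" "j < n" for i j
    using S that by (auto simp: unitary_on_def spectral_def)
  have A: "A i j = (\<Sum>k<n. U i k * of_real (p k) * cnj (U j k))" if "i < n" "j < n" for i j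
    using S that by (auto simp: spectral_def)
  have "(\<Sum>m<n. A i m * U m l) = (\<Sum>m<n. \<Sum>k<n. (U i k * of_real (p k)) * (cnj (U m k) * U m l))"
    using i by (intro sum.cong refl) (simp add: A sum_distrib_right mult.assoc)
  also have "\<dots> = (\<Sum>k<n. (U i k * of_real (p k)) * (\<Sum>m<n. cnj (U m k) * U m l))"
    by (subst sum.swap) (simp add: sum_distrib_left)
  also have "\<dots> = (\<Sum>k<n. (U i k * of_real (p k)) * of_bool (k = l))"
    using l by (intro sum.cong refl) (simp add: col)
  also have "\<dots> = of_real (p l) * U i l"
    using l by (simp add: of_bool_def if_distrib if_distribR cong: if_cong)
  finally show "(\<Sum>m<n. A i m * U m l) = of_real (p l) * U i l" .
  have "(\<Sum>m<n. cnj (U m l) * A m i) = (\<Sum>m<n. \<Sum>k<n. (cnj (U m l) * U m k) * (of_real (p k) * cnj (U i k)))"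
    using i by (intro sum.cong refl) (simp add: A sum_distrib_left mult.assoc)
  also have "\<dots> = (\<Sum>k<n. (\<Sum>m<n. cnj (U m l) * U m k) * (of_real (p k) * cnj (U i k)))"
    by (subst sum.swap) (simp add: sum_distrib_right)
  also have "\<dots> = (\<Sum>k<n. of_bool (l = k) * (of_real (p k) * cnj (U i k)))"
    using l by (intro sum.cong refl) (simp add: col)
  also have "\<dots> = of_real (p l) * cnj (U i l)"
    using l by (simp add: of_bool_def if_distrib if_distribR cong: if_cong)
  finally show "(\<Sum>m<n. cnj (U m l) * A m i) = of_real (p l) * cnj (U i l)" .
qed

text \<open>Makes the choice in \<open>op_fun\<close> meaningful: \<open>U\<close> is extended by
  the identity outside the block, where \<open>A\<close> vanishes and the eigenvalue is 0.\<close>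

lemma eigenbasis_exists:
  assumes A: "supported n A" and S: "spectral n A U p"
  shows "\<exists>V q. eigenbasis A V q"
proof -
  define V where "V i j = (if i < n \<and> j < n then U i j else of_bool (i = j))" for i j
  define q where "q k = (if k < n then p k else 0)" for k
  have col: "(\<Sum>k<n. cnj (U k i) * U k j) = of_bool (i = j)" if "i < n" "j < n" for i j
    using S that by (auto simp: unitary_on_def spectral_def)
  have row: "(\<Sum>k<n. U i k * cnj (U j k)) = of_bool (i = j)" if "i < n" "j < n" for i j
    using S that by (auto simp: unitary_on_def spectral_def)
  have eig: "(A \<odot> V) i j = (V \<odot> op_diag q) i j" for i j
  proof -
    have "(V \<odot> op_diag q) i j = V i j * of_real (q j)"
      unfolding op_times_def op_diag_def by (subst infsum_single[of j]) auto
    moreover have "(A \<odot> V) i j = (\<Sum>k<n. A i k * V k j)"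
      unfolding op_times_def by (rule infsum_lessThan) (use A in \<open>auto simp: supported_def\<close>)
    moreover have "(\<Sum>k<n. A i k * V k j) = V i j * of_real (q j)"
    proof (cases "i < n \<and> j < n")
      case True
      then have "(\<Sum>k<n. A i k * V k j) = (\<Sum>k<n. A i k * U k j)"
        by (intro sum.cong refl) (auto simp: V_def)
      then show ?thesis using spectral_eigen(1)[OF S, of i j] True by (auto simp: V_def q_def)
    next
      case False
      have "(\<Sum>k<n. A i k * V k j) = 0"
        using False A by (intro sum.neutral) (auto simp: V_def supported_def)
      then show ?thesis using False by (auto simp: V_def q_def)
    qed
    ultimately show ?thesis by simp
  qed
  have u1: "(op_adj V \<odot> V) i j = op_id i j" for i j
  proof (cases "i < n \<and> j < n")
    case True
    have "(op_adj V \<odot> V) i j = (\<Sum>k<n. cnj (V k i) * V k j)"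
      unfolding op_times_def op_adj_def by (rule infsum_lessThan) (use True in \<open>auto simp: V_def\<close>)
    also have "\<dots> = (\<Sum>k<n. cnj (U k i) * U k j)"
      using True by (intro sum.cong refl) (auto simp: V_def)
    finally show ?thesis using True by (simp add: col op_id_def)
  next
    case False
    then show ?thesis
      unfolding op_times_def op_adj_def
      by (subst infsum_single[of "if i < n then j else i"]) (auto simp: V_def op_id_def split: if_splits)
  qed
  have u2: "(V \<odot> op_adj V) i j = op_id i j" for i j
  proof (cases "i < n \<and> j < n")
    case True
    have "(V \<odot> op_adj V) i j = (\<Sum>k<n. V i k * cnj (V j k))"
      unfolding op_times_def op_adj_def by (rule infsum_lessThan) (use True in \<open>auto simp: V_def\<close>)
    also have "\<dots> = (\<Sum>k<n. U i k * cnj (U j k))"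
      using True by (intro sum.cong refl) (auto simp: V_def)
    finally show ?thesis using True by (simp add: row op_id_def)
  next
    case False
    then show ?thesis
      unfolding op_times_def op_adj_def
      by (subst infsum_single[of "if i < n then j else i"]) (auto simp: V_def op_id_def split: if_splits)
  qed
  have "eigenbasis A V q"
    unfolding eigenbasis_def op_unitary_def using eig u1 u2 by (auto simp: fun_eq_iff)
  then show ?thesis by blast
qed

text \<open>Unitarity fixes only values of \<open>infsum\<close>, which is 0 for divergent sums. The
  value 1 on the diagonal shows that the rows are square summable, and a product of two rows is
  dominated by their squares.\<close>

lemma op_unitary_row_has_sum:
  fixes V :: "nat op"
  assumes "op_unitary V"
  shows "((\<lambda>k. V m k * cnj (V j k)) has_sum of_bool (m = j)) UNIV"
proof -
  have inf: "infsum (\<lambda>k. V m k * cnj (V j k)) UNIV = of_bool (m = j)" for m j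
    using assms unfolding op_unitary_def op_times_def op_adj_def op_id_def by metis
  have sm: "(\<lambda>k. (cmod (V m k))\<^sup>2) summable_on UNIV" for m
  proof -
    have "(\<lambda>k. V m k * cnj (V m k)) summable_on UNIV"
      using inf[of m m] infsum_not_exists by fastforce
    then have "(\<lambda>k. cmod (V m k * cnj (V m k))) summable_on UNIV"
      by (rule iffD1[OF summable_on_iff_abs_summable_on_complex])
    then show ?thesis by (simp add: norm_mult power2_eq_square)
  qed
  have "(\<lambda>k. cmod (V m k * cnj (V j k))) summable_on UNIV"
  proof (rule Infinite_Sum.abs_summable_on_comparison_test')
    show "(\<lambda>k. (cmod (V m k))\<^sup>2 + (cmod (V j k))\<^sup>2) summable_on UNIV"
      using sm by (intro summable_on_add)
    show "cmod (V m k * cnj (V j k)) \<le> (cmod (V m k))\<^sup>2 + (cmod (V j k))\<^sup>2" for k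
    proof -
      have "0 \<le> cmod (V m k) * cmod (V j k)" by simp
      then show ?thesis
        using sum_squares_bound[of "cmod (V m k)" "cmod (V j k)"] unfolding norm_mult complex_mod_cnj by linarith
    qed
  qed
  then have "(\<lambda>k. V m k * cnj (V j k)) summable_on UNIV"
    by (rule abs_summable_summable)
  then show ?thesis using has_sum_infsum inf by fastforce
qed

text \<open>
  The overlaps \<open>\<langle>u\<^sub>l|v\<^sub>k\<rangle>\<close> of two eigenbases vanish unless the eigenvalues agree, so that a function
  of an operator does not depend on the eigenbasis.
\<close>

lemma op_fun_spectral:
  assumes A: "supported n A" and S: "spectral n A U p" and f0: "f 0 = 0"
  shows "op_fun f A i j =
    (if i < n \<and> j < n then \<Sum>l<n. U i l * of_real (f (p l)) * cnj (U j l) else 0)"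
proof -
  define X where "X = (SOME (V, p). eigenbasis A V p)"
  obtain V q where X: "X = (V, q)" by (cases X)
  have "case X of (V, p) \<Rightarrow> eigenbasis A V p"
    unfolding X_def by (rule someI_ex) (use eigenbasis_exists[OF A S] in auto)
  then have E: "eigenbasis A V q" by (simp add: X)
  then have V: "op_unitary V" and eig: "A \<odot> V = V \<odot> op_diag q" by (auto simp: eigenbasis_def)
  have row: "(\<Sum>k<n. U i k * cnj (U j k)) = of_bool (i = j)" if "i < n" "j < n" for i j
    using S that by (auto simp: unitary_on_def spectral_def)
  have diag: "(V \<odot> op_diag q) i k = V i k * of_real (q k)" for i k q
    unfolding op_times_def op_diag_def by (subst infsum_single[of k]) auto
  have eig': "(\<Sum>m<n. A i m * V m k) = V i k * of_real (q k)" for i k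
  proof -
    have "(A \<odot> V) i k = (\<Sum>m<n. A i m * V m k)"
      unfolding op_times_def by (rule infsum_lessThan) (use A in \<open>auto simp: supported_def\<close>)
    then show ?thesis using eig diag by metis
  qed
  define c where "c l k = (\<Sum>m<n. cnj (U m l) * V m k)" for l k
  have cpq: "of_real (p l) * c l k = of_real (q k) * c l k" if l: "l < n" for l k
  proof -
    have "of_real (q k) * c l k = (\<Sum>i<n. cnj (U i l) * (\<Sum>m<n. A i m * V m k))"
      unfolding eig' c_def by (simp add: sum_distrib_left ac_simps)
    also have "\<dots> = (\<Sum>m<n. (\<Sum>i<n. cnj (U i l) * A i m) * V m k)"
      unfolding sum_distrib_left sum_distrib_right
      by (subst sum.swap) (simp add: mult.assoc)
    also have "\<dots> = (\<Sum>m<n. (of_real (p l) * cnj (U m l)) * V m k)"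
      using l by (intro sum.cong refl) (simp add: spectral_eigen(2)[OF S])
    also have "\<dots> = of_real (p l) * c l k"
      by (simp add: c_def sum_distrib_left mult.assoc)
    finally show ?thesis by (rule sym)
  qed
  have cf: "of_real (f (p l)) * c l k = of_real (f (q k)) * c l k" if "l < n" for l k
    using cpq[OF that, of k] by (cases "c l k = 0") auto
  have key: "V i k * of_real (f (q k)) = (\<Sum>l<n. of_real (f (p l)) * U i l * c l k)" if i: "i < n" for i k
  proof -
    have "(\<Sum>l<n. of_real (f (p l)) * U i l * c l k) = (\<Sum>l<n. U i l * (of_real (f (p l)) * c l k))"
      by (intro sum.cong refl) (simp only: ac_simps)
    also have "\<dots> = (\<Sum>l<n. U i l * (of_real (f (q k)) * c l k))"
      by (intro sum.cong refl) (simp only: cf lessThan_iff)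
    also have "\<dots> = (\<Sum>l<n. of_real (f (q k)) * (U i l * c l k))"
      by (intro sum.cong refl) (simp only: ac_simps)
    also have "\<dots> = of_real (f (q k)) * (\<Sum>l<n. \<Sum>m<n. (U i l * cnj (U m l)) * V m k)"
      by (simp add: c_def sum_distrib_left mult.assoc)
    also have "\<dots> = of_real (f (q k)) * (\<Sum>m<n. (\<Sum>l<n. U i l * cnj (U m l)) * V m k)"
      by (subst sum.swap) (simp add: sum_distrib_right)
    also have "\<dots> = of_real (f (q k)) * V i k"
      using i by (simp add: row of_bool_def if_distrib if_distribR cong: if_cong)
    finally show ?thesis by simp
  qed
  \<comment> \<open>Outside the block the eigenvalue equation allows \<open>V i k\<close> to be
    nonzero only where \<open>q k = 0\<close>; there \<open>f 0 = 0\<close> removes the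
    term.\<close>
  have zero: "V i k * of_real (f (q k)) = 0" if i: "i \<ge> n" for i k
  proof -
    have "V i k * of_real (q k) = 0"
      using A i by (subst eig'[symmetric]) (simp add: supported_def)
    then show ?thesis using f0 by auto
  qed
  have val: "op_fun f A i j = infsum (\<lambda>k. V i k * of_real (f (q k)) * cnj (V j k)) UNIV" for i j
  proof -
    have "op_fun f A = V \<odot> op_diag (f \<circ> q) \<odot> op_adj V"
      unfolding op_fun_def X_def[symmetric] X by (simp add: Let_def)
    then show ?thesis by (simp add: op_times_def[of _ "op_adj V"] diag op_adj_def)
  qed
  consider "n \<le> i" | "n \<le> j" | "i < n" "j < n" by linarith
  then show ?thesis
  proof cases
    case 1
    then show ?thesis by (simp add: val zero)
  next
    case 2
    have "(\<lambda>k. V i k * of_real (f (q k)) * cnj (V j k)) = (\<lambda>_. 0)"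
      using zero[OF 2] by (auto simp: fun_eq_iff)
    then show ?thesis using 2 by (simp only: val) simp
  next
    case 3
    \<comment> \<open>By \<open>key\<close> the series over k is a finite combination of row
      products of \<open>V\<close>, whose convergence is known, so it can be summed term by
      term.\<close>
    have "((\<lambda>k. \<Sum>l<n. of_real (f (p l)) * U i l * (\<Sum>m<n. cnj (U m l) * (V m k * cnj (V j k)))) has_sum
       (\<Sum>l<n. of_real (f (p l)) * U i l * (\<Sum>m<n. cnj (U m l) * of_bool (m = j)))) UNIV"
      by (intro has_sum_finite_sum has_sum_cmult_right op_unitary_row_has_sum[OF V] finite_lessThan)
    also have "(\<lambda>k. \<Sum>l<n. of_real (f (p l)) * U i l * (\<Sum>m<n. cnj (U m l) * (V m k * cnj (V j k))))
       = (\<lambda>k. V i k * of_real (f (q k)) * cnj (V j k))"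
      unfolding key[OF 3(1)] c_def by (simp add: sum_distrib_left sum_distrib_right mult.assoc)
    also have "(\<Sum>l<n. of_real (f (p l)) * U i l * (\<Sum>m<n. cnj (U m l) * of_bool (m = j)))
       = (\<Sum>l<n. U i l * of_real (f (p l)) * cnj (U j l))"
      using 3 by (simp add: of_bool_def if_distrib if_distribR ac_simps cong: if_cong)
    finally show ?thesis using 3 by (simp add: val infsumI)
  qed
qed

theorem entropy_spectral:
  assumes A: "supported n A" and S: "spectral n A U p"
  shows "entropy A = - (\<Sum>k<n. p k * ln (p k))"
proof -
  have col: "(\<Sum>k<n. cnj (U k i) * U k j) = of_bool (i = j)" if "i < n" "j < n" for i j
    using S that by (auto simp: unitary_on_def spectral_def)
  let ?f = "\<lambda>x::real. x * ln x"
  have "op_trace (op_fun ?f A) = (\<Sum>i<n. op_fun ?f A i i)"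
    unfolding op_trace_def
    by (rule infsum_lessThan) (simp add: op_fun_spectral[where f = ?f, OF A S])
  also have "\<dots> = (\<Sum>i<n. \<Sum>l<n. U i l * of_real (?f (p l)) * cnj (U i l))"
    by (intro sum.cong refl) (simp add: op_fun_spectral[where f = ?f, OF A S])
  also have "\<dots> = (\<Sum>l<n. of_real (?f (p l)) * (\<Sum>i<n. cnj (U i l) * U i l))"
    by (subst sum.swap) (simp add: sum_distrib_left ac_simps)
  also have "\<dots> = (\<Sum>l<n. of_real (?f (p l)))"
    by (simp add: col)
  finally show ?thesis unfolding entropy_def by simp
qed


section \<open>The beam splitter and the attenuator\<close>

text \<open>The generator \<open>a\<^sup>\<dagger> b - a b\<^sup>\<dagger>\<close> acting on real
  amplitudes. Where a subtraction truncates, the square root is 0.\<close>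

definition bs_gen :: "(nat \<times> nat \<Rightarrow> real) \<Rightarrow> nat \<times> nat \<Rightarrow> real" where
  "bs_gen v = (\<lambda>(m, k). sqrt (real m * real (k + 1)) * v (m - 1, k + 1)
     - sqrt (real (m + 1) * real k) * v (m + 1, k - 1))"

lemma bs_gen_funpow_Suc:
  "(bs_gen ^^ Suc j) v (m, k) = sqrt (real m * real (k + 1)) * (bs_gen ^^ j) v (m - 1, k + 1)
     - sqrt (real (m + 1) * real k) * (bs_gen ^^ j) v (m + 1, k - 1)"
  unfolding funpow.simps o_apply by (simp only: bs_gen_def prod.case)

text \<open>Amplitude of |m, k> when |n, 0> is rotated by the angle x: each photon becomes a
  superposition of mode a with amplitude cos x and mode b with amplitude - sin x.\<close>

definition bs_amp :: "nat \<Rightarrow> real \<Rightarrow> nat \<times> nat \<Rightarrow> real" where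
  "bs_amp n x = (\<lambda>(m, k). of_bool (m + k = n) * sqrt (real (n choose k)) * cos x ^ m * (- sin x) ^ k)"

lemma bs_amp_0: "bs_amp n 0 (m, k) = of_bool ((m, k) = (n, 0))"
  by (cases k) (auto simp: bs_amp_def)

lemma bs_amp_le: "\<bar>bs_amp n x p\<bar> \<le> 2 ^ n"
proof (cases p)
  case (Pair m k)
  have 1: "sqrt (real (n choose k)) \<le> 2 ^ n"
  proof -
    have "real (n choose k) \<le> 2 ^ n"
      using binomial_le_pow2[of n k] by (metis of_nat_le_iff of_nat_numeral of_nat_power)
    also have "\<dots> \<le> (2 ^ n)\<^sup>2"
      by (simp add: power2_eq_square)
    finally show ?thesis by (rule real_le_lsqrt[rotated 1]) simp
  qed
  have 2: "\<bar>cos x ^ m * (- sin x) ^ k\<bar> \<le> 1"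
    unfolding abs_mult power_abs by (intro mult_le_one power_le_one) auto
  have "\<bar>sqrt (real (n choose k))\<bar> * \<bar>cos x ^ m * (- sin x) ^ k\<bar> \<le> 2 ^ n * 1"
    using 1 2 by (intro mult_mono) auto
  then show ?thesis
    unfolding Pair bs_amp_def by (simp add: abs_mult ac_simps)
qed

text \<open>The closed form solves the evolution equation of the generator: differentiating cos and
  sin produces the two neighbours, and the absorption identities for binomial coefficients supply
  the square roots.\<close>

lemma bs_amp_deriv: "((\<lambda>x. bs_amp n x p) has_real_derivative bs_gen (bs_amp n x) p) (at x)"
proof (cases p)
  case (Pair m k)
  show ?thesis
  proof (cases "m + k = n")
    case False
    then have "bs_gen (bs_amp n x) (m, k) = 0"
      by (cases m; cases k) (auto simp: bs_gen_def bs_amp_def)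
    moreover have "(\<lambda>x. bs_amp n x p) = (\<lambda>_. 0)"
      using False by (auto simp: bs_amp_def Pair)
    ultimately show ?thesis by (simp add: Pair)
  next
    case True
    have 1: "sqrt (real m * real (k + 1)) * bs_amp n x (m - 1, k + 1)
       = sqrt (real (n choose k)) * (real m * cos x ^ (m - 1) * (- sin x) ^ (k + 1))"
    proof (cases m)
      case (Suc m')
      have "(k + 1) * (n choose (k + 1)) = (n - k) * (n choose k)"
        using binomial_absorb_comp[of n k] binomial_absorption[of k n] True Suc
        by (metis Suc_eq_plus1 add_diff_cancel_right' binomial_absorb_comp mult.commute binomial_absorption)
      then have "real (k + 1) * real (n choose (k + 1)) = real m * real (n choose k)"
        using True by (metis add_diff_cancel_right' of_nat_mult)
      then have "real m * real (k + 1) * real (n choose (k + 1)) = (real m)\<^sup>2 * real (n choose k)"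
        by (simp add: power2_eq_square mult.assoc)
      then have "sqrt (real m * real (k + 1)) * sqrt (real (n choose (k + 1))) = real m * sqrt (real (n choose k))"
        by (metis real_sqrt_mult real_sqrt_abs abs_of_nat)
      then show ?thesis using True Suc by (simp add: bs_amp_def)
    qed simp
    have 2: "sqrt (real (m + 1) * real k) * bs_amp n x (m + 1, k - 1)
       = sqrt (real (n choose k)) * (real k * cos x ^ (m + 1) * (- sin x) ^ (k - 1))"
    proof (cases k)
      case (Suc k')
      have "k * (n choose k) = (n - k') * (n choose k')"
        using binomial_absorb_comp[of n k'] binomial_absorption[of k' n] True Suc by simp
      moreover have "n - k' = m + 1" using True Suc by simp
      ultimately have "real k * real (n choose k) = real (m + 1) * real (n choose k')"
        by (metis of_nat_mult)
      then have "real (m + 1) * real k * real (n choose k') = (real k)\<^sup>2 * real (n choose k)"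
        by (simp add: power2_eq_square ac_simps)
      then have "sqrt (real (m + 1) * real k) * sqrt (real (n choose k')) = real k * sqrt (real (n choose k))"
        by (metis real_sqrt_mult real_sqrt_abs abs_of_nat)
      then show ?thesis using True Suc by (simp add: bs_amp_def)
    qed simp
    have eq: "(\<lambda>x. bs_amp n x p) = (\<lambda>x. sqrt (real (n choose k)) * (cos x ^ m * (- sin x) ^ k))"
      using True by (simp add: bs_amp_def Pair mult.assoc)
    have "((\<lambda>x. sqrt (real (n choose k)) * (cos x ^ m * (- sin x) ^ k)) has_real_derivative
       sqrt (real (n choose k)) * (real m * cos x ^ (m - 1) * (- sin x) ^ (k + 1)
         - real k * cos x ^ (m + 1) * (- sin x) ^ (k - 1))) (at x)"
      by (auto intro!: derivative_eq_intros simp: algebra_simps)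
    then show ?thesis
      unfolding eq unfolding Pair bs_gen_def prod.case 1 2 by (simp add: right_diff_distrib)
  qed
qed

lemma bs_gen_funpow_deriv:
  "((\<lambda>x. (bs_gen ^^ j) (bs_amp n x) p) has_real_derivative (bs_gen ^^ Suc j) (bs_amp n x) p) (at x)"
proof (induction j arbitrary: p)
  case 0
  then show ?case by (simp add: bs_amp_deriv)
next
  case (Suc j)
  obtain m k where p: "p = (m, k)" by (cases p)
  have "((\<lambda>x. sqrt (real m * real (k + 1)) * (bs_gen ^^ j) (bs_amp n x) (m - 1, k + 1)
     - sqrt (real (m + 1) * real k) * (bs_gen ^^ j) (bs_amp n x) (m + 1, k - 1)) has_real_derivative
     sqrt (real m * real (k + 1)) * (bs_gen ^^ Suc j) (bs_amp n x) (m - 1, k + 1)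
     - sqrt (real (m + 1) * real k) * (bs_gen ^^ Suc j) (bs_amp n x) (m + 1, k - 1)) (at x)"
    by (intro DERIV_diff DERIV_cmult Suc.IH)
  then show ?case
    unfolding p bs_gen_funpow_Suc[of "Suc j"] unfolding bs_gen_funpow_Suc[of j _ m k] .
qed

text \<open>The generator preserves m + k = n, and there both square roots are at most n + 1; each
  application costs a factor of at most 2 (n + 1).\<close>

lemma bs_gen_funpow_le:
  assumes "\<And>p. \<bar>v p\<bar> \<le> B" and "\<And>m k. m + k \<noteq> n \<Longrightarrow> v (m, k) = 0"
  shows "\<bar>(bs_gen ^^ j) v (m, k)\<bar> \<le> B * (2 * real (n + 1)) ^ j \<and> (m + k \<noteq> n \<longrightarrow> (bs_gen ^^ j) v (m, k) = 0)"
proof (induction j arbitrary: m k)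
  case 0
  then show ?case using assms by simp
next
  case (Suc j)
  define u where "u = (bs_gen ^^ j) v"
  define M where "M = B * (2 * real (n + 1)) ^ j"
  have u: "\<bar>u p\<bar> \<le> M" for p
    using Suc unfolding u_def M_def by (cases p) blast
  have M: "0 \<le> M" using u[of "(0, 0)"] by linarith
  have u0: "m + k \<noteq> n \<Longrightarrow> u (m, k) = 0" for m k using Suc unfolding u_def by blast
  have "\<bar>bs_gen u (m, k)\<bar> \<le> M * (2 * real (n + 1)) \<and> (m + k \<noteq> n \<longrightarrow> bs_gen u (m, k) = 0)"
  proof (cases "m + k = n")
    case False
    then have "bs_gen u (m, k) = 0"
      by (cases m; cases k) (auto simp: bs_gen_def u0)
    then show ?thesis using M by simp
  next
    case True
    have "sqrt (real m * real (k + 1)) \<le> real (n + 1)"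
      using True by (intro real_le_lsqrt) (auto simp: power2_eq_square intro!: mult_mono)
    moreover have "sqrt (real (m + 1) * real k) \<le> real (n + 1)"
      using True by (intro real_le_lsqrt) (auto simp: power2_eq_square intro!: mult_mono)
    ultimately have "\<bar>sqrt (real m * real (k + 1)) * u (m - 1, k + 1)\<bar> \<le> real (n + 1) * M"
      "\<bar>sqrt (real (m + 1) * real k) * u (m + 1, k - 1)\<bar> \<le> real (n + 1) * M"
      unfolding abs_mult using u by (auto intro!: mult_mono)
    then show ?thesis using True unfolding bs_gen_def by (simp add: algebra_simps)
  qed
  then show ?case unfolding u_def M_def by (simp add: ac_simps)
qed

text \<open>Taylor's formula in place of uniqueness for a differential equation: the derivatives of
  the amplitude are powers of the generator applied to it, so the remainder is at most
  \<open>2 ^ n\<close> times a term of an exponential series.\<close>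

lemma bs_amp_sums:
  "(\<lambda>j. (bs_gen ^^ j) (bs_amp n 0) p / fact j * x ^ j) sums bs_amp n x p"
proof -
  obtain m k where p: "p = (m, k)" by (cases p)
  define R where "R J = bs_amp n x p - (\<Sum>j<J. (bs_gen ^^ j) (bs_amp n 0) p / fact j * x ^ j)" for J
  have R: "\<bar>R J\<bar> \<le> 2 ^ n * ((2 * real (n + 1) * \<bar>x\<bar>) ^ J / fact J)" for J
  proof -
    obtain t where "bs_amp n x p = (\<Sum>j<J. (bs_gen ^^ j) (bs_amp n 0) p / fact j * x ^ j)
        + (bs_gen ^^ J) (bs_amp n t) p / fact J * x ^ J"
      using Maclaurin_all_le[of "\<lambda>j x. (bs_gen ^^ j) (bs_amp n x) p" "\<lambda>x. bs_amp n x p" x J]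
        bs_gen_funpow_deriv by auto
    then have "\<bar>R J\<bar> = \<bar>(bs_gen ^^ J) (bs_amp n t) p\<bar> * (\<bar>x\<bar> ^ J / fact J)"
      by (simp add: R_def abs_mult power_abs)
    also have "\<dots> \<le> (2 ^ n * (2 * real (n + 1)) ^ J) * (\<bar>x\<bar> ^ J / fact J)"
      using bs_gen_funpow_le[of "bs_amp n t" "2 ^ n" n J m k] bs_amp_le
      by (intro mult_right_mono) (auto simp: p bs_amp_def)
    finally show ?thesis by (simp add: power_mult_distrib)
  qed
  have "(\<lambda>J. 2 ^ n * ((2 * real (n + 1) * \<bar>x\<bar>) ^ J / fact J)) \<longlonglongrightarrow> 2 ^ n * 0"
    using summable_LIMSEQ_zero[OF summable_exp[of "2 * real (n + 1) * \<bar>x\<bar>"]]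
    by (intro tendsto_intros) (simp add: field_simps)
  then have "R \<longlonglongrightarrow> 0"
    using R by (intro Lim_null_comparison[of R]) auto
  then have "(\<lambda>J. bs_amp n x p - R J) \<longlonglongrightarrow> bs_amp n x p - 0"
    by (intro tendsto_intros)
  then show ?thesis unfolding sums_def R_def by simp
qed

text \<open>The attenuator starts the second mode in the vacuum, so it sees the beam splitter
  through these columns.\<close>

lemma beam_splitter_column:
  "beam_splitter \<tau> (m, k) (n, 0) = of_real (bs_amp n (arccos (sqrt \<tau>)) (m, k))"
proof -
  define \<theta> where "\<theta> = arccos (sqrt \<tau>)"
  define A where "A = (\<lambda>i j. complex_of_real \<theta> *
     ((op_adj ladder \<otimes>\<^sub>o ladder) i j - (ladder \<otimes>\<^sub>o op_adj ladder) i j))"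
  have A: "A (m, k) (m', k') = of_real \<theta> *
     ((if m = Suc m' \<and> k' = Suc k then of_real (sqrt (real m) * sqrt (real k')) else 0)
      - (if m' = Suc m \<and> k = Suc k' then of_real (sqrt (real m') * sqrt (real k)) else 0))" for m k m' k'
    by (simp add: A_def op_tensor_def op_adj_def ladder_def)
  have pow: "op_power A j (m, k) (n, 0) = of_real (\<theta> ^ j * (bs_gen ^^ j) (bs_amp n 0) (m, k))" for j m k
  proof (induction j arbitrary: m k)
    case 0
    then show ?case by (simp add: op_id_def bs_amp_0)
  next
    case (Suc j)
    \<comment> \<open>The generator links (m, k) to two states. Their first components m - 1 and m +
      1 differ even for m = 0, and a neighbour that arises by truncation has coefficient 0.\<close>
    have "op_power A (Suc j) (m, k) (n, 0) = (\<Sum>q\<in>{(m - 1, k + 1), (m + 1, k - 1)}. A (m, k) q * op_power A j q (n, 0))"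
      unfolding op_power.simps op_times_def
      by (rule infsumI, rule has_sum_finite_neutralI[where B = "{(m - 1, k + 1), (m + 1, k - 1)}"])
        (auto simp: A split: if_splits)
    also have "\<dots> = A (m, k) (m - 1, k + 1) * op_power A j (m - 1, k + 1) (n, 0)
        + A (m, k) (m + 1, k - 1) * op_power A j (m + 1, k - 1) (n, 0)"
      by (subst sum.insert) auto
    also have "A (m, k) (m - 1, k + 1) = of_real (\<theta> * sqrt (real m * real (k + 1)))"
      by (cases m) (auto simp: A real_sqrt_mult)
    also have "A (m, k) (m + 1, k - 1) = - of_real (\<theta> * sqrt (real (m + 1) * real k))"
      by (cases k) (auto simp: A real_sqrt_mult)
    finally show ?case
      unfolding Suc.IH bs_gen_funpow_Suc by (simp add: algebra_simps)
  qed
  have "(\<lambda>j. complex_of_real ((bs_gen ^^ j) (bs_amp n 0) (m, k) / fact j * \<theta> ^ j)) sums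
      of_real (bs_amp n \<theta> (m, k))"
    by (intro sums_of_real bs_amp_sums)
  then have "(\<lambda>j. op_power A j (m, k) (n, 0) / fact j) sums of_real (bs_amp n \<theta> (m, k))"
    by (simp add: pow ac_simps)
  then show ?thesis
    unfolding beam_splitter_def \<theta>_def[symmetric] A_def[symmetric] op_exp_def by (simp add: sums_iff)
qed

section \<open>The attenuator as binomial loss of photons\<close>

text \<open>Conservation of the photon number leaves one term for each number k of lost photons,
  with input indices i + k and j + k. The signs from - sin \<theta> cancel between the two
  amplitudes.\<close>

lemma attenuator_entry:
  assumes \<rho>: "supported n \<rho>" and \<tau>: "0 \<le> \<tau>" "\<tau> \<le> 1"
  shows "attenuator \<tau> \<rho> i j = (\<Sum>k<n. of_real (sqrt (real ((i + k) choose k)) * sqrt (real ((j + k) choose k))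
     * sqrt \<tau> ^ (i + j) * (1 - \<tau>) ^ k) * \<rho> (i + k) (j + k))"
proof -
  define \<theta> where "\<theta> = arccos (sqrt \<tau>)"
  have c: "cos \<theta> = sqrt \<tau>" unfolding \<theta>_def by (rule cos_arccos) (use \<tau> in \<open>auto intro: order_trans[of _ 0]\<close>)
  have s: "sin \<theta> * sin \<theta> = 1 - \<tau>"
    using sin_cos_squared_add[of \<theta>] \<tau> by (simp add: c power2_eq_square)
  define b where "b i k = bs_amp (i + k) \<theta> (i, k)" for i k
  have B: "beam_splitter \<tau> (i, k) (m, 0) = of_bool (m = i + k) * of_real (b i k)" for i k m
    unfolding beam_splitter_column \<theta>_def[symmetric] b_def by (auto simp: bs_amp_def)
  have 1: "(beam_splitter \<tau> \<odot> (\<rho> \<otimes>\<^sub>o vacuum)) (i, k) (m, l) = of_bool (l = 0) * of_real (b i k) * \<rho> (i + k) m" for i k m l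
    unfolding op_times_def
    by (subst infsum_single[of "(i + k, 0)"]) (auto simp: op_tensor_def vacuum_def B)
  have 2: "(beam_splitter \<tau> \<odot> (\<rho> \<otimes>\<^sub>o vacuum) \<odot> op_adj (beam_splitter \<tau>)) (i, k) (j, k)
     = of_real (b i k * b j k) * \<rho> (i + k) (j + k)" for k
    unfolding op_times_def[of "beam_splitter \<tau> \<odot> (\<rho> \<otimes>\<^sub>o vacuum)"]
    by (subst infsum_single[of "(j + k, 0)"]) (auto simp: op_adj_def 1 B)
  have bb: "b i k * b j k = sqrt (real ((i + k) choose k)) * sqrt (real ((j + k) choose k))
     * sqrt \<tau> ^ (i + j) * (1 - \<tau>) ^ k" for k
  proof -
    have "b i k * b j k = sqrt (real ((i + k) choose k)) * sqrt (real ((j + k) choose k))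
     * cos \<theta> ^ (i + j) * ((- sin \<theta>) ^ k * (- sin \<theta>) ^ k)"
      by (simp add: b_def bs_amp_def power_add)
    also have "(- sin \<theta>) ^ k * (- sin \<theta>) ^ k = (1 - \<tau>) ^ k"
      by (simp add: power_mult_distrib[symmetric] s)
    finally show ?thesis by (simp add: c)
  qed
  have "attenuator \<tau> \<rho> i j = (\<Sum>k<n. of_real (b i k * b j k) * \<rho> (i + k) (j + k))"
    unfolding attenuator_def partial_trace_snd_def 2
    by (rule infsum_lessThan) (use \<rho> in \<open>auto simp: supported_def\<close>)
  then show ?thesis by (simp only: bb)
qed

lemma sum_pick:
  fixes f :: "nat \<Rightarrow> complex"
  assumes "k < N"
  shows "(\<Sum>b<N. f b * of_bool (b = k)) = f k"
proof -
  have "(\<Sum>b<N. f b * of_bool (b = k)) = (\<Sum>b<N. if b = k then f b else 0)"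
    by (intro sum.cong) auto
  then show ?thesis using assms by simp
qed

text \<open>Polarisation: reality of the quadratic form on \<open>e i + w * e j\<close> for w = 1
  and w = \<i> relates the imaginary and the real parts of \<open>A i j\<close> and
  \<open>A j i\<close>.\<close>

lemma op_psd_hermitian:
  assumes A: "op_psd A"
  shows "A j i = cnj (A i j)"
proof -
  define N where "N = Suc (i + j)"
  have N: "i < N" "j < N" by (auto simp: N_def)
  define e where "e k = (\<lambda>b. of_bool (b = k) :: complex)" for k :: nat
  have e: "sesq N A (e k) (e l) = A k l" if "k < N" "l < N" for k l
  proof -
    have "sesq N A (e k) (e l) = (\<Sum>a<N. A a l * of_bool (a = k))"
      unfolding sesq_def
    proof (intro sum.cong refl)
      fix a
      have "(\<Sum>b<N. cnj (e k a) * A a b * e l b) = cnj (e k a) * A a l"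
        unfolding e_def by (rule sum_pick[OF that(2)])
      also have "\<dots> = A a l * of_bool (a = k)" by (simp add: e_def)
      finally show "(\<Sum>b<N. cnj (e k a) * A a b * e l b) = A a l * of_bool (a = k)" .
    qed
    then show ?thesis using that by (simp only: sum_pick)
  qed
  have real: "Im (sesq N A c c) = 0" for c
    using A unfolding op_psd_def sesq_def by (meson complex_nonneg_Reals_iff)
  have diag: "Im (A k k) = 0" if "k < N" for k
    using real[of "e k"] e that by simp
  have im: "Im (A i i + w * A i j + cnj w * (A j i + w * A j j)) = 0" for w
    using real[of "\<lambda>x. 1 * e i x + w * e j x"] N
    unfolding sesq_comb_left sesq_comb_right by (simp add: e)
  from im[of 1] im[of \<i>] show ?thesis
    using diag[of i] diag[of j] N by (simp add: complex_eq_iff)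
qed

lemma sum_nonneg_Reals:
  fixes f :: "'a \<Rightarrow> complex"
  assumes "\<And>x. x \<in> S \<Longrightarrow> f x \<in> \<real>\<^sub>\<ge>\<^sub>0"
  shows "sum f S \<in> \<real>\<^sub>\<ge>\<^sub>0"
  using assms by (induction S rule: infinite_finite_induct) auto

text \<open>The Kraus form of the channel: up to a scalar, \<open>d k\<close> is the adjoint of the
  Kraus operator for k lost photons applied to \<open>c\<close>, so the quadratic form of the output
  is a nonnegative combination of quadratic forms of \<rho>.\<close>

lemma op_psd_attenuator:
  assumes A: "op_psd \<rho>" and \<rho>: "supported n \<rho>" and \<tau>: "0 \<le> \<tau>" "\<tau> \<le> 1"
  shows "op_psd (attenuator \<tau> \<rho>)"
  unfolding op_psd_def
proof (intro allI)
  fix N and c :: "nat \<Rightarrow> complex"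
  define g where "g i k = sqrt (real ((i + k) choose k)) * sqrt \<tau> ^ i" for i k
  define d where "d k i = (if k \<le> i then of_real (g (i - k) k) * c (i - k) else 0)" for k i
  have "(\<Sum>i<N. \<Sum>j<N. cnj (c i) * attenuator \<tau> \<rho> i j * c j)
      = (\<Sum>i<N. \<Sum>j<N. \<Sum>k<n. of_real ((1 - \<tau>) ^ k) * (cnj (d k (i + k)) * \<rho> (i + k) (j + k) * d k (j + k)))"
    unfolding attenuator_entry[OF \<rho> \<tau>] sum_distrib_left sum_distrib_right
    by (intro sum.cong refl) (simp add: d_def g_def power_add ac_simps)
  also have "\<dots> = (\<Sum>k<n. \<Sum>i<N. \<Sum>j<N. of_real ((1 - \<tau>) ^ k) * (cnj (d k (i + k)) * \<rho> (i + k) (j + k) * d k (j + k)))"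
    by (subst sum.swap[where B = "{..<n}"], rule sum.swap)
  also have "\<dots> = (\<Sum>k<n. of_real ((1 - \<tau>) ^ k) * (\<Sum>i<N + k. \<Sum>j<N + k. cnj (d k i) * \<rho> i j * d k j))"
  proof (intro sum.cong refl)
    fix k
    have shift: "(\<Sum>i<N + k. f i) = (\<Sum>i<N. f (i + k))" if "\<And>i. i < k \<Longrightarrow> f i = 0" for f :: "nat \<Rightarrow> complex"
    proof -
      have "(\<Sum>i<N + k. f i) = (\<Sum>i\<in>{k..<N + k}. f i)"
        using that by (intro sum.mono_neutral_right) auto
      then show ?thesis using sum.shift_bounds_nat_ivl[of f 0 k N] by (simp add: atLeast0LessThan)
    qed
    have "(\<Sum>i<N + k. \<Sum>j<N + k. cnj (d k i) * \<rho> i j * d k j)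
      = (\<Sum>i<N. \<Sum>j<N + k. cnj (d k (i + k)) * \<rho> (i + k) j * d k j)"
      by (rule shift) (simp add: d_def)
    also have "\<dots> = (\<Sum>i<N. \<Sum>j<N. cnj (d k (i + k)) * \<rho> (i + k) (j + k) * d k (j + k))"
      by (intro sum.cong refl shift) (simp add: d_def)
    finally show "(\<Sum>i<N. \<Sum>j<N. of_real ((1 - \<tau>) ^ k) * (cnj (d k (i + k)) * \<rho> (i + k) (j + k) * d k (j + k)))
      = of_real ((1 - \<tau>) ^ k) * (\<Sum>i<N + k. \<Sum>j<N + k. cnj (d k i) * \<rho> i j * d k j)"
      by (simp add: sum_distrib_left)
  qed
  also have "\<dots> \<in> \<real>\<^sub>\<ge>\<^sub>0"
  proof (rule sum_nonneg_Reals, rule nonneg_Reals_mult_I)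
    fix k
    show "complex_of_real ((1 - \<tau>) ^ k) \<in> \<real>\<^sub>\<ge>\<^sub>0" using \<tau> by (subst nonneg_Reals_of_real_iff) simp
    show "(\<Sum>i<N + k. \<Sum>j<N + k. cnj (d k i) * \<rho> i j * d k j) \<in> \<real>\<^sub>\<ge>\<^sub>0"
      using A unfolding op_psd_def by blast
  qed
  finally show "(\<Sum>i<N. \<Sum>j<N. cnj (c i) * attenuator \<tau> \<rho> i j * c j) \<in> \<real>\<^sub>\<ge>\<^sub>0" .
qed

lemma supported_attenuator:
  assumes \<rho>: "supported n \<rho>" and \<tau>: "0 \<le> \<tau>" "\<tau> \<le> 1"
  shows "supported n (attenuator \<tau> \<rho>)"
  unfolding supported_def attenuator_entry[OF \<rho> \<tau>]
  using \<rho> by (auto simp: supported_def intro!: sum.neutral)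

text \<open>On the diagonal, the weight of m photons spreads binomially over the number of
  survivors, with total \<open>(\<tau> + (1 - \<tau>)) ^ m\<close>.\<close>

lemma trace_attenuator:
  assumes \<rho>: "supported n \<rho>" and \<tau>: "0 \<le> \<tau>" "\<tau> \<le> 1"
  shows "(\<Sum>i<n. attenuator \<tau> \<rho> i i) = (\<Sum>i<n. \<rho> i i)"
proof -
  define h where "h i k = of_real (real ((i + k) choose k) * \<tau> ^ i * (1 - \<tau>) ^ k) * \<rho> (i + k) (i + k)" for i k
  have "(\<Sum>i<n. attenuator \<tau> \<rho> i i) = (\<Sum>i<n. \<Sum>k<n. h i k)"
    unfolding attenuator_entry[OF \<rho> \<tau>] h_def using \<tau>
    by (intro sum.cong refl) (simp add: power_add real_sqrt_mult[symmetric] power_mult_distrib[symmetric])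
  also have "\<dots> = (\<Sum>(i, k)\<in>{..<n} \<times> {..<n}. h i k)"
    by (rule sum.cartesian_product)
  also have "\<dots> = (\<Sum>(i, k)\<in>{(i, k). i + k < n}. h i k)"
    using \<rho> by (intro sum.mono_neutral_right) (auto simp: h_def supported_def, meson not_less)
  also have "\<dots> = (\<Sum>m<n. \<Sum>i\<le>m. h i (m - i))"
    by (rule sum.triangle_reindex)
  also have "\<dots> = (\<Sum>m<n. \<rho> m m)"
  proof (intro sum.cong refl)
    fix m
    have "(\<Sum>i\<le>m. h i (m - i)) = (\<Sum>i\<le>m. of_real (real (m choose i) * \<tau> ^ i * (1 - \<tau>) ^ (m - i))) * \<rho> m m"
      unfolding sum_distrib_right h_def by (intro sum.cong refl) (auto simp: binomial_symmetric[symmetric])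
    also have "(\<Sum>i\<le>m. complex_of_real (real (m choose i) * \<tau> ^ i * (1 - \<tau>) ^ (m - i))) = of_real ((\<tau> + (1 - \<tau>)) ^ m)"
      unfolding binomial_ring by simp
    finally show "(\<Sum>i\<le>m. h i (m - i)) = \<rho> m m" by simp
  qed
  finally show ?thesis .
qed

section \<open>First-order expansion in time\<close>

text \<open>The Lindblad generator \<open>a \<rho> a\<^sup>\<dagger> - (a\<^sup>\<dagger> a \<rho> +
  \<rho> a\<^sup>\<dagger> a) / 2\<close> in the Fock basis.\<close>

definition attenuator_gen :: "nat op \<Rightarrow> nat op" where
  "attenuator_gen \<rho> i j = of_real (sqrt (real (i + 1)) * sqrt (real (j + 1))) * \<rho> (i + 1) (j + 1)
     - of_real (real (i + j) / 2) * \<rho> i j"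

lemma exp_minus_sq:
  assumes "0 \<le> (x::real)"
  shows "1 - x \<le> exp (- x)" and "exp (- x) \<le> 1 - x + x\<^sup>2"
proof -
  show "1 - x \<le> exp (- x)" using exp_ge_add_one_self[of "- x"] by simp
  \<comment> \<open>The product equals \<open>1 + x ^ 3\<close>.\<close>
  have "(1 + x) * (1 - x + x\<^sup>2) \<ge> 1" using assms by (simp add: power2_eq_square algebra_simps)
  moreover have "exp x \<ge> 1 + x" by (rule exp_ge_add_one_self)
  ultimately have "1 \<le> exp x * (1 - x + x\<^sup>2)"
    by (smt (verit) assms mult_right_mono zero_less_mult_iff)
  then show "exp (- x) \<le> 1 - x + x\<^sup>2" by (simp add: exp_minus field_simps)
qed

text \<open>For transmissivity exp (- t) and a = (i + j) / 2 this is the weight of losing k photons: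
  to first order at most one is lost. The errors for k = 0, k = 1 and k \<ge> 2 are at most
  \<open>(a * t)\<^sup>2\<close>, \<open>(a + 1) * t\<^sup>2\<close> and \<open>t\<^sup>2\<close>,
  all covered by one constant.\<close>

lemma thinning_coeff_expansion:
  assumes t: "0 \<le> t" "t \<le> 1" and a: "0 \<le> (a::real)"
  shows "\<bar>exp (- (a * t)) * (1 - exp (- t)) ^ k - of_bool (k = 0) - t * (of_bool (k = 1) - a * of_bool (k = 0))\<bar>
     \<le> (a\<^sup>2 + a + 1) * t\<^sup>2"
proof -
  have at: "0 \<le> a * t" using t a by simp
  have e: "1 - a * t \<le> exp (- (a * t))" "exp (- (a * t)) \<le> 1 - a * t + (a * t)\<^sup>2" "0 \<le> exp (- (a * t))" "exp (- (a * t)) \<le> 1"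
    using exp_minus_sq[OF at] at by auto
  have s: "t - t\<^sup>2 \<le> 1 - exp (- t)" "1 - exp (- t) \<le> t" "0 \<le> 1 - exp (- t)"
    using exp_minus_sq[OF t(1)] t by auto
  consider "k = 0" | "k = 1" | "k \<ge> 2" by linarith
  then show ?thesis
  proof cases
    case 1
    have "(a * t)\<^sup>2 \<le> (a\<^sup>2 + a + 1) * t\<^sup>2"
      unfolding power_mult_distrib using a by (intro mult_right_mono) auto
    moreover have "0 \<le> (a * t)\<^sup>2" by simp
    ultimately show ?thesis using 1 e by (simp add: abs_le_iff mult.commute[of t a])
  next
    case 2
    have "exp (- (a * t)) * (1 - exp (- t)) \<le> 1 * t"
      using e s by (intro mult_mono) auto
    moreover have "t - (a + 1) * t\<^sup>2 \<le> exp (- (a * t)) * (1 - exp (- t))"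
    proof -
      have "exp (- (a * t)) * (t - t\<^sup>2) \<ge> (1 - a * t) * (t - t\<^sup>2)"
        using e t by (intro mult_right_mono) (auto simp: power2_eq_square mult_left_le)
      moreover have "exp (- (a * t)) * (1 - exp (- t)) \<ge> exp (- (a * t)) * (t - t\<^sup>2)"
        using e s by (intro mult_left_mono) auto
      moreover have "(1 - a * t) * (t - t\<^sup>2) = t - (a + 1) * t\<^sup>2 + a * t * t\<^sup>2"
        by (simp add: power2_eq_square algebra_simps)
      moreover have "0 \<le> a * t * t\<^sup>2" using at by simp
      ultimately show ?thesis by linarith
    qed
    moreover have "(a + 1) * t\<^sup>2 \<le> (a\<^sup>2 + a + 1) * t\<^sup>2"
      by (intro mult_right_mono) auto
    ultimately show ?thesis using 2 t by (simp add: abs_le_iff)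
  next
    case 3
    have "(1 - exp (- t)) ^ k \<le> t ^ k"
      using s by (intro power_mono) auto
    also have "\<dots> \<le> t\<^sup>2" using t 3 by (intro power_decreasing) auto
    finally have "exp (- (a * t)) * (1 - exp (- t)) ^ k \<le> 1 * t\<^sup>2"
      using e s by (intro mult_mono) auto
    also have "\<dots> \<le> (a\<^sup>2 + a + 1) * t\<^sup>2"
      using a by (intro mult_right_mono) auto
    finally show ?thesis using 3 e s by simp
  qed
qed

lemma attenuator_expansion:
  assumes \<rho>: "supported n \<rho>"
  shows "\<exists>C\<ge>0. \<forall>t\<in>{0..1}. cmod (attenuator (exp (- t)) \<rho> i j - \<rho> i j - of_real t * attenuator_gen \<rho> i j) \<le> C * t\<^sup>2"
proof -
  define a where "a = real (i + j) / 2"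
  define b where "b k = of_real (sqrt (real ((i + k) choose k)) * sqrt (real ((j + k) choose k))) * \<rho> (i + k) (j + k)" for k
  define f where "f t k = exp (- (a * t)) * (1 - exp (- t)) ^ k" for t k
  define e where "e t k = (of_bool (k = 0) + t * (of_bool (k = 1) - a * of_bool (k = 0)) :: real)" for t and k :: nat
  define C where "C = (\<Sum>k<n + 2. cmod (b k)) * (a\<^sup>2 + a + 1)"
  have a: "a \<ge> 0" by (simp add: a_def)
  have "cmod (attenuator (exp (- t)) \<rho> i j - \<rho> i j - of_real t * attenuator_gen \<rho> i j) \<le> C * t\<^sup>2"
    if t: "t \<in> {0..1}" for t
  proof -
    have sq: "sqrt (exp (- t)) ^ (i + j) = exp (- (a * t))"
    proof -
      have "sqrt (exp (- t)) = exp (- t / 2)"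
        by (rule real_sqrt_unique) (simp_all add: power2_eq_square exp_add[symmetric])
      then show ?thesis by (simp add: exp_of_nat_mult[symmetric] a_def)
    qed
    have "attenuator (exp (- t)) \<rho> i j = (\<Sum>k<n. of_real (f t k) * b k)"
      using t by (subst attenuator_entry[OF \<rho>]) (auto simp: sq f_def b_def ac_simps)
    \<comment> \<open>The longer range contains k = 0 and k = 1 for every n; the support of \<rho>
      makes the added terms vanish.\<close>
    also have "\<dots> = (\<Sum>k<n + 2. of_real (f t k) * b k)"
      using \<rho> by (intro sum.mono_neutral_left) (auto simp: b_def supported_def)
    finally have 1: "attenuator (exp (- t)) \<rho> i j = (\<Sum>k<n + 2. of_real (f t k) * b k)" .
    have "(\<Sum>k<n + 2. of_real (e t k) * b k) = (\<Sum>k\<in>{0, 1}. of_real (e t k) * b k)"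
      by (intro sum.mono_neutral_right) (auto simp: e_def)
    also have "\<dots> = \<rho> i j + of_real t * attenuator_gen \<rho> i j"
      by (simp add: e_def b_def attenuator_gen_def a_def algebra_simps)
    finally have 2: "\<rho> i j + of_real t * attenuator_gen \<rho> i j = (\<Sum>k<n + 2. of_real (e t k) * b k)" by simp
    have "attenuator (exp (- t)) \<rho> i j - \<rho> i j - of_real t * attenuator_gen \<rho> i j
       = (\<Sum>k<n + 2. of_real (f t k - e t k) * b k)"
      unfolding diff_diff_eq 1 2 by (simp add: sum_subtractf left_diff_distrib)
    also have "cmod \<dots> \<le> (\<Sum>k<n + 2. cmod (of_real (f t k - e t k) * b k))"
      by (rule norm_sum)
    also have "\<dots> \<le> (\<Sum>k<n + 2. (a\<^sup>2 + a + 1) * t\<^sup>2 * cmod (b k))"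
    proof (intro sum_mono)
      fix k
      have "\<bar>f t k - e t k\<bar> \<le> (a\<^sup>2 + a + 1) * t\<^sup>2"
        using thinning_coeff_expansion[of t a k] t a by (simp add: f_def e_def algebra_simps)
      then show "cmod (of_real (f t k - e t k) * b k) \<le> (a\<^sup>2 + a + 1) * t\<^sup>2 * cmod (b k)"
        unfolding norm_mult norm_of_real by (intro mult_right_mono) auto
    qed
    also have "\<dots> = C * t\<^sup>2"
      unfolding C_def sum_distrib_right by (intro sum.cong refl) (simp only: ac_simps)
    finally show ?thesis .
  qed
  moreover have "C \<ge> 0" unfolding C_def using a by (intro mult_nonneg_nonneg sum_nonneg) auto
  ultimately show ?thesis by blast
qed


section \<open>The entropy rate of passive states\<close>

text \<open>The summand for \<open>n = 0\<close> vanishes, so that the truncated subtraction is harmless.\<close>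

definition death_rate :: "nat \<Rightarrow> (nat \<Rightarrow> real) \<Rightarrow> real" where
  "death_rate m p = (\<Sum>n<m. real n * p n * (ln (p (n - 1)) - ln (p n)))"

lemma sum_by_parts:
  fixes c L :: "nat \<Rightarrow> real"
  shows "(\<Sum>j<Suc M. c j * L j) = c M * (\<Sum>j<Suc M. L j) - (\<Sum>j<M. (\<Sum>i<Suc j. L i) * (c (Suc j) - c j))"
  by (induction M) (simp_all add: algebra_simps)

text \<open>
  Only the partial sums of the flow into the states of the largest probability matter: the flow from
  a state outside to a state inside carries at most the weight \<open>p (k + 1)\<close>, the reverse flow at least
  that weight.
\<close>

lemma sorted_flow_bound:
  fixes A :: "nat \<Rightarrow> nat \<Rightarrow> real"
  assumes A: "\<And>i j. i < m \<Longrightarrow> j < m \<Longrightarrow> 0 \<le> A j i"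
    and rc: "\<And>j. j < m \<Longrightarrow> (\<Sum>i<m. A j i) - (\<Sum>i<m. A i j) \<le> 1"
    and pos: "\<And>i. i < m \<Longrightarrow> 0 < p i"
    and dec: "\<And>i j. i \<le> j \<Longrightarrow> j < m \<Longrightarrow> p j \<le> p i"
  shows "- death_rate m p \<le> (\<Sum>i<m. \<Sum>j<m. A j i * p i * (ln (p i) - ln (p j)))"
proof (cases m)
  case 0
  then show ?thesis by (simp add: death_rate_def)
next
  case (Suc M)
  \<comment> \<open>\<open>A j i\<close> is the rate of jumps from i to j, so \<open>L j\<close> is
    the net flow of probability into j.\<close>
  define L where "L j = (\<Sum>i<m. A j i * p i - A i j * p j)" for j
  have anti: "(\<Sum>j<k. \<Sum>i<k. A j i * q i - A i j * q j) = 0" for k and q :: "nat \<Rightarrow> real"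
    by (simp add: sum_subtractf) (rule sum.swap)
  have W: "(\<Sum>j<Suc k. L j) \<le> real (Suc k) * p (Suc k)" if k: "Suc k < m" for k
  proof -
    have split: "(\<Sum>i<m. f i) = (\<Sum>i<Suc k. f i) + (\<Sum>i\<in>{Suc k..<m}. f i)" for f :: "nat \<Rightarrow> real"
      using sum.atLeastLessThan_concat[of 0 "Suc k" m f] k by (simp add: atLeast0LessThan)
    have "(\<Sum>j<Suc k. L j) = (\<Sum>j<Suc k. \<Sum>i\<in>{Suc k..<m}. A j i * p i - A i j * p j)"
      unfolding L_def split sum.distrib anti by simp
    also have "\<dots> \<le> (\<Sum>j<Suc k. \<Sum>i\<in>{Suc k..<m}. A j i * p (Suc k) - A i j * p (Suc k))"
      using k A dec by (intro sum_mono diff_mono mult_left_mono) auto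
    \<comment> \<open>With equal weights the flow inside the block cancels again and can be put
      back, which completes the sums over i to those bounded by \<open>rc\<close>.\<close>
    also have "\<dots> = (\<Sum>j<Suc k. \<Sum>i<m. A j i * p (Suc k) - A i j * p (Suc k))"
      unfolding split sum.distrib using anti[where k = "Suc k" and q = "\<lambda>_. p (Suc k)"] by simp
    also have "\<dots> = (\<Sum>j<Suc k. ((\<Sum>i<m. A j i) - (\<Sum>i<m. A i j)) * p (Suc k))"
      by (simp add: sum_subtractf sum_distrib_right left_diff_distrib)
    also have "\<dots> \<le> (\<Sum>j<Suc k. 1 * p (Suc k))"
      using k rc pos by (intro sum_mono mult_right_mono) (auto intro: less_imp_le)
    finally show ?thesis by simp
  qed
  have "(\<Sum>i<m. \<Sum>j<m. A j i * p i * (ln (p i) - ln (p j)))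
      = (\<Sum>i<m. \<Sum>j<m. A j i * p i * ln (p i)) - (\<Sum>i<m. \<Sum>j<m. A j i * p i * ln (p j))"
    by (simp add: right_diff_distrib sum_subtractf)
  also have "(\<Sum>i<m. \<Sum>j<m. A j i * p i * ln (p j)) = (\<Sum>j<m. \<Sum>i<m. A j i * p i * ln (p j))"
    by (rule sum.swap)
  also have "(\<Sum>i<m. \<Sum>j<m. A j i * p i * ln (p i)) - \<dots> = - (\<Sum>j<m. ln (p j) * L j)"
    by (simp add: L_def sum_subtractf sum_distrib_left sum_negf[symmetric] algebra_simps)
  also have "\<dots> = (\<Sum>j<M. (\<Sum>i<Suc j. L i) * (ln (p (Suc j)) - ln (p j)))"
    using anti[where k = m and q = p] sum_by_parts[of "\<lambda>j. ln (p j)" L M] unfolding Suc L_def by simp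
  \<comment> \<open>The logarithms decrease along the order, so upper bounds on the partial sums
    become lower bounds.\<close>
  also have "\<dots> \<ge> (\<Sum>j<M. (real (Suc j) * p (Suc j)) * (ln (p (Suc j)) - ln (p j)))"
    using W pos dec Suc by (intro sum_mono mult_right_mono_neg) auto
  also have "(\<Sum>j<M. (real (Suc j) * p (Suc j)) * (ln (p (Suc j)) - ln (p j))) = - death_rate m p"
    unfolding death_rate_def Suc sum.lessThan_Suc_shift sum_negf[symmetric]
    by (simp add: algebra_simps sum_negf[symmetric] sum_subtractf)
  finally show ?thesis .
qed

lemma sorting_permutation:
  fixes p :: "nat \<Rightarrow> real"
  shows "\<exists>\<pi>. bij_betw \<pi> {..<m} {..<m} \<and> (\<forall>i j. i \<le> j \<longrightarrow> j < m \<longrightarrow> p (\<pi> j) \<le> p (\<pi> i))"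
proof -
  define xs where "xs = sort_key (\<lambda>i. - p i) [0..<m]"
  have l: "length xs = m" and d: "distinct xs" and s: "set xs = {..<m}"
    by (auto simp: xs_def)
  have "bij_betw ((!) xs) {..<m} {..<m}"
    using bij_betw_nth[OF d] l s by blast
  moreover have "p (xs ! j) \<le> p (xs ! i)" if "i \<le> j" "j < m" for i j
  proof -
    have "sorted (map (\<lambda>i. - p i) xs)" by (simp add: xs_def)
    from sorted_nth_mono[OF this that(1)] show ?thesis using that l by simp
  qed
  ultimately show ?thesis by blast
qed

text \<open>The flow bound for the pure death process, which jumps from i to i - 1 at rate i, with
  the states relabelled by \<pi>. Its row sums exceed its column sums by at most 1, and its flow
  computed in the original labels is \<open>- death_rate m p\<close>.\<close>

lemma death_rate_sorted:
  assumes pos: "\<And>i. i < m \<Longrightarrow> 0 < p i" and \<pi>: "bij_betw \<pi> {..<m} {..<m}"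
    and dec: "\<And>i j. i \<le> j \<Longrightarrow> j < m \<Longrightarrow> p (\<pi> j) \<le> p (\<pi> i)"
  shows "death_rate m p \<le> death_rate m (p \<circ> \<pi>)"
proof -
  define B where "B j i = (if i = Suc j then real i else 0)" for j i :: nat
  have re: "(\<Sum>i<m. f (\<pi> i)) = (\<Sum>i<m. f i)" for f :: "nat \<Rightarrow> real"
    by (rule sum.reindex_bij_betw[OF \<pi>])
  have in_m: "\<pi> i < m" if "i < m" for i using \<pi> that by (auto simp: bij_betw_def)
  have "- death_rate m (p \<circ> \<pi>) \<le> (\<Sum>i<m. \<Sum>j<m. B (\<pi> j) (\<pi> i) * (p \<circ> \<pi>) i * (ln ((p \<circ> \<pi>) i) - ln ((p \<circ> \<pi>) j)))"
  proof (rule sorted_flow_bound)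
    fix j assume j: "j < m"
    have "(\<Sum>i<m. B (\<pi> j) (\<pi> i)) - (\<Sum>i<m. B (\<pi> i) (\<pi> j)) = (\<Sum>i<m. B (\<pi> j) i) - (\<Sum>i<m. B i (\<pi> j))"
      by (simp add: re[of "\<lambda>i. B (\<pi> j) i"] re[of "\<lambda>i. B i (\<pi> j)"])
    moreover have "(\<Sum>i<m. B (\<pi> j) i) \<le> real (Suc (\<pi> j))"
      unfolding B_def by (subst sum.delta) auto
    moreover have "(\<Sum>i<m. B i (\<pi> j)) = real (\<pi> j)"
    proof (cases "\<pi> j")
      case 0
      then show ?thesis by (simp add: B_def)
    next
      case (Suc k)
      have "(\<Sum>i<m. B i (\<pi> j)) = (\<Sum>i\<in>{k}. B i (\<pi> j))"
        using in_m[OF j] Suc by (intro sum.mono_neutral_right) (auto simp: B_def)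
      then show ?thesis by (simp add: B_def Suc)
    qed
    ultimately show "(\<Sum>i<m. B (\<pi> j) (\<pi> i)) - (\<Sum>i<m. B (\<pi> i) (\<pi> j)) \<le> 1" by simp
  qed (use pos in_m dec in \<open>auto simp: B_def\<close>)
  also have "\<dots> = (\<Sum>i<m. \<Sum>j<m. B (\<pi> j) i * p i * (ln (p i) - ln (p (\<pi> j))))"
    unfolding o_apply by (rule re[of "\<lambda>i. \<Sum>j<m. B (\<pi> j) i * p i * (ln (p i) - ln (p (\<pi> j)))"])
  also have "\<dots> = (\<Sum>i<m. \<Sum>j<m. B j i * p i * (ln (p i) - ln (p j)))"
  proof (rule sum.cong[OF refl])
    fix i
    show "(\<Sum>j<m. B (\<pi> j) i * p i * (ln (p i) - ln (p (\<pi> j)))) = (\<Sum>j<m. B j i * p i * (ln (p i) - ln (p j)))"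
      by (rule re[of "\<lambda>j. B j i * p i * (ln (p i) - ln (p j))"])
  qed
  also have "\<dots> = (\<Sum>i<m. - (real i * p i * (ln (p (i - 1)) - ln (p i))))"
  proof (intro sum.cong refl)
    fix i assume i: "i \<in> {..<m}"
    show "(\<Sum>j<m. B j i * p i * (ln (p i) - ln (p j))) = - (real i * p i * (ln (p (i - 1)) - ln (p i)))"
    proof (cases i)
      case 0
      then show ?thesis by (simp add: B_def)
    next
      case (Suc k)
      have "(\<Sum>j<m. B j i * p i * (ln (p i) - ln (p j))) = (\<Sum>j\<in>{k}. B j i * p i * (ln (p i) - ln (p j)))"
        using i Suc by (intro sum.mono_neutral_right) (auto simp: B_def)
      then show ?thesis by (simp add: B_def Suc algebra_simps)
    qed
  qed
  also have "\<dots> = - death_rate m p" by (simp add: death_rate_def sum_negf)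
  finally show ?thesis by simp
qed

section \<open>The maximum of F - \<mu> S over truncated distributions\<close>

definition lagr :: "real \<Rightarrow> nat \<Rightarrow> (nat \<Rightarrow> real) \<Rightarrow> real" where
  "lagr \<mu> m p = death_rate m p + \<mu> * (\<Sum>n<m. p n * ln (p n))"

lemma neg_ln_le_sqrt:
  assumes "0 \<le> (x::real)" "x \<le> 1"
  shows "x * \<bar>ln x\<bar> \<le> 2 * sqrt x"
proof (cases "x = 0")
  case False
  then have x: "x > 0" using assms by simp
  have "- ln x = 2 * ln (1 / sqrt x)"
    using x by (simp add: ln_div ln_sqrt)
  also have "\<dots> \<le> 2 * (1 / sqrt x)"
    using x ln_le_minus_one[of "1 / sqrt x"] by simp
  finally have "x * (- ln x) \<le> x * (2 * (1 / sqrt x))"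
    using x by (intro mult_left_mono) auto
  also have "\<dots> = 2 * (x / sqrt x)" by simp
  also have "\<dots> = 2 * sqrt x" using x by (simp only: real_div_sqrt)
  finally show ?thesis using x assms by simp
qed simp

text \<open>At the origin y ln x has no limit within the unit square, but for y \<le> x it is
  dominated by x |ln x|. This is what restricts the maximisation to decreasing sequences.\<close>

lemma continuous_on_mult_ln:
  "continuous_on {(x, y). 0 \<le> y \<and> y \<le> x \<and> x \<le> (1::real)} (\<lambda>z. snd z * ln (fst z))"
    (is "continuous_on ?K ?f")
  unfolding continuous_on_eq_continuous_within
proof
  fix z assume z: "z \<in> ?K"
  show "continuous (at z within ?K) ?f"
  proof (cases "fst z = 0")
    case False
    then show ?thesis by (intro continuous_intros) auto
  next
    case True
    then have z0: "z = (0, 0)" using z by (cases z) auto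
    have "((\<lambda>w. 2 * sqrt (fst w)) \<longlongrightarrow> 2 * sqrt (fst z)) (at z within ?K)"
      by (intro tendsto_intros)
    then have lim: "((\<lambda>w. 2 * sqrt (fst w)) \<longlongrightarrow> 0) (at z within ?K)" by (simp add: z0)
    have "norm (?f w) \<le> 2 * sqrt (fst w)" if "w \<in> ?K" for w
    proof -
      have "norm (?f w) \<le> fst w * \<bar>ln (fst w)\<bar>"
        using that by (auto simp: abs_mult intro!: mult_right_mono)
      also have "\<dots> \<le> 2 * sqrt (fst w)" using that by (intro neg_ln_le_sqrt) auto
      finally show ?thesis .
    qed
    then have "(?f \<longlongrightarrow> 0) (at z within ?K)"
      by (intro Lim_null_comparison[OF _ lim]) (auto simp: eventually_at_filter)
    then show ?thesis by (simp add: continuous_within z0)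
  qed
qed

text \<open>Decreasing distributions on N levels form a compact set on which \<open>lagr\<close> is
  continuous. The competitors \<open>q\<close> may be unsorted and shorter: sorting preserves the
  entropy and does not lower the death rate, and padding by zeros preserves both.\<close>

lemma lagr_maximum:
  assumes N: "0 < N"
  shows "\<exists>p. (\<forall>n. 0 \<le> p n) \<and> (\<forall>n\<ge>N. p n = 0) \<and> (\<Sum>n<N. p n) = 1 \<and> (\<forall>n. p (Suc n) \<le> p n) \<and>
     (\<forall>k\<le>N. \<forall>q. (\<forall>i<k. 0 < q i) \<longrightarrow> (\<Sum>i<k. q i) = 1 \<longrightarrow> lagr \<mu> k q \<le> lagr \<mu> N p)"
proof -
  define X where "X = {p :: nat \<Rightarrow> real. (\<forall>n. p n \<in> {0..1}) \<and> (\<forall>n\<ge>N. p n = 0) \<and> (\<Sum>n<N. p n) = 1 \<and> (\<forall>n. p (Suc n) \<le> p n)}"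
  have 1: "compact (Pi\<^sub>E UNIV (\<lambda>_::nat. {0..1::real}))"
    unfolding compactin_euclidean_iff[symmetric] euclidean_product_topology[symmetric]
    by (subst compactin_PiE) auto
  have "closed {p :: nat \<Rightarrow> real. (\<forall>n. N \<le> n \<longrightarrow> p n = 0) \<and> (\<Sum>n<N. p n) = 1 \<and> (\<forall>n. p (Suc n) \<le> p n)}"
    by (intro closed_Collect_conj closed_Collect_all closed_Collect_imp closed_Collect_eq closed_Collect_le
        continuous_intros continuous_on_coord open_Collect_const)
  from compact_Int_closed[OF 1 this] have X: "compact X"
    by (rule back_subst[of compact]) (auto simp: X_def PiE_def Pi_def)
  have "(\<lambda>n. of_bool (n = 0)) \<in> X"
    using N by (auto simp: X_def of_bool_def)
  then have ne: "X \<noteq> {}" by blast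
  have K: "continuous_on X (\<lambda>p. p n * ln (p k))" if "n = k \<or> n = Suc k" for n k
  proof -
    have "continuous_on X (\<lambda>p. snd (p k, p n) * ln (fst (p k, p n)))"
    proof (rule continuous_on_compose2[OF continuous_on_mult_ln])
      show "continuous_on X (\<lambda>p. (p k, p n))" by (intro continuous_intros continuous_on_coord)
      show "(\<lambda>p. (p k, p n)) ` X \<subseteq> {(x, y). 0 \<le> y \<and> y \<le> x \<and> x \<le> 1}"
        using that by (auto simp: X_def)
    qed
    then show ?thesis by simp
  qed
  have eq: "lagr \<mu> N p = (\<Sum>n<N. real n * (p n * ln (p (n - 1)) - p n * ln (p n)) + \<mu> * (p n * ln (p n)))" for p
    unfolding lagr_def death_rate_def sum_distrib_left sum.distrib[symmetric]
    by (intro sum.cong refl) (simp add: algebra_simps)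
  have cont: "continuous_on X (lagr \<mu> N)"
    unfolding eq
  proof (intro continuous_on_sum)
    fix n
    show "continuous_on X (\<lambda>p. real n * (p n * ln (p (n - 1)) - p n * ln (p n)) + \<mu> * (p n * ln (p n)))"
      by (intro continuous_on_add continuous_on_diff continuous_on_mult continuous_on_const K) auto
  qed
  obtain p where p: "p \<in> X" and pmax: "\<And>q. q \<in> X \<Longrightarrow> lagr \<mu> N q \<le> lagr \<mu> N p"
    using continuous_attains_sup[OF X ne cont] by blast
  have "lagr \<mu> k q \<le> lagr \<mu> N p" if k: "k \<le> N" and q: "\<And>i. i < k \<Longrightarrow> 0 < q i" and q1: "(\<Sum>i<k. q i) = 1" for k q
  proof -
    obtain \<pi> where \<pi>: "bij_betw \<pi> {..<k} {..<k}"
      and dec: "\<And>i j. i \<le> j \<Longrightarrow> j < k \<Longrightarrow> q (\<pi> j) \<le> q (\<pi> i)"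
      using sorting_permutation by blast
    have re: "(\<Sum>i<k. f (\<pi> i)) = (\<Sum>i<k. f i)" for f :: "nat \<Rightarrow> real"
      by (rule sum.reindex_bij_betw[OF \<pi>])
    have in_k: "\<pi> i < k" if "i < k" for i using \<pi> that by (auto simp: bij_betw_def)
    define p' where "p' n = (if n < k then q (\<pi> n) else 0)" for n
    have ext: "(\<Sum>n<N. f n) = (\<Sum>n<k. g n)" if "\<And>n. n \<ge> k \<Longrightarrow> f n = 0" "\<And>n. n < k \<Longrightarrow> f n = g n" for f g :: "nat \<Rightarrow> real"
      using that k by (intro sum.mono_neutral_cong_right) auto
    have s: "(\<Sum>n<N. p' n) = 1"
      using ext[of p' "\<lambda>n. q (\<pi> n)"] re[of q] q1 by (simp add: p'_def)
    have nn: "0 \<le> p' n" for n using q in_k by (auto simp: p'_def intro: less_imp_le)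
    have "p' n \<le> 1" for n
    proof (cases "n < N")
      case True
      then show ?thesis using s nn member_le_sum[of n "{..<N}" p'] by auto
    next
      case False
      then show ?thesis using k by (simp add: p'_def)
    qed
    moreover have "p' (Suc n) \<le> p' n" for n
      using dec[of n "Suc n"] nn[of n] by (auto simp: p'_def)
    ultimately have "p' \<in> X" using s nn k by (auto simp: X_def p'_def)
    then have "lagr \<mu> N p' \<le> lagr \<mu> N p" by (rule pmax)
    moreover have "lagr \<mu> N p' = lagr \<mu> k (q \<circ> \<pi>)"
    proof -
      have "death_rate N p' = death_rate k (q \<circ> \<pi>)"
        unfolding death_rate_def by (rule ext) (auto simp: p'_def)
      moreover have "(\<Sum>n<N. p' n * ln (p' n)) = (\<Sum>n<k. (q \<circ> \<pi>) n * ln ((q \<circ> \<pi>) n))"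
        by (rule ext) (auto simp: p'_def)
      ultimately show ?thesis by (simp add: lagr_def)
    qed
    moreover have "death_rate k q \<le> death_rate k (q \<circ> \<pi>)"
      by (rule death_rate_sorted) (use q \<pi> dec in auto)
    then have "lagr \<mu> k q \<le> lagr \<mu> k (q \<circ> \<pi>)"
      using re[of "\<lambda>i. q i * ln (q i)"] by (simp add: lagr_def)
    ultimately show ?thesis by linarith
  qed
  then show ?thesis using p unfolding X_def by (intro exI[of _ p]) auto
qed

text \<open>The partial derivative of \<open>lagr\<close> in \<open>p n\<close>; the term with
  \<open>p (n + 1)\<close> comes from the next summand.\<close>

definition lagr_grad :: "real \<Rightarrow> (nat \<Rightarrow> real) \<Rightarrow> nat \<Rightarrow> real" where
  "lagr_grad \<mu> p n = real n * (ln (p (n - 1)) - ln (p n)) - real n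
     + real (n + 1) * p (n + 1) / p n + \<mu> * (ln (p n) + 1)"

lemma lagr_has_derivative:
  assumes pos: "\<And>n. n < m \<Longrightarrow> 0 < p n" and end0: "p m = 0"
  shows "((\<lambda>s. lagr \<mu> m (\<lambda>n. p n + s * v n)) has_real_derivative (\<Sum>n<m. v n * lagr_grad \<mu> p n)) (at 0)"
proof -
  have "((\<lambda>s. \<Sum>n<m. real n * (p n + s * v n) * (ln (p (n - 1) + s * v (n - 1)) - ln (p n + s * v n))
        + \<mu> * ((p n + s * v n) * ln (p n + s * v n))) has_real_derivative
     (\<Sum>n<m. real n * (v n * (ln (p (n - 1)) - ln (p n)) + p n * (v (n - 1) / p (n - 1) - v n / p n))
        + \<mu> * (v n * ln (p n) + v n))) (at 0)"
  proof (rule DERIV_sum)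
    fix n assume "n \<in> {..<m}"
    then have "0 < p n" "0 < p (n - 1)" using pos by auto
    then show "((\<lambda>s. real n * (p n + s * v n) * (ln (p (n - 1) + s * v (n - 1)) - ln (p n + s * v n))
        + \<mu> * ((p n + s * v n) * ln (p n + s * v n))) has_real_derivative
        real n * (v n * (ln (p (n - 1)) - ln (p n)) + p n * (v (n - 1) / p (n - 1) - v n / p n))
        + \<mu> * (v n * ln (p n) + v n)) (at 0)"
      by (auto intro!: derivative_eq_intros simp: algebra_simps)
  qed
  moreover have "(\<Sum>n<m. real n * (p n + s * v n) * (ln (p (n - 1) + s * v (n - 1)) - ln (p n + s * v n))
        + \<mu> * ((p n + s * v n) * ln (p n + s * v n))) = lagr \<mu> m (\<lambda>n. p n + s * v n)" for s
    by (simp add: lagr_def death_rate_def sum.distrib sum_distrib_left)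
  moreover have "(\<Sum>n<m. real n * (v n * (ln (p (n - 1)) - ln (p n)) + p n * (v (n - 1) / p (n - 1) - v n / p n))
        + \<mu> * (v n * ln (p n) + v n)) = (\<Sum>n<m. v n * lagr_grad \<mu> p n)"
  proof -
    \<comment> \<open>The dependence of summand n on \<open>p (n - 1)\<close> is booked under n - 1;
      the new top term contains \<open>p m = 0\<close>.\<close>
    have shift: "(\<Sum>n<m. real n * p n * (v (n - 1) / p (n - 1))) = (\<Sum>n<m. real (n + 1) * p (n + 1) * (v n / p n))"
    proof (cases m)
      case (Suc k)
      then show ?thesis
        using end0 by (subst Suc, subst sum.lessThan_Suc_shift) simp
    qed simp
    have "(\<Sum>n<m. real n * (v n * (ln (p (n - 1)) - ln (p n)) + p n * (v (n - 1) / p (n - 1) - v n / p n))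
        + \<mu> * (v n * ln (p n) + v n))
      = (\<Sum>n<m. real n * v n * (ln (p (n - 1)) - ln (p n)) - real n * v n + \<mu> * (v n * ln (p n) + v n))
        + (\<Sum>n<m. real n * p n * (v (n - 1) / p (n - 1)))"
      unfolding sum.distrib[symmetric]
    proof (intro sum.cong refl)
      fix n assume "n \<in> {..<m}"
      then have "p n * (v n / p n) = v n" using pos[of n] by simp
      then show "real n * (v n * (ln (p (n - 1)) - ln (p n)) + p n * (v (n - 1) / p (n - 1) - v n / p n))
          + \<mu> * (v n * ln (p n) + v n)
        = real n * v n * (ln (p (n - 1)) - ln (p n)) - real n * v n + \<mu> * (v n * ln (p n) + v n)
          + real n * p n * (v (n - 1) / p (n - 1))"
        unfolding right_diff_distrib by (simp only:) (simp add: algebra_simps)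
    qed
    also have "\<dots> = (\<Sum>n<m. v n * lagr_grad \<mu> p n)"
      unfolding shift sum.distrib[symmetric]
      by (intro sum.cong refl) (simp add: lagr_grad_def algebra_simps add_divide_distrib)
    finally show ?thesis .
  qed
  ultimately show ?thesis by simp
qed

text \<open>If the support ended at M < N, moving mass s from level 0 to level M would change
  \<open>lagr\<close> by an amount of order s plus \<open>- (real M - \<mu>) * s * ln s\<close>. As
  M \<ge> 1 > \<mu>, the latter is positive and wins for small s.\<close>

lemma lagr_maximum_positive:
  assumes N: "0 < N" and \<mu>: "\<mu> < 1" and p0: "\<And>n. 0 \<le> p n" and pN: "\<And>n. n \<ge> N \<Longrightarrow> p n = 0"
    and p1: "(\<Sum>n<N. p n) = 1" and dec: "\<And>n. p (Suc n) \<le> p n"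
    and max: "\<And>k q. k \<le> N \<Longrightarrow> (\<And>i. i < k \<Longrightarrow> 0 < q i) \<Longrightarrow> (\<Sum>i<k. q i) = 1 \<Longrightarrow> lagr \<mu> k q \<le> lagr \<mu> N p"
    and n: "n < N"
  shows "0 < p n"
proof -
  define M where "M = (LEAST n. p n = 0)"
  have pM: "p M = 0" unfolding M_def by (rule LeastI[of _ N]) (simp add: pN)
  have MN: "M \<le> N" unfolding M_def by (rule Least_le) (simp add: pN)
  have pos: "0 < p n" if "n < M" for n
    using not_less_Least[of n "\<lambda>n. p n = 0"] that p0[of n] unfolding M_def by force
  have zero: "p n = 0" if "n \<ge> M" for n
    using lift_Suc_antimono_le[of p, OF dec that] pM p0[of n] by simp
  have sumM: "(\<Sum>n<M. p n) = 1"
    using p1 zero MN by (subst sum.mono_neutral_left[of "{..<N}"]) auto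
  have M: "0 < M" using sumM by (cases M) auto
  have lagrM: "lagr \<mu> N p = lagr \<mu> M p"
    unfolding lagr_def death_rate_def using zero MN
    by (intro arg_cong2[where f="(+)"] arg_cong2[where f="(*)"] refl sum.mono_neutral_right) auto
  have "\<not> M < N"
  proof
    assume "M < N"
    define v where "v n = (if n = 0 then - 1 else 0 :: real)" for n :: nat
    define \<phi> where "\<phi> s = lagr \<mu> M (\<lambda>n. p n + s * v n)" for s
    define D where "D = (\<Sum>n<M. v n * lagr_grad \<mu> p n)"
    have D: "(\<phi> has_real_derivative D) (at 0)"
      unfolding \<phi>_def D_def by (rule lagr_has_derivative) (use pos pM in auto)
    then have "((\<lambda>s. (\<phi> s - \<phi> 0) / s) \<longlongrightarrow> D) (at 0)"
      by (simp add: DERIV_def)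
    then have l1: "((\<lambda>s. (\<phi> s - \<phi> 0) / s) \<longlongrightarrow> D) (at_right 0)"
      by (rule filterlim_mono) (auto simp: at_le)
    \<comment> \<open>For M = 1 the predecessor of the new level is the level 0 that gives up the
      mass, hence the term \<open>s * v (M - 1)\<close>.\<close>
    have l2: "((\<lambda>s. real M * ln (p (M - 1) + s * v (M - 1))) \<longlongrightarrow> real M * ln (p (M - 1) + 0 * v (M - 1))) (at_right 0)"
      using pos[of "M - 1"] M by (intro tendsto_intros) auto
    have l3: "filterlim (\<lambda>s. - (real M - \<mu>) * ln s) at_top (at_right 0)"
      using M \<mu> by (subst filterlim_tendsto_neg_mult_at_top_iff[OF tendsto_const]) (auto intro: ln_at_0)
    have lim: "filterlim (\<lambda>s. ((\<phi> s - \<phi> 0) / s + real M * ln (p (M - 1) + s * v (M - 1))) + - (real M - \<mu>) * ln s) at_top (at_right 0)"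
      by (rule filterlim_tendsto_add_at_top[OF tendsto_add[OF l1 l2] l3])
    have "\<forall>\<^sub>F s in at_right 0. 1 \<le> (\<phi> s - \<phi> 0) / s + real M * ln (p (M - 1) + s * v (M - 1)) + - (real M - \<mu>) * ln s"
      using lim unfolding filterlim_at_top by blast
    moreover have "\<forall>\<^sub>F s in at_right 0. s \<in> {0<..<p 0}"
      using pos[OF M] by (rule eventually_at_right_real)
    ultimately have "\<forall>\<^sub>F s in at_right (0::real). False"
    proof eventually_elim
      case (elim s)
      define q where "q n = (if n = M then s else p n + s * v n)" for n
      have q_pos: "0 < q n" if "n < Suc M" for n
        using elim pos[of n] that by (auto simp: q_def v_def)
      have "(\<Sum>n<Suc M. q n) = (\<Sum>n<M. p n + s * v n) + s"
        by (simp add: q_def)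
      also have "(\<Sum>n<M. p n + s * v n) = 1 - s"
        using M by (simp add: sum.distrib sumM sum_distrib_left[symmetric] v_def)
      finally have "(\<Sum>n<Suc M. q n) = 1" by simp
      with max[of "Suc M" q] q_pos \<open>M < N\<close> have "lagr \<mu> (Suc M) q \<le> lagr \<mu> N p" by simp
      also have "\<dots> = \<phi> 0" by (simp add: lagrM \<phi>_def)
      finally have le: "lagr \<mu> (Suc M) q \<le> \<phi> 0" .
      have "lagr \<mu> (Suc M) q = \<phi> s + real M * s * (ln (p (M - 1) + s * v (M - 1)) - ln s) + \<mu> * (s * ln s)"
      proof -
        have "death_rate M q = death_rate M (\<lambda>n. p n + s * v n)"
          unfolding death_rate_def by (intro sum.cong refl) (auto simp: q_def)
        moreover have "(\<Sum>n<M. q n * ln (q n)) = (\<Sum>n<M. (p n + s * v n) * ln (p n + s * v n))"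
          by (intro sum.cong refl) (auto simp: q_def)
        moreover have "death_rate (Suc M) q = death_rate M q + real M * s * (ln (p (M - 1) + s * v (M - 1)) - ln s)"
          using M unfolding death_rate_def by (auto simp: q_def)
        ultimately show ?thesis
          unfolding \<phi>_def lagr_def by (simp add: q_def algebra_simps)
      qed
      with le have "(\<phi> s - \<phi> 0) + s * (real M * ln (p (M - 1) + s * v (M - 1)) + - (real M - \<mu>) * ln s) \<le> 0"
        by (simp add: algebra_simps)
      moreover have "(\<phi> s - \<phi> 0) + s * (real M * ln (p (M - 1) + s * v (M - 1)) + - (real M - \<mu>) * ln s)
        = s * ((\<phi> s - \<phi> 0) / s + real M * ln (p (M - 1) + s * v (M - 1)) + - (real M - \<mu>) * ln s)"
        using elim by (simp add: distrib_left)
      ultimately show False using elim by (simp add: mult_le_0_iff)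
    qed
    then show False by simp
  qed
  then show ?thesis using pos n by auto
qed

text \<open>Moving mass between the levels 0 and k keeps the total, and as all weights are positive
  both directions are admissible.\<close>

lemma lagr_maximum_stationary:
  assumes pos: "\<And>n. n < N \<Longrightarrow> 0 < p n" and pN: "p N = 0"
    and p1: "(\<Sum>n<N. p n) = 1"
    and max: "\<And>q. (\<And>i. i < N \<Longrightarrow> 0 < q i) \<Longrightarrow> (\<Sum>i<N. q i) = 1 \<Longrightarrow> lagr \<mu> N q \<le> lagr \<mu> N p"
    and k: "k < N"
  shows "lagr_grad \<mu> p k = lagr_grad \<mu> p 0"
proof (cases "k = 0")
  case False
  define v where "v n = (of_bool (n = k) - of_bool (n = 0) :: real)" for n
  have d: "((\<lambda>s. lagr \<mu> N (\<lambda>n. p n + s * v n)) has_real_derivative (\<Sum>n<N. v n * lagr_grad \<mu> p n)) (at 0)"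
    by (rule lagr_has_derivative) (use pos pN in auto)
  have pk: "0 < p 0" "0 < p k" using pos k by auto
  have s1: "(\<Sum>n<N. v n * f n) = f k - f 0" for f
  proof -
    have "(\<Sum>n<N. v n * f n) = (\<Sum>n<N. (if n = k then f n else 0) - (if n = 0 then f n else 0))"
      by (intro sum.cong) (auto simp: v_def)
    then show ?thesis using k by (simp add: sum_subtractf)
  qed
  have "(\<Sum>n<N. v n * lagr_grad \<mu> p n) = 0"
  proof (rule DERIV_local_max[OF d, of "min (p 0) (p k)"])
    show "0 < min (p 0) (p k)" using pk by simp
    show "\<forall>s. \<bar>0 - s\<bar> < min (p 0) (p k) \<longrightarrow> lagr \<mu> N (\<lambda>n. p n + s * v n) \<le> lagr \<mu> N (\<lambda>n. p n + 0 * v n)"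
    proof (intro allI impI)
      fix s assume s: "\<bar>0 - s\<bar> < min (p 0) (p k)"
      have "lagr \<mu> N (\<lambda>n. p n + s * v n) \<le> lagr \<mu> N p"
      proof (rule max)
        fix i assume "i < N"
        then show "0 < p i + s * v i"
          using pos[of i] s False by (auto simp: v_def abs_less_iff)
      next
        show "(\<Sum>i<N. p i + s * v i) = 1"
          using s1[of "\<lambda>_. s"] by (simp add: sum.distrib p1 mult.commute)
      qed
      then show "lagr \<mu> N (\<lambda>n. p n + s * v n) \<le> lagr \<mu> N (\<lambda>n. p n + 0 * v n)" by simp
    qed
  qed
  then show ?thesis unfolding s1 by simp
qed simp

text \<open>Euler's identity: F is homogeneous of degree 1 and the entropy term adds \<mu>, so
  \<open>lagr\<close> is the common value of the gradient minus \<mu>. That value is read off at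
  level 0, where the logarithmic ratio has factor 0.\<close>

lemma lagr_stationary_value:
  assumes pos: "\<And>n. n < N \<Longrightarrow> 0 < p n" and pN: "p N = 0" and p1: "(\<Sum>n<N. p n) = 1"
    and stat: "\<And>k. k < N \<Longrightarrow> lagr_grad \<mu> p k = lagr_grad \<mu> p 0"
  shows "lagr \<mu> N p = p 1 / p 0 + \<mu> * ln (p 0)"
proof -
  have "lagr \<mu> N p = (\<Sum>n<N. p n * lagr_grad \<mu> p n - p n * \<mu> + (real n * p n - real (Suc n) * p (Suc n)))"
    unfolding lagr_def death_rate_def sum_distrib_left sum.distrib[symmetric]
  proof (intro sum.cong refl)
    fix n assume "n \<in> {..<N}"
    then have "p n > 0" using pos by simp
    then show "real n * p n * (ln (p (n - 1)) - ln (p n)) + \<mu> * (p n * ln (p n)) =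
        p n * lagr_grad \<mu> p n - p n * \<mu> + (real n * p n - real (Suc n) * p (Suc n))"
      by (simp add: lagr_grad_def field_simps)
  qed
  also have "\<dots> = (\<Sum>n<N. p n * lagr_grad \<mu> p n) - \<mu> + (\<Sum>n<N. real n * p n - real (Suc n) * p (Suc n))"
    by (simp add: sum.distrib sum_subtractf sum_distrib_right[symmetric] p1)
  finally have 1: "lagr \<mu> N p = (\<Sum>n<N. p n * lagr_grad \<mu> p n) - \<mu> + (\<Sum>n<N. real n * p n - real (Suc n) * p (Suc n))" .
  have 2: "(\<Sum>n<N. real n * p n - real (Suc n) * p (Suc n)) = 0"
    by (subst sum_lessThan_telescope'[of "\<lambda>n. real n * p n"]) (simp add: pN)
  have "(\<Sum>n<N. p n * lagr_grad \<mu> p n) = (\<Sum>n<N. p n * lagr_grad \<mu> p 0)"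
    by (intro sum.cong refl arg_cong2[where f = "(*)"] stat) simp
  also have "\<dots> = lagr_grad \<mu> p 0" by (simp add: sum_distrib_right[symmetric] p1)
  finally show ?thesis unfolding 1 2 by (simp add: lagr_grad_def algebra_simps)
qed

section \<open>The recursion for the ratios and the geometric bound\<close>

text \<open>The Lagrange multiplier for which the geometric distribution of ratio \<open>z\<close> is stationary.\<close>

definition geom_mult :: "real \<Rightarrow> real" where
  "geom_mult z = 1 - (1 - z) / (- ln z)"

lemma neg_ln_bounds:
  assumes "0 < (z::real)" "z < 1"
  shows "1 - z < - ln z" "- ln z < (1 - z) / z"
proof -
  show "1 - z < - ln z"
    using assms ln_less_self ln_add_one_self_less_self[of "z - 1"] by (smt (verit) ln_eq_minus_one ln_le_minus_one)
  have "- ln z = ln (1 / z)" using assms by (simp add: ln_div)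
  also have "\<dots> < 1 / z - 1"
    using assms ln_le_minus_one[of "1 / z"] ln_eq_minus_one[of "1 / z"] by (auto simp: less_le)
  also have "\<dots> = (1 - z) / z" using assms by (simp add: field_simps)
  finally show "- ln z < (1 - z) / z" .
qed

text \<open>The third quantity is the derivative at z of \<open>1 - r + (1 - \<mu>) ln r\<close>.
  Its sign makes z a repelling fixed point of the recursion for the ratios.\<close>

lemma geom_mult_bounds:
  assumes "0 < z" "z < 1"
  shows "0 < geom_mult z" "geom_mult z < 1" "0 < (1 - geom_mult z) / z - 1"
proof -
  have L: "0 < - ln z" using assms by simp
  show "0 < geom_mult z" "geom_mult z < 1"
    using neg_ln_bounds[OF assms] L assms by (auto simp: geom_mult_def field_simps)
  have "z < 1 - geom_mult z"
    using neg_ln_bounds(2)[OF assms] L assms by (auto simp: geom_mult_def field_simps)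
  then show "0 < (1 - geom_mult z) / z - 1" using assms by (simp add: field_simps)
qed

text \<open>The concave function \<open>r \<mapsto> 1 - r + (1 - \<mu>) ln r\<close> has the zeros \<open>z\<close> and \<open>1\<close>.\<close>

lemma geom_chord:
  assumes z: "0 < z" "z < 1" and r: "z \<le> r" "r \<le> 1"
  shows "r \<le> 1 + (1 - geom_mult z) * ln r"
proof -
  define s where "s = (1 - r) / (1 - z)"
  have s: "0 \<le> s" "s \<le> 1" using z r by (auto simp: s_def)
  have "s * (1 - z) = 1 - r" using z by (simp add: s_def)
  then have rs: "r = (1 - s) *\<^sub>R 1 + s *\<^sub>R z" by (simp add: algebra_simps)
  have "convex_on {0<..} (\<lambda>x::real. - ln x)"
    using ln_concave by (simp add: concave_on_def)
  from convex_onD[OF this s, of 1 z] have "- ln r \<le> (1 - s) * (- ln 1) + s * (- ln z)"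
    unfolding rs using z by simp
  then have "- ln r \<le> s * (- ln z)" by simp
  moreover have g: "(1 - geom_mult z) * (- ln z) = 1 - z"
    using z by (simp add: geom_mult_def)
  moreover have "0 \<le> 1 - geom_mult z" using geom_mult_bounds[OF z] by simp
  ultimately have "(1 - geom_mult z) * (- ln r) \<le> (1 - geom_mult z) * (s * (- ln z))"
    by (intro mult_left_mono)
  also have "\<dots> = s * (1 - z)" using g by (metis mult.left_commute)
  also have "\<dots> = 1 - r" using z by (simp add: s_def)
  finally show ?thesis by simp
qed

text \<open>Concavity through the tangent at the zero z, which gives a linear deficit for r below z;
  the chord serves r between z and 1.\<close>

lemma geom_tangent:
  assumes z: "0 < z" "z < 1" and r: "0 < r"
  shows "1 + (1 - geom_mult z) * ln r \<le> r - ((1 - geom_mult z) / z - 1) * (z - r)"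
proof -
  have "ln r - ln z = ln (r / z)" using z r by (simp add: ln_div)
  also have "\<dots> \<le> r / z - 1" using z r by (intro ln_le_minus_one) simp
  finally have "ln r \<le> ln z + (r - z) / z" using z by (simp add: field_simps)
  then have "(1 - geom_mult z) * ln r \<le> (1 - geom_mult z) * (ln z + (r - z) / z)"
    using geom_mult_bounds[OF z] by (intro mult_left_mono) auto
  also have "\<dots> = (1 - geom_mult z) * ln z + (1 - geom_mult z) * ((r - z) / z)"
    by (simp add: distrib_left)
  also have "(1 - geom_mult z) * ln z = z - 1"
    using z by (simp add: geom_mult_def)
  finally have "(1 - geom_mult z) * ln r \<le> z - 1 + (1 - geom_mult z) * ((r - z) / z)" .
  moreover have "((1 - geom_mult z) / z - 1) * (z - r) = - ((1 - geom_mult z) * ((r - z) / z)) - (z - r)"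
    using z by (simp add: field_simps)
  ultimately show ?thesis by linarith
qed

text \<open>
  The ratios \<open>r n = p n / p (n - 1)\<close> of a stationary point move away from the fixed point \<open>z\<close>, and
  they end at \<open>0\<close>.
\<close>

locale stationary_ratios =
  fixes z :: real and N :: nat and r :: "nat \<Rightarrow> real"
  assumes z: "0 < z" "z < 1" and N: "0 < N"
    and r_pos: "\<And>n. 1 \<le> n \<Longrightarrow> n < N \<Longrightarrow> 0 < r n" and r_le: "\<And>n. 1 \<le> n \<Longrightarrow> n < N \<Longrightarrow> r n \<le> 1"
    and r_end: "r N = 0"
    and rec: "\<And>n. 1 \<le> n \<Longrightarrow> n < N \<Longrightarrow> real (n + 1) * r (n + 1) = 1 + real n * r n
      + (real n - geom_mult z) * ln (r n) - real (n - 1) * ln (r (n - 1))"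
begin

text \<open>Separates \<open>1 + (1 - \<mu>) ln (r n)\<close>, whose comparison with
  \<open>r n\<close> depends on the side of z, from a term with the sign of the previous increment,
  so that monotonicity propagates. For n = 1 the value \<open>r 0\<close> has factor 0.\<close>

lemma rec':
  assumes "1 \<le> n" "n < N"
  shows "real (n + 1) * r (n + 1) = real n * r n + (1 + (1 - geom_mult z) * ln (r n))
    + real (n - 1) * (ln (r n) - ln (r (n - 1)))"
  using rec[OF assms] assms by (simp add: algebra_simps of_nat_diff)

text \<open>Ratios starting at or above z would never decrease, by the chord bound, against
  \<open>r N = 0\<close>.\<close>

lemma first_less: "r 1 < z"
proof (rule ccontr)
  assume "\<not> r 1 < z"
  then have 1: "z \<le> r 1" by simp
  have "1 \<le> n \<Longrightarrow> n \<le> N \<Longrightarrow> z \<le> r n \<and> (1 < n \<longrightarrow> r (n - 1) \<le> r n)" for n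
  proof (induction n rule: nat_induct_at_least)
    case base
    then show ?case using 1 by simp
  next
    case (Suc n)
    then have n: "1 \<le> n" "n < N" by auto
    have IH: "z \<le> r n" "1 < n \<longrightarrow> r (n - 1) \<le> r n" using Suc by auto
    have "0 \<le> real (n - 1) * (ln (r n) - ln (r (n - 1)))"
    proof (cases "1 < n")
      case True
      then have "ln (r (n - 1)) \<le> ln (r n)" using IH r_pos[of "n - 1"] r_pos[of n] n by (subst ln_le_cancel_iff) auto
      then show ?thesis by simp
    qed simp
    moreover have "r n \<le> 1 + (1 - geom_mult z) * ln (r n)"
      using geom_chord[OF z IH(1) r_le[OF n]] .
    ultimately have "real (n + 1) * r n \<le> real (n + 1) * r (n + 1)"
      unfolding rec'[OF n] by (simp add: algebra_simps)
    then have "r n \<le> r (Suc n)" by (simp add: mult_le_cancel_left)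
    then show ?case using IH by auto
  qed
  from this[of N] have "z \<le> r N" using N by simp
  then show False using z r_end by simp
qed

text \<open>Repulsion made quantitative: below z, each step loses at least a fixed multiple of
  \<open>z - r n\<close>, divided by n + 1.\<close>

lemma decrement:
  assumes n: "1 \<le> n" "n < N" and prev: "1 < n \<Longrightarrow> r n \<le> r (n - 1)"
  shows "r (Suc n) \<le> r n - ((1 - geom_mult z) / z - 1) * (z - r n) / real (Suc n)"
proof -
  have "real (n - 1) * (ln (r n) - ln (r (n - 1))) \<le> 0"
  proof (cases "1 < n")
    case True
    then have "ln (r n) \<le> ln (r (n - 1))" using prev r_pos[of "n - 1"] r_pos[of n] n by (subst ln_le_cancel_iff) auto
    then show ?thesis by (simp add: mult_nonneg_nonpos)
  qed simp
  then have "real (n + 1) * r (n + 1) \<le> real n * r n + (r n - ((1 - geom_mult z) / z - 1) * (z - r n))"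
    using geom_tangent[OF z r_pos[OF n]] unfolding rec'[OF n] by simp
  also have "\<dots> = real (n + 1) * r n - ((1 - geom_mult z) / z - 1) * (z - r n)"
    by (simp add: algebra_simps)
  finally show ?thesis by (simp add: field_simps)
qed

lemma less_and_decreasing:
  "1 \<le> n \<Longrightarrow> n \<le> N \<Longrightarrow> r n < z \<and> (1 < n \<longrightarrow> r n \<le> r (n - 1))"
proof (induction n rule: nat_induct_at_least)
  case base
  then show ?case using first_less by simp
next
  case (Suc n)
  then have n: "1 \<le> n" "n < N" and IH: "r n < z" "1 < n \<Longrightarrow> r n \<le> r (n - 1)" by auto
  have "0 \<le> ((1 - geom_mult z) / z - 1) * (z - r n) / real (Suc n)"
    using geom_mult_bounds(3)[OF z] IH(1) by simp
  then have "r (Suc n) \<le> r n" using decrement[OF n IH(2)] by linarith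
  then show ?case using IH by simp
qed

text \<open>Once a ratio is at most q, the losses dominate a multiple of the harmonic series, while
  the whole descent to \<open>r N = 0\<close> is less than z. Since the series diverges, N cannot
  lie far beyond n.\<close>

lemma small_ratio_bounds_length:
  assumes n: "1 \<le> n" "n \<le> N" and q: "r n \<le> q" "q < z"
  shows "((1 - geom_mult z) / z - 1) * (z - q) * (harm N - harm n) \<le> z"
proof -
  define c where "c = (1 - geom_mult z) / z - 1"
  have c: "c > 0" using geom_mult_bounds(3)[OF z] by (simp add: c_def)
  have "n \<le> k \<Longrightarrow> k \<le> N \<Longrightarrow> r k \<le> q \<and> r k \<le> r n - c * (z - q) * (harm k - harm n)" for k
  proof (induction k rule: nat_induct_at_least)
    case base
    then show ?case using q by simp
  next
    case (Suc k)
    then have k: "1 \<le> k" "k < N" and IH: "r k \<le> q" "r k \<le> r n - c * (z - q) * (harm k - harm n)"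
      using n by auto
    have "r (Suc k) \<le> r k - c * (z - r k) / real (Suc k)"
      using decrement[OF k] less_and_decreasing[of k] k by (simp add: c_def)
    moreover have "c * (z - q) / real (Suc k) \<le> c * (z - r k) / real (Suc k)"
      using c IH by (intro divide_right_mono mult_left_mono) auto
    ultimately have 1: "r (Suc k) \<le> r k - c * (z - q) / real (Suc k)" by linarith
    moreover have "0 \<le> c * (z - q) / real (Suc k)" using c q by simp
    moreover have "c * (z - q) * (harm (Suc k) - harm n) = c * (z - q) * (harm k - harm n) + c * (z - q) / real (Suc k)"
      by (simp add: harm_Suc algebra_simps divide_inverse)
    ultimately show ?case using IH by linarith
  qed
  from this[of N] have "0 \<le> r n - c * (z - q) * (harm N - harm n)" using n r_end by simp
  then show ?thesis using q by (simp add: c_def)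
qed

end

text \<open>A maximiser on N \<ge> m levels dominates \<open>p\<close>, and N is taken so large that
  none of the first n0 ratios can be at most q. Then \<open>P n \<ge> P 0 * q ^ n\<close> up to n0,
  normalisation bounds \<open>P 0\<close>, and the maximal value
  \<open>P 1 / P 0 + \<mu> * ln (P 0)\<close> is estimated with \<open>r 1 < z\<close>.\<close>

lemma lagr_le_partial:
  assumes z: "0 < z" "z < 1" and p: "\<And>n. n < m \<Longrightarrow> 0 < p n" "(\<Sum>n<m. p n) = 1"
    and q: "0 < q" "q < z"
  shows "lagr (geom_mult z) m p \<le> z - geom_mult z * ln (\<Sum>n\<le>n0. q ^ n)"
proof -
  define \<mu> where "\<mu> = geom_mult z"
  define c where "c = (1 - geom_mult z) / z - 1"
  have c: "c > 0" using geom_mult_bounds(3)[OF z] by (simp add: c_def)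
  have \<mu>: "0 < \<mu>" "\<mu> < 1" using geom_mult_bounds[OF z] by (auto simp: \<mu>_def)
  have "\<exists>N. m \<le> N \<and> n0 < N \<and> harm n0 + z / (c * (z - q)) < harm N"
  proof -
    have "filterlim (\<lambda>n. ln (real n + 1)) at_top sequentially" by real_asymp
    then have "\<forall>\<^sub>F n in sequentially. harm n0 + z / (c * (z - q)) < ln (real n + 1)"
      by (simp add: filterlim_at_top_dense)
    moreover have "\<forall>\<^sub>F n in sequentially. m \<le> n" by (rule eventually_ge_at_top)
    moreover have "\<forall>\<^sub>F n in sequentially. n0 < n" by (rule eventually_gt_at_top)
    ultimately have "\<forall>\<^sub>F n in sequentially. m \<le> n \<and> n0 < n \<and> harm n0 + z / (c * (z - q)) < harm n"
    proof eventually_elim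
      case (elim n)
      then show ?case using ln_le_harm[of n] by simp
    qed
    then show ?thesis using eventually_happens'[OF sequentially_bot] by blast
  qed
  then obtain N where Nm: "m \<le> N" "n0 < N" and hN: "harm n0 + z / (c * (z - q)) < harm N" by blast
  have N0: "0 < N" using Nm by simp
  obtain P where P0: "\<And>n. 0 \<le> P n" and PN: "\<And>n. n \<ge> N \<Longrightarrow> P n = 0" and P1: "(\<Sum>n<N. P n) = 1"
    and dec: "\<And>n. P (Suc n) \<le> P n"
    and Pmax: "\<And>k q. k \<le> N \<Longrightarrow> (\<And>i. i < k \<Longrightarrow> 0 < q i) \<Longrightarrow> (\<Sum>i<k. q i) = 1 \<Longrightarrow> lagr \<mu> k q \<le> lagr \<mu> N P"
    using lagr_maximum[OF N0, of \<mu>] by blast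
  have pos: "0 < P n" if "n < N" for n
    by (rule lagr_maximum_positive[OF N0 \<mu>(2) P0 PN P1 dec Pmax that])
  have PN0: "P N = 0" using PN by simp
  have stat: "lagr_grad \<mu> P k = lagr_grad \<mu> P 0" if "k < N" for k
    by (rule lagr_maximum_stationary[OF pos PN0 P1 _ that]) (use Pmax in auto)
  define r where "r n = P n / P (n - 1)" for n
  interpret stationary_ratios z N r
  proof
    show "0 < z" "z < 1" "0 < N" using z Nm by auto
    show "r N = 0" by (simp add: r_def PN0)
    fix n assume n: "1 \<le> n" "n < N"
    then have Pn: "0 < P n" "0 < P (n - 1)" using pos by auto
    then show "0 < r n" by (simp add: r_def)
    show "r n \<le> 1" using dec[of "n - 1"] Pn n by (simp add: r_def)
    \<comment> \<open>Subtracting the stationarity equations of neighbouring levels eliminates the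
      multiplier of the normalisation.\<close>
    have "lagr_grad \<mu> P n = lagr_grad \<mu> P (n - 1)" using stat[of n] stat[of "n - 1"] n by simp
    moreover have "real (n - 1) * (ln (P (n - 1 - 1)) - ln (P (n - 1))) = - real (n - 1) * ln (r (n - 1))"
    proof (cases "n = 1")
      case False
      then have "0 < P (n - 1 - 1)" using n pos by simp
      then show ?thesis using Pn by (simp add: r_def ln_div right_diff_distrib)
    qed simp
    moreover have "ln (P n) = ln (P (n - 1)) + ln (r n)" using Pn by (simp add: r_def ln_div)
    moreover have "real (n + 1) * P (n + 1) / P n = real (n + 1) * r (n + 1)"
      "real (n - 1 + 1) * P (n - 1 + 1) / P (n - 1) = real n * r n"
      using n by (auto simp: r_def)
    ultimately show "real (n + 1) * r (n + 1) = 1 + real n * r n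
      + (real n - geom_mult z) * ln (r n) - real (n - 1) * ln (r (n - 1))"
      unfolding lagr_grad_def \<mu>_def[symmetric] using n by (simp add: algebra_simps of_nat_diff)
  qed
  have rq: "q < r n" if n: "1 \<le> n" "n \<le> n0" for n
  proof (rule ccontr)
    assume "\<not> q < r n"
    then have "c * (z - q) * (harm N - harm n) \<le> z"
      using small_ratio_bounds_length[of n q] n Nm q by (simp add: c_def)
    then have "harm N - harm n \<le> z / (c * (z - q))"
      using c q by (simp add: field_simps)
    moreover have "harm n \<le> (harm n0 :: real)" using n by (rule_tac harm_mono) simp
    ultimately show False using hN by simp
  qed
  have P_ge: "P 0 * q ^ n \<le> P n" if "n \<le> n0" for n
    using that
  proof (induction n)
    case (Suc n)
    have "P 0 * q ^ Suc n \<le> P n * q" using Suc q by simp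
    also have "\<dots> \<le> P n * r (Suc n)" using rq[of "Suc n"] Suc P0[of n] by (intro mult_left_mono) auto
    also have "\<dots> = P (Suc n)" using pos[of n] Suc Nm by (simp add: r_def)
    finally show ?case .
  qed simp
  have "P 0 * (\<Sum>n\<le>n0. q ^ n) \<le> (\<Sum>n\<le>n0. P n)"
    unfolding sum_distrib_left using P_ge by (intro sum_mono) auto
  also have "\<dots> \<le> (\<Sum>n<N. P n)" using Nm P0 by (intro sum_mono2) auto
  finally have le1: "P 0 * (\<Sum>n\<le>n0. q ^ n) \<le> 1" by (simp add: P1)
  have S: "0 < (\<Sum>n\<le>n0. q ^ n)" using q by (intro sum_pos) auto
  have "ln (P 0 * (\<Sum>n\<le>n0. q ^ n)) \<le> 0"
    using le1 pos[OF N0] S by (simp add: ln_le_zero_iff)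
  then have lnP: "ln (P 0) \<le> - ln (\<Sum>n\<le>n0. q ^ n)"
    using pos[OF N0] S by (simp add: ln_mult)
  have "lagr \<mu> m p \<le> lagr \<mu> N P" using Pmax[OF Nm(1)] p by blast
  also have "\<dots> = P 1 / P 0 + \<mu> * ln (P 0)"
    by (rule lagr_stationary_value[OF pos PN0 P1 stat])
  also have "\<dots> \<le> z + \<mu> * (- ln (\<Sum>n\<le>n0. q ^ n))"
    using first_less \<mu> lnP by (intro add_mono mult_left_mono) (auto simp: r_def)
  finally show ?thesis by (simp add: \<mu>_def)
qed

text \<open>Two limits, n0 to infinity and then q to z from the left. At q = z itself the guaranteed
  descent, proportional to z - q, would vanish.\<close>

theorem lagr_le_geometric:
  assumes z: "0 < z" "z < 1" and p: "\<And>n. n < m \<Longrightarrow> 0 < p n" "(\<Sum>n<m. p n) = 1"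
  shows "lagr (geom_mult z) m p \<le> z + geom_mult z * ln (1 - z)"
proof -
  have 1: "lagr (geom_mult z) m p \<le> z - geom_mult z * ln (1 / (1 - q))" if q: "0 < q" "q < z" for q
  proof (rule tendsto_lowerbound)
    have "(\<lambda>n0. \<Sum>n\<le>n0. q ^ n) \<longlonglongrightarrow> 1 / (1 - q)"
      using geometric_sums[of q] q z by (simp add: sums_def_le)
    then show "(\<lambda>n0. z - geom_mult z * ln (\<Sum>n\<le>n0. q ^ n)) \<longlonglongrightarrow> z - geom_mult z * ln (1 / (1 - q))"
      using q z by (intro tendsto_intros) auto
    show "\<forall>\<^sub>F n0 in sequentially. lagr (geom_mult z) m p \<le> z - geom_mult z * ln (\<Sum>n\<le>n0. q ^ n)"
      using lagr_le_partial[OF z p q] by (intro always_eventually allI) auto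
  qed simp
  have "lagr (geom_mult z) m p \<le> z - geom_mult z * ln (1 / (1 - z))"
  proof (rule tendsto_lowerbound)
    show "((\<lambda>q. z - geom_mult z * ln (1 / (1 - q))) \<longlongrightarrow> z - geom_mult z * ln (1 / (1 - z))) (at_left z)"
      using z by (intro tendsto_intros) auto
    have "\<forall>\<^sub>F q in at_left z. q \<in> {0<..<z}" using z(1) by (rule eventually_at_left_real)
    then show "\<forall>\<^sub>F q in at_left z. lagr (geom_mult z) m p \<le> z - geom_mult z * ln (1 / (1 - q))"
      by eventually_elim (use 1 in auto)
  qed simp
  then show ?thesis using z by (simp add: ln_div)
qed

section \<open>The thermal entropy function and the bound for decreasing spectra\<close>

lemma g_ent_deriv:
  assumes "0 < E"
  shows "(g_ent has_real_derivative ln (E + 1) - ln E) (at E)"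
  unfolding g_ent_def using assms
  by (auto intro!: derivative_eq_intros)

lemma g_ent_pos:
  assumes "0 < E"
  shows "0 < g_ent E"
proof -
  have "E * ln E \<le> E * ln (E + 1)" using assms by (intro mult_left_mono) auto
  moreover have "0 < ln (E + 1)" using assms by simp
  ultimately show ?thesis unfolding g_ent_def by (simp add: algebra_simps)
qed

lemma g_ent_0: "g_ent 0 = 0"
  by (simp add: g_ent_def)

lemma inj_on_g_ent: "inj_on g_ent {0..}"
proof (rule linorder_inj_onI)
  fix a b :: real assume ab: "a < b" "a \<in> {0..}" "b \<in> {0..}"
  show "g_ent a \<noteq> g_ent b"
  proof (cases "a = 0")
    case True
    then show ?thesis using g_ent_pos[of b] ab by (simp add: g_ent_0)
  next
    case False
    have "g_ent a < g_ent b"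
    proof (rule DERIV_pos_imp_increasing[OF ab(1)])
      fix x assume "a \<le> x" "x \<le> b"
      then have "0 < x" using False ab by auto
      then show "\<exists>y. (g_ent has_real_derivative y) (at x) \<and> 0 < y"
        using g_ent_deriv[of x] by (intro exI[of _ "ln (x + 1) - ln x"]) auto
    qed
    then show ?thesis by simp
  qed
qed auto

lemma g_ent_inv_pos:
  assumes "0 < S"
  shows "0 < g_ent_inv S" "g_ent (g_ent_inv S) = S"
proof -
  have "(g_ent \<longlongrightarrow> 0) (at_right 0)" unfolding g_ent_def by real_asymp
  then have "\<forall>\<^sub>F x in at_right 0. g_ent x < S" using assms by (rule order_tendstoD)
  then obtain b where b: "b > 0" "\<And>x. 0 < x \<Longrightarrow> x < b \<Longrightarrow> g_ent x < S"
    unfolding eventually_at_right_field by blast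
  define a where "a = b / 2"
  have a: "0 < a" "g_ent a < S" using b by (auto simp: a_def)
  have "filterlim g_ent at_top at_top" unfolding g_ent_def by real_asymp
  then have "\<forall>\<^sub>F x in at_top. S \<le> g_ent x" by (simp add: filterlim_at_top)
  moreover have "\<forall>\<^sub>F x in at_top. a \<le> x" by (rule eventually_ge_at_top)
  ultimately have "\<forall>\<^sub>F x in at_top. S \<le> g_ent x \<and> a \<le> x" by (rule eventually_conj)
  then obtain c where c: "S \<le> g_ent c" "a \<le> c" using eventually_happens'[OF trivial_limit_at_top_linorder] by blast
  have "\<exists>E\<ge>a. E \<le> c \<and> g_ent E = S"
  proof (rule IVT)
    show "\<forall>x. a \<le> x \<and> x \<le> c \<longrightarrow> isCont g_ent x"
      using a DERIV_isCont[OF g_ent_deriv] by auto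
  qed (use a c in auto)
  then obtain E where E: "a \<le> E" "g_ent E = S" by blast
  then have "g_ent_inv S = E"
    unfolding g_ent_inv_def using a inv_into_f_f[OF inj_on_g_ent, of E] by auto
  then show "0 < g_ent_inv S" "g_ent (g_ent_inv S) = S" using a E by auto
qed

text \<open>The tangent is taken at the geometric distribution with the same entropy as
  \<open>p\<close>. There its right side collapses to \<open>E * L\<close>, where \<open>L\<close>
  is g'(E).\<close>

theorem death_rate_le_f_iso:
  assumes p: "\<And>n. n < m \<Longrightarrow> 0 < p n" "(\<Sum>n<m. p n) = 1"
  shows "f_iso (- (\<Sum>n<m. p n * ln (p n))) \<le> - death_rate m p"
proof -
  define S where "S = - (\<Sum>n<m. p n * ln (p n))"
  have p_le: "p n \<le> 1" if "n < m" for n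
    using member_le_sum[of n "{..<m}" p] p that by (auto intro: less_imp_le)
  have nn: "0 \<le> - (p n * ln (p n))" if "n < m" for n
    using p_le[OF that] p(1)[OF that] by (simp add: mult_nonneg_nonpos)
  have S_sum: "S = (\<Sum>n<m. - (p n * ln (p n)))" by (simp add: S_def sum_negf)
  then have S0: "0 \<le> S" using nn by (simp only:) (rule sum_nonneg, simp)
  show ?thesis
  proof (cases "S = 0")
    case True
    \<comment> \<open>Without entropy every \<open>p n\<close> is 1, so all logarithms vanish and
      both sides are 0.\<close>
    then have "\<forall>n\<in>{..<m}. - (p n * ln (p n)) = 0"
      unfolding S_sum using nn by (subst (asm) sum_nonneg_eq_0_iff) auto
    then have "ln (p n) = 0" if "n < m" for n using p(1)[OF that] that by force
    then have "death_rate m p = 0"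
      unfolding death_rate_def by (intro sum.neutral) auto
    then show ?thesis using True by (simp add: f_iso_def S_def)
  next
    case False
    then have S: "0 < S" using S0 by simp
    define E where "E = g_ent_inv S"
    have E: "0 < E" "g_ent E = S" using g_ent_inv_pos[OF S] by (auto simp: E_def)
    \<comment> \<open>The ratio of the geometric distribution of mean E.\<close>
    define z where "z = E / (E + 1)"
    define L where "L = ln (E + 1) - ln E"
    have z: "0 < z" "z < 1" using E by (auto simp: z_def)
    have lnz: "ln z = - L" using E by (simp add: z_def L_def ln_div)
    have lnz1: "ln (1 - z) = - ln (E + 1)"
    proof -
      have "1 - z = 1 / (E + 1)" using E by (simp add: z_def field_simps)
      then show ?thesis using E by (simp add: ln_div)
    qed
    have L: "0 < L" using lnz z by (smt (verit) ln_less_zero)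
    have muL: "geom_mult z * L = L - (1 - z)" using L by (simp add: geom_mult_def lnz field_simps)
    have "lagr (geom_mult z) m p \<le> z + geom_mult z * ln (1 - z)"
      by (rule lagr_le_geometric[OF z p])
    then have "death_rate m p \<le> z + geom_mult z * (S - ln (E + 1))"
      by (simp add: lagr_def S_def lnz1 algebra_simps)
    also have "S - ln (E + 1) = E * L"
      using E(2) by (simp add: g_ent_def L_def algebra_simps)
    also have "z + geom_mult z * (E * L) = z + E * (L - (1 - z))"
      by (simp add: muL[symmetric])
    also have "\<dots> = E * L"
    proof -
      have "E * (1 - z) = z" using E by (simp add: z_def field_simps)
      then show ?thesis by (simp add: algebra_simps)
    qed
    finally have "death_rate m p \<le> E * L" .
    moreover have "f_iso S = - (E * L)"
      using False DERIV_imp_deriv[OF g_ent_deriv[OF E(1)]] by (simp add: f_iso_def E_def[symmetric] L_def)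
    ultimately show ?thesis by (simp add: S_def)
  qed
qed


section \<open>Transition rates in the eigenbasis\<close>

lemma unitary_on_adj: "unitary_on n U \<Longrightarrow> unitary_on n (\<lambda>i j. cnj (U j i))"
  unfolding unitary_on_def by auto

lemma unitary_on_parseval:
  assumes "unitary_on n V"
  shows "(\<Sum>x<n. (cmod (\<Sum>a<n. V x a * d a))\<^sup>2) = (\<Sum>a<n. (cmod (d a))\<^sup>2)"
proof -
  have col: "(\<Sum>k<n. cnj (V k i) * V k j) = of_bool (i = j)" if "i < n" "j < n" for i j
    using assms that by (auto simp: unitary_on_def)
  have "complex_of_real (\<Sum>x<n. (cmod (\<Sum>a<n. V x a * d a))\<^sup>2)
      = (\<Sum>x<n. \<Sum>a<n. \<Sum>b<n. d a * cnj (d b) * (cnj (V x b) * V x a))"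
    unfolding of_real_sum complex_norm_square
    by (simp add: sum_product ac_simps)
  also have "\<dots> = (\<Sum>a<n. \<Sum>x<n. \<Sum>b<n. d a * cnj (d b) * (cnj (V x b) * V x a))"
    by (rule sum.swap)
  also have "\<dots> = (\<Sum>a<n. \<Sum>b<n. d a * cnj (d b) * (\<Sum>x<n. cnj (V x b) * V x a))"
    by (rule sum.cong[OF refl], subst sum.swap) (simp add: sum_distrib_left)
  also have "\<dots> = (\<Sum>a<n. d a * cnj (d a))"
  proof (rule sum.cong[OF refl])
    fix a assume a: "a \<in> {..<n}"
    have "(\<Sum>b<n. d a * cnj (d b) * (\<Sum>x<n. cnj (V x b) * V x a)) = (\<Sum>b<n. d a * cnj (d b) * of_bool (b = a))"
      using a by (intro sum.cong refl) (simp add: col)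
    then show "(\<Sum>b<n. d a * cnj (d b) * (\<Sum>x<n. cnj (V x b) * V x a)) = d a * cnj (d a)"
      using a by (simp only: sum_pick lessThan_iff)
  qed
  also have "\<dots> = complex_of_real (\<Sum>a<n. (cmod (d a))\<^sup>2)"
    by (simp only: of_real_sum complex_norm_square)
  finally show ?thesis by (simp only: of_real_eq_iff)
qed

lemma unitary_on_column_norm:
  assumes "unitary_on n U" "i < n"
  shows "(\<Sum>x<n. (cmod (U x i))\<^sup>2) = 1"
proof -
  have "(\<Sum>x<n. cnj (U x i) * U x i) = 1" using assms by (auto simp: unitary_on_def)
  then have "complex_of_real (\<Sum>x<n. (cmod (U x i))\<^sup>2) = 1"
    by (simp only: of_real_sum complex_norm_square mult.commute)
  then show ?thesis using of_real_eq_1_iff by blast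
qed

definition overlap :: "nat \<Rightarrow> nat op \<Rightarrow> nat op \<Rightarrow> nat op" where
  "overlap n V U a i = (\<Sum>x<n. cnj (V x a) * U x i)"

lemma overlap_sum_left:
  assumes "unitary_on n V" "unitary_on n U" "i < n"
  shows "(\<Sum>a<n. (cmod (overlap n V U a i))\<^sup>2) = 1"
  unfolding overlap_def
  using unitary_on_parseval[OF unitary_on_adj[OF assms(1)], of "\<lambda>x. U x i"] unitary_on_column_norm[OF assms(2,3)]
  by simp

lemma overlap_cnj: "overlap n V U a i = cnj (overlap n U V i a)"
  by (simp add: overlap_def mult.commute)

lemma overlap_sum_right:
  assumes "unitary_on n V" "unitary_on n U" "a < n"
  shows "(\<Sum>i<n. (cmod (overlap n V U a i))\<^sup>2) = 1"
  using overlap_sum_left[OF assms(2,1,3)] by (subst overlap_cnj) simp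

lemma overlap_expand:
  assumes V: "unitary_on n V" and x: "x < n"
  shows "U x i = (\<Sum>a<n. V x a * overlap n V U a i)"
proof -
  have row: "(\<Sum>k<n. V i k * cnj (V j k)) = of_bool (i = j)" if "i < n" "j < n" for i j
    using V that by (auto simp: unitary_on_def)
  have "(\<Sum>a<n. V x a * overlap n V U a i) = (\<Sum>y<n. U y i * (\<Sum>a<n. V x a * cnj (V y a)))"
    unfolding overlap_def sum_distrib_left by (subst sum.swap) (simp add: ac_simps)
  also have "\<dots> = (\<Sum>y<n. U y i * of_bool (y = x))"
    using x by (intro sum.cong refl) (simp add: row eq_commute)
  also have "\<dots> = U x i" by (rule sum_pick[OF x])
  finally show ?thesis by simp
qed

lemma spectral_apply:
  assumes S: "spectral n \<sigma> V q" and x: "x < n"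
  shows "(\<Sum>y<n. \<sigma> x y * U y i) = (\<Sum>a<n. V x a * (of_real (q a) * overlap n V U a i))"
proof -
  have V: "unitary_on n V" using S by (simp add: spectral_def)
  have "(\<Sum>y<n. \<sigma> x y * U y i) = (\<Sum>y<n. \<Sum>a<n. (V x a * of_real (q a)) * (cnj (V y a) * U y i))"
    using S x by (intro sum.cong refl) (simp add: spectral_def sum_distrib_right mult.assoc)
  also have "\<dots> = (\<Sum>a<n. V x a * (of_real (q a) * overlap n V U a i))"
    by (subst sum.swap) (simp add: overlap_def sum_distrib_left mult.assoc)
  finally show ?thesis .
qed

text \<open>The diagonal of \<sigma> in the basis \<open>U\<close> averages the eigenvalues of
  \<sigma> with the squared overlaps; for unitary \<open>U\<close> these weights are doubly
  stochastic.\<close>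

lemma overlap_mean:
  assumes S: "spectral n \<sigma> V q"
  shows "sesq n \<sigma> (\<lambda>x. U x i) (\<lambda>x. U x i) = of_real (\<Sum>a<n. (cmod (overlap n V U a i))\<^sup>2 * q a)"
proof -
  have "sesq n \<sigma> (\<lambda>x. U x i) (\<lambda>x. U x i) = (\<Sum>x<n. cnj (U x i) * (\<Sum>y<n. \<sigma> x y * U y i))"
    by (simp add: sesq_def sum_distrib_left mult.assoc)
  also have "\<dots> = (\<Sum>x<n. \<Sum>a<n. (cnj (U x i) * V x a) * (of_real (q a) * overlap n V U a i))"
    by (intro sum.cong refl) (simp add: spectral_apply[OF S] sum_distrib_left mult.assoc)
  also have "\<dots> = (\<Sum>a<n. overlap n U V i a * (of_real (q a) * overlap n V U a i))"
    by (subst sum.swap) (simp add: overlap_def[of n U V] sum_distrib_right)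
  also have "\<dots> = (\<Sum>a<n. of_real ((cmod (overlap n V U a i))\<^sup>2 * q a))"
    by (intro sum.cong refl)
      (simp only: overlap_cnj[of n U V] of_real_mult complex_norm_square ac_simps)
  finally show ?thesis by simp
qed

text \<open>The spread of the eigenvalues of \<sigma> about y equals the squared residual of a
  column of \<open>U\<close> as an approximate eigenvector, which can be estimated without knowing
  \<open>V\<close>.\<close>

lemma overlap_variance:
  assumes S: "spectral n \<sigma> V q"
  shows "(\<Sum>a<n. (cmod (overlap n V U a i))\<^sup>2 * (q a - y)\<^sup>2) = (\<Sum>x<n. (cmod ((\<Sum>z<n. \<sigma> x z * U z i) - of_real y * U x i))\<^sup>2)"
proof -
  have V: "unitary_on n V" using S by (simp add: spectral_def)
  have "(\<Sum>x<n. (cmod ((\<Sum>z<n. \<sigma> x z * U z i) - of_real y * U x i))\<^sup>2)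
      = (\<Sum>x<n. (cmod (\<Sum>a<n. V x a * (of_real (q a - y) * overlap n V U a i)))\<^sup>2)"
  proof (rule sum.cong[OF refl])
    fix x assume "x \<in> {..<n}"
    then have x: "x < n" by simp
    have "(\<Sum>z<n. \<sigma> x z * U z i) - of_real y * U x i = (\<Sum>a<n. V x a * (of_real (q a - y) * overlap n V U a i))"
      unfolding spectral_apply[OF S x] overlap_expand[OF V x, of U i] sum_distrib_left sum_subtractf[symmetric]
      by (intro sum.cong refl) (simp add: algebra_simps)
    then show "(cmod ((\<Sum>z<n. \<sigma> x z * U z i) - of_real y * U x i))\<^sup>2
      = (cmod (\<Sum>a<n. V x a * (of_real (q a - y) * overlap n V U a i)))\<^sup>2" by simp
  qed
  also have "\<dots> = (\<Sum>a<n. (cmod (of_real (q a - y) * overlap n V U a i))\<^sup>2)"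
    by (rule unitary_on_parseval[OF V])
  also have "\<dots> = (\<Sum>a<n. (cmod (overlap n V U a i))\<^sup>2 * (q a - y)\<^sup>2)"
    by (intro sum.cong refl) (simp only: norm_mult power_mult_distrib norm_of_real power2_abs mult.commute)
  finally show ?thesis by simp
qed

lemma spectral_mean:
  assumes S: "spectral n \<rho> U p" and i: "i < n"
  shows "sesq n \<rho> (\<lambda>x. U x i) (\<lambda>x. U x i) = of_real (p i)"
proof -
  have "sesq n \<rho> (\<lambda>x. U x i) (\<lambda>x. U x i) = (\<Sum>x<n. cnj (U x i) * (\<Sum>y<n. \<rho> x y * U y i))"
    by (simp add: sesq_def sum_distrib_left mult.assoc)
  also have "\<dots> = (\<Sum>x<n. of_real (p i) * (cnj (U x i) * U x i))"
    using i by (intro sum.cong refl) (simp add: spectral_eigen(1)[OF S])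
  also have "\<dots> = of_real (p i)"
    using S i by (simp add: sum_distrib_left[symmetric] spectral_def unitary_on_def)
  finally show ?thesis .
qed

lemma spectral_trace:
  assumes S: "spectral n \<rho> U p"
  shows "(\<Sum>i<n. \<rho> i i) = of_real (\<Sum>k<n. p k)"
proof -
  have "(\<Sum>i<n. \<rho> i i) = (\<Sum>i<n. \<Sum>k<n. of_real (p k) * (cnj (U i k) * U i k))"
    using S by (intro sum.cong refl) (simp add: spectral_def ac_simps)
  also have "\<dots> = (\<Sum>k<n. of_real (p k) * (\<Sum>i<n. cnj (U i k) * U i k))"
    by (subst sum.swap) (simp add: sum_distrib_left)
  also have "\<dots> = (\<Sum>k<n. of_real (p k))"
    using S by (intro sum.cong refl) (simp add: spectral_def unitary_on_def)
  finally show ?thesis by simp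
qed

lemma spectral_psd_nonneg:
  assumes "spectral n \<rho> U p" "op_psd \<rho>" "i < n"
  shows "0 \<le> p i"
proof -
  have "sesq n \<rho> (\<lambda>x. U x i) (\<lambda>x. U x i) \<in> \<real>\<^sub>\<ge>\<^sub>0"
    using assms(2)[unfolded op_psd_def, rule_format, where n = n and c = "\<lambda>x. U x i"] by (simp add: sesq_def)
  then show ?thesis by (simp add: spectral_mean[OF assms(1,3)])
qed

section \<open>Jumps of the lowering operator between eigenvectors\<close>

text \<open>Components of a applied to the columns of \<open>U\<close>. The operator a maps the
  block into itself; the test cuts off entries of \<open>U\<close> outside the block, which are
  arbitrary.\<close>

definition lowered :: "nat \<Rightarrow> nat op \<Rightarrow> nat op" where
  "lowered n U x j = (if Suc x < n then of_real (sqrt (real (Suc x))) * U (Suc x) j else 0)"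

definition rate :: "nat \<Rightarrow> nat op \<Rightarrow> nat \<Rightarrow> nat \<Rightarrow> real" where
  "rate n U i j = (cmod (overlap n U (lowered n U) i j))\<^sup>2"

definition mean_number :: "nat \<Rightarrow> nat op \<Rightarrow> nat \<Rightarrow> real" where
  "mean_number n U i = (\<Sum>x<n. real x * (cmod (U x i))\<^sup>2)"

lemma sum_shift_number:
  "(\<Sum>x<n. if Suc x < n then f (Suc x) else 0) = (\<Sum>x<n. if 0 < x then f x else (0::real))"
proof (cases n)
  case (Suc k)
  have "(\<Sum>x<Suc k. if Suc x < Suc k then f (Suc x) else 0) = (\<Sum>x<k. f (Suc x))" by simp
  also have "\<dots> = (\<Sum>x<Suc k. if 0 < x then f x else 0)"
    by (subst sum.lessThan_Suc_shift) simp
  finally show ?thesis by (simp only: Suc)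
qed simp

text \<open>Both sides are the squared norm of a u_j. The identity is exact because a does not leave
  the block.\<close>

lemma rate_column_sum:
  assumes U: "unitary_on n U"
  shows "(\<Sum>i<n. rate n U i j) = mean_number n U j"
proof -
  have "(\<Sum>i<n. rate n U i j) = (\<Sum>x<n. (cmod (lowered n U x j))\<^sup>2)"
    unfolding rate_def overlap_def by (rule unitary_on_parseval[OF unitary_on_adj[OF U]])
  also have "\<dots> = (\<Sum>x<n. if Suc x < n then real (Suc x) * (cmod (U (Suc x) j))\<^sup>2 else 0)"
    by (intro sum.cong refl) (auto simp: lowered_def norm_mult power_mult_distrib)
  also have "\<dots> = (\<Sum>x<n. if 0 < x then real x * (cmod (U x j))\<^sup>2 else 0)"
    by (rule sum_shift_number)
  also have "\<dots> = mean_number n U j"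
    unfolding mean_number_def by (intro sum.cong refl) auto
  finally show ?thesis .
qed

text \<open>The commutation relation: \<open>a a\<^sup>\<dagger> \<le> a\<^sup>\<dagger> a + 1\<close> after truncation.\<close>

lemma rate_row_sum:
  assumes U: "unitary_on n U" and i: "i < n"
  shows "(\<Sum>j<n. rate n U i j) \<le> mean_number n U i + 1"
proof -
  \<comment> \<open>The conjugate of the vector \<open>a\<^sup>\<dagger> u\<^sub>i\<close>. Its
    component at level n falls outside the block, and this loss turns the commutation relation into
    an inequality.\<close>
  define g where "g y = (if 0 < y then of_real (sqrt (real y)) * cnj (U (y - 1) i) else 0)" for y
  have tr: "unitary_on n (\<lambda>i j. U j i)"
    unfolding unitary_on_def
  proof (intro conjI allI impI)
    fix i j assume "i < n" "j < n"
    then have "(\<Sum>k<n. U j k * cnj (U i k)) = of_bool (j = i)" "(\<Sum>k<n. cnj (U k j) * U k i) = of_bool (j = i)"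
      using U by (auto simp: unitary_on_def)
    then show "(\<Sum>k<n. cnj (U i k) * U j k) = of_bool (i = j)" "(\<Sum>k<n. U k i * cnj (U k j)) = of_bool (i = j)"
      by (simp_all only: mult.commute eq_commute[of i j])
  qed
  have "overlap n U (lowered n U) i j = (\<Sum>y<n. U y j * g y)" for j
  proof (cases n)
    case (Suc k)
    have "overlap n U (lowered n U) i j = (\<Sum>x<k. cnj (U x i) * (of_real (sqrt (real (Suc x))) * U (Suc x) j))"
      unfolding overlap_def lowered_def Suc by simp
    also have "\<dots> = (\<Sum>y<Suc k. U y j * g y)"
      by (subst sum.lessThan_Suc_shift) (simp add: g_def ac_simps)
    finally show ?thesis by (simp only: Suc)
  qed (simp add: overlap_def)
  then have "(\<Sum>j<n. rate n U i j) = (\<Sum>y<n. (cmod (g y))\<^sup>2)"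
    unfolding rate_def using unitary_on_parseval[OF tr, of g] by simp
  also have "\<dots> = (\<Sum>y<n. if 0 < y then real y * (cmod (U (y - 1) i))\<^sup>2 else 0)"
    by (intro sum.cong refl) (auto simp: g_def norm_mult power_mult_distrib)
  also have "\<dots> = (\<Sum>x<n. if Suc x < n then real (Suc x) * (cmod (U x i))\<^sup>2 else 0)"
    using sum_shift_number[of n "\<lambda>y. real y * (cmod (U (y - 1) i))\<^sup>2"]
    by (simp only: diff_Suc_1)
  also have "\<dots> \<le> (\<Sum>x<n. real x * (cmod (U x i))\<^sup>2 + (cmod (U x i))\<^sup>2)"
    by (intro sum_mono) (auto simp: algebra_simps)
  also have "\<dots> = mean_number n U i + 1"
    using unitary_on_column_norm[OF U i] by (simp add: mean_number_def sum.distrib)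
  finally show ?thesis .
qed

text \<open>Gain minus loss of a master equation: \<open>a \<rho> a\<^sup>\<dagger>\<close> feeds i
  from all j, and as u_i is both a left and a right eigenvector, the anticommutator yields
  \<open>p i\<close> times the mean number.\<close>

lemma attenuator_gen_mean:
  assumes \<rho>: "supported n \<rho>" and S: "spectral n \<rho> U p" and i: "i < n"
  shows "sesq n (attenuator_gen \<rho>) (\<lambda>x. U x i) (\<lambda>x. U x i)
     = of_real ((\<Sum>j<n. rate n U i j * p j) - p i * mean_number n U i)"
proof -
  define u where "u x = U x i" for x
  have lower: "of_real (sqrt (real (x + 1)) * sqrt (real (y + 1))) * \<rho> (x + 1) (y + 1)
      = (\<Sum>j<n. lowered n U x j * of_real (p j) * cnj (lowered n U y j))" for x y
  proof (cases "Suc x < n \<and> Suc y < n")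
    case True
    then have "\<rho> (x + 1) (y + 1) = (\<Sum>j<n. U (Suc x) j * of_real (p j) * cnj (U (Suc y) j))"
      using S by (simp add: spectral_def)
    then show ?thesis using True by (simp add: lowered_def sum_distrib_left ac_simps)
  next
    case False
    then have "\<rho> (x + 1) (y + 1) = 0" using \<rho> by (auto simp: supported_def)
    moreover have "lowered n U x j * of_real (p j) * cnj (lowered n U y j) = 0" for j
      using False by (auto simp: lowered_def)
    ultimately show ?thesis by (simp only: sum.neutral_const mult_zero_right)
  qed
  have "sesq n (attenuator_gen \<rho>) u u = (\<Sum>x<n. \<Sum>y<n. cnj (u x) * (\<Sum>j<n. lowered n U x j * of_real (p j) * cnj (lowered n U y j)) * u y)
     - (\<Sum>x<n. \<Sum>y<n. cnj (u x) * (of_real (real (x + y) / 2) * \<rho> x y) * u y)"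
    unfolding sesq_def attenuator_gen_def lower sum_subtractf[symmetric]
    by (intro sum.cong refl) (simp add: algebra_simps)
  moreover have "(\<Sum>x<n. \<Sum>y<n. cnj (u x) * (\<Sum>j<n. lowered n U x j * of_real (p j) * cnj (lowered n U y j)) * u y)
     = of_real (\<Sum>j<n. rate n U i j * p j)"
  proof -
    have "(\<Sum>x<n. \<Sum>y<n. cnj (u x) * (\<Sum>j<n. lowered n U x j * of_real (p j) * cnj (lowered n U y j)) * u y)
      = (\<Sum>x<n. \<Sum>y<n. \<Sum>j<n. of_real (p j) * ((cnj (u x) * lowered n U x j) * cnj (cnj (u y) * lowered n U y j)))"
      unfolding sum_distrib_left sum_distrib_right by (intro sum.cong refl) (simp add: ac_simps)
    also have "\<dots> = (\<Sum>x<n. \<Sum>j<n. \<Sum>y<n. of_real (p j) * ((cnj (u x) * lowered n U x j) * cnj (cnj (u y) * lowered n U y j)))"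
      by (rule sum.cong[OF refl], rule sum.swap)
    also have "\<dots> = (\<Sum>j<n. \<Sum>x<n. \<Sum>y<n. of_real (p j) * ((cnj (u x) * lowered n U x j) * cnj (cnj (u y) * lowered n U y j)))"
      by (rule sum.swap)
    also have "\<dots> = (\<Sum>j<n. of_real (p j) * (overlap n U (lowered n U) i j * cnj (overlap n U (lowered n U) i j)))"
    proof -
      have gen: "(\<Sum>x<n. \<Sum>y<n. c * (a x * cnj (a y))) = c * ((\<Sum>x<n. a x) * cnj (\<Sum>x<n. a x))" for c :: complex and a
        unfolding cnj_sum sum_product by (simp add: sum_distrib_left)
      show ?thesis unfolding overlap_def u_def by (rule sum.cong[OF refl], rule gen)
    qed
    also have "\<dots> = of_real (\<Sum>j<n. rate n U i j * p j)"
      unfolding of_real_sum by (intro sum.cong refl) (simp add: rate_def complex_norm_square[symmetric] mult.commute)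
    finally show ?thesis .
  qed
  moreover have "(\<Sum>x<n. \<Sum>y<n. cnj (u x) * (of_real (real (x + y) / 2) * \<rho> x y) * u y) = of_real (p i * mean_number n U i)"
  proof -
    have "(\<Sum>x<n. \<Sum>y<n. cnj (u x) * (of_real (real (x + y) / 2) * \<rho> x y) * u y)
      = (\<Sum>x<n. \<Sum>y<n. (of_real (real x / 2) * cnj (u x)) * (\<rho> x y * u y))
        + (\<Sum>x<n. \<Sum>y<n. (cnj (u x) * \<rho> x y) * (of_real (real y / 2) * u y))"
      unfolding sum.distrib[symmetric] by (intro sum.cong refl) (simp add: algebra_simps add_divide_distrib)
    also have "(\<Sum>x<n. \<Sum>y<n. (of_real (real x / 2) * cnj (u x)) * (\<rho> x y * u y))
      = (\<Sum>x<n. (of_real (real x / 2) * cnj (u x)) * (of_real (p i) * u x))"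
      unfolding sum_distrib_left[symmetric] u_def
      using i by (intro sum.cong refl) (simp add: spectral_eigen(1)[OF S])
    also have "(\<Sum>x<n. \<Sum>y<n. (cnj (u x) * \<rho> x y) * (of_real (real y / 2) * u y))
      = (\<Sum>y<n. (of_real (p i) * cnj (u y)) * (of_real (real y / 2) * u y))"
      unfolding u_def by (subst sum.swap, unfold sum_distrib_right[symmetric])
        (use i in \<open>intro sum.cong refl, simp add: spectral_eigen(2)[OF S]\<close>)
    also have "(\<Sum>x<n. (of_real (real x / 2) * cnj (u x)) * (of_real (p i) * u x))
        + (\<Sum>y<n. (of_real (p i) * cnj (u y)) * (of_real (real y / 2) * u y))
      = (\<Sum>x<n. of_real (p i * (real x * (cmod (u x))\<^sup>2)))"
      unfolding sum.distrib[symmetric]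
      unfolding of_real_mult complex_norm_square by (intro sum.cong refl) (simp add: field_simps)
    also have "\<dots> = of_real (p i * mean_number n U i)"
      by (simp add: mean_number_def u_def sum_distrib_left)
    finally show ?thesis .
  qed
  ultimately show ?thesis unfolding u_def by simp
qed

text \<open>The hypothesis \<open>closed\<close> says that a maps the range of \<rho> into itself.
  The flow then stays among the positive eigenvalues, where the logarithms are meaningful, and
  column sums over the range alone still give the full mean number.\<close>

lemma support_flow_bound:
  assumes U: "unitary_on n U" and p0: "\<And>i. i < n \<Longrightarrow> 0 \<le> p i" and p1: "(\<Sum>i<n. p i) = 1"
    and closed: "\<And>i. i < n \<Longrightarrow> p i = 0 \<Longrightarrow> (\<Sum>j<n. rate n U i j * p j) = 0"
  shows "f_iso (- (\<Sum>k<n. p k * ln (p k)))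
    \<le> (\<Sum>i | i < n \<and> 0 < p i. - (((\<Sum>j<n. rate n U i j * p j) - p i * mean_number n U i) * (ln (p i) + 1)))"
proof -
  define K where "K = {i. i < n \<and> 0 < p i}"
  define A where "A = rate n U"
  have A0: "0 \<le> A i j" for i j by (simp add: A_def rate_def)
  have K: "finite K" "K \<subseteq> {..<n}" by (auto simp: K_def)
  have restrict: "(\<Sum>j<n. f j) = (\<Sum>j\<in>K. f j)" if "\<And>j. j < n \<Longrightarrow> p j = 0 \<Longrightarrow> f j = 0" for f :: "nat \<Rightarrow> real"
    using p0 that K by (intro sum.mono_neutral_right) (auto simp: K_def less_le)
  have A_zero: "A i j = 0" if "i < n" "p i = 0" "j \<in> K" for i j
  proof -
    have "\<forall>j\<in>{..<n}. A i j * p j = 0"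
      using closed[OF that(1,2)] p0 A0 unfolding A_def[symmetric]
      by (subst (asm) sum_nonneg_eq_0_iff) auto
    then show ?thesis using that(3) by (auto simp: K_def)
  qed
  have inflow: "(\<Sum>j<n. A i j * p j) = (\<Sum>j\<in>K. A i j * p j)" for i
    by (rule restrict) simp
  have outflow: "mean_number n U j = (\<Sum>i\<in>K. A i j)" if "j \<in> K" for j
    unfolding rate_column_sum[OF U, symmetric] A_def[symmetric]
    using A_zero that by (intro restrict) auto
  obtain \<iota> where \<iota>: "bij_betw \<iota> {..<card K} K"
    using ex_bij_betw_nat_finite[OF K(1)] by (auto simp: atLeast0LessThan)
  define m where "m = card K"
  obtain \<pi> where \<pi>: "bij_betw \<pi> {..<m} {..<m}"
    and dec: "\<And>i j. i \<le> j \<Longrightarrow> j < m \<Longrightarrow> (p \<circ> \<iota>) (\<pi> j) \<le> (p \<circ> \<iota>) (\<pi> i)"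
    using sorting_permutation[of m "p \<circ> \<iota>"] by blast
  define \<kappa> where "\<kappa> = \<iota> \<circ> \<pi>"
  have \<kappa>: "bij_betw \<kappa> {..<m} K"
    unfolding \<kappa>_def using bij_betw_trans[OF \<pi>] \<iota> by (simp add: m_def)
  have re: "(\<Sum>i<m. f (\<kappa> i)) = (\<Sum>i\<in>K. f i)" for f :: "nat \<Rightarrow> real"
    by (rule sum.reindex_bij_betw[OF \<kappa>])
  have in_K: "\<kappa> i \<in> K" if "i < m" for i using \<kappa> that by (auto simp: bij_betw_def)
  have pos: "0 < p (\<kappa> i)" if "i < m" for i using in_K[OF that] by (simp add: K_def)
  have "- death_rate m (\<lambda>i. p (\<kappa> i)) \<le> (\<Sum>i<m. \<Sum>j<m. A (\<kappa> j) (\<kappa> i) * p (\<kappa> i) * (ln (p (\<kappa> i)) - ln (p (\<kappa> j))))"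
  proof (rule sorted_flow_bound)
    fix j assume j: "j < m"
    have "(\<Sum>i<m. A (\<kappa> j) (\<kappa> i)) = (\<Sum>i\<in>K. A (\<kappa> j) i)" by (rule re)
    also have "\<dots> \<le> (\<Sum>i<n. A (\<kappa> j) i)" using K A0 by (intro sum_mono2) auto
    also have "\<dots> \<le> mean_number n U (\<kappa> j) + 1"
      unfolding A_def using in_K[OF j] by (intro rate_row_sum[OF U]) (simp add: K_def)
    also have "mean_number n U (\<kappa> j) = (\<Sum>i<m. A (\<kappa> i) (\<kappa> j))"
      unfolding outflow[OF in_K[OF j]] by (rule re[symmetric])
    finally show "(\<Sum>i<m. A (\<kappa> j) (\<kappa> i)) - (\<Sum>i<m. A (\<kappa> i) (\<kappa> j)) \<le> 1" by simp
  qed (use A0 pos dec in \<open>auto simp: \<kappa>_def\<close>)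
  also have "\<dots> = (\<Sum>i<m. \<Sum>j\<in>K. A j (\<kappa> i) * p (\<kappa> i) * (ln (p (\<kappa> i)) - ln (p j)))"
  proof (rule sum.cong[OF refl])
    fix i
    show "(\<Sum>j<m. A (\<kappa> j) (\<kappa> i) * p (\<kappa> i) * (ln (p (\<kappa> i)) - ln (p (\<kappa> j))))
      = (\<Sum>j\<in>K. A j (\<kappa> i) * p (\<kappa> i) * (ln (p (\<kappa> i)) - ln (p j)))"
      by (rule re[of "\<lambda>j. A j (\<kappa> i) * p (\<kappa> i) * (ln (p (\<kappa> i)) - ln (p j))"])
  qed
  also have "\<dots> = (\<Sum>i\<in>K. \<Sum>j\<in>K. A j i * p i * (ln (p i) - ln (p j)))"
    by (rule re[of "\<lambda>i. \<Sum>j\<in>K. A j i * p i * (ln (p i) - ln (p j))"])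
  \<comment> \<open>The summands 1 cancel between the two logarithms; they match the terms to the
    derivative of x ln x.\<close>
  also have "\<dots> = (\<Sum>i\<in>K. \<Sum>j\<in>K. A j i * p i * (ln (p i) + 1)) - (\<Sum>i\<in>K. \<Sum>j\<in>K. A j i * p i * (ln (p j) + 1))"
    by (simp add: sum_subtractf[symmetric] algebra_simps)
  also have "(\<Sum>i\<in>K. \<Sum>j\<in>K. A j i * p i * (ln (p j) + 1)) = (\<Sum>j\<in>K. \<Sum>i\<in>K. A j i * p i * (ln (p j) + 1))"
    by (rule sum.swap)
  also have "(\<Sum>i\<in>K. \<Sum>j\<in>K. A j i * p i * (ln (p i) + 1)) - (\<Sum>j\<in>K. \<Sum>i\<in>K. A j i * p i * (ln (p j) + 1))
    = (\<Sum>i\<in>K. - (((\<Sum>j<n. A i j * p j) - p i * mean_number n U i) * (ln (p i) + 1)))"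
  proof -
    have "(\<Sum>i\<in>K. \<Sum>j\<in>K. A j i * p i * (ln (p i) + 1)) = (\<Sum>i\<in>K. p i * mean_number n U i * (ln (p i) + 1))"
      by (intro sum.cong refl) (simp add: outflow sum_distrib_right sum_distrib_left ac_simps)
    moreover have "(\<Sum>j\<in>K. \<Sum>i\<in>K. A j i * p i * (ln (p j) + 1)) = (\<Sum>i\<in>K. (\<Sum>j<n. A i j * p j) * (ln (p i) + 1))"
      by (intro sum.cong refl) (simp add: inflow sum_distrib_right)
    ultimately show ?thesis
      by (simp add: sum_subtractf left_diff_distrib)
  qed
  finally have 1: "- death_rate m (\<lambda>i. p (\<kappa> i)) \<le> \<dots>" .
  have "f_iso (- (\<Sum>i<m. p (\<kappa> i) * ln (p (\<kappa> i)))) \<le> - death_rate m (\<lambda>i. p (\<kappa> i))"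
  proof (rule death_rate_le_f_iso)
    show "(\<Sum>i<m. p (\<kappa> i)) = 1"
      unfolding re[of p] p1[symmetric] by (rule restrict[symmetric]) simp
  qed (use pos in auto)
  also have "(\<Sum>i<m. p (\<kappa> i) * ln (p (\<kappa> i))) = (\<Sum>i<n. p i * ln (p i))"
    unfolding re[of "\<lambda>i. p i * ln (p i)"] by (rule restrict[symmetric]) simp
  finally show ?thesis using 1 unfolding K_def A_def by linarith
qed

section \<open>Tangent bounds for the entropy from both sides\<close>

lemma neg_xlnx_le_tangent:
  assumes "0 \<le> (x::real)" "0 < y"
  shows "- (x * ln x) \<le> - (x * ln y) - x + y"
proof (cases "x = 0")
  case False
  then have x: "0 < x" using assms by simp
  have "ln y - ln x = ln (y / x)" using x assms by (simp add: ln_div)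
  also have "\<dots> \<le> y / x - 1" using x assms by (intro ln_le_minus_one) simp
  finally have "x * (ln y - ln x) \<le> x * (y / x - 1)" using x by (intro mult_left_mono) auto
  also have "\<dots> = y - x" using x by (simp add: field_simps)
  finally show ?thesis by (simp add: algebra_simps)
qed (use assms in simp)

text \<open>The logarithm bound for x / y in place of y / x. The error is quadratic, so that
  averaging over a spectrum turns it into a variance about y.\<close>

lemma neg_xlnx_ge_tangent:
  assumes "0 \<le> (x::real)" "0 < y"
  shows "- (x * ln y) - x + y - (x - y)\<^sup>2 / y \<le> - (x * ln x)"
proof (cases "x = 0")
  case False
  then have x: "0 < x" using assms by simp
  have "ln x - ln y = ln (x / y)" using x assms by (simp add: ln_div)
  also have "\<dots> \<le> x / y - 1" using x assms by (intro ln_le_minus_one) simp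
  finally have "x * (ln x - ln y) \<le> x * (x / y - 1)" using x by (intro mult_left_mono) auto
  also have "\<dots> = x - y + (x - y)\<^sup>2 / y" using assms by (simp add: field_simps power2_eq_square)
  finally show ?thesis by (simp add: algebra_simps)
qed (use assms in \<open>simp add: power2_eq_square\<close>)

text \<open>
  Klein's inequality and a converse with a quadratic error replace the perturbation theory of
  eigenvalues.
\<close>

lemma entropy_klein:
  assumes \<sigma>: "op_psd \<sigma>" "supported n \<sigma>" "(\<Sum>i<n. \<sigma> i i) = 1" and U: "unitary_on n U"
  shows "\<exists>h. entropy \<sigma> = (\<Sum>i<n. h i) \<and> (\<forall>i<n. 0 \<le> h i \<and> 0 \<le> Re (sesq n \<sigma> (\<lambda>x. U x i) (\<lambda>x. U x i)) \<and>
    (\<forall>y>0. h i \<le> - (Re (sesq n \<sigma> (\<lambda>x. U x i) (\<lambda>x. U x i)) * ln y) - Re (sesq n \<sigma> (\<lambda>x. U x i) (\<lambda>x. U x i)) + y \<and>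
      - (Re (sesq n \<sigma> (\<lambda>x. U x i) (\<lambda>x. U x i)) * ln y) - Re (sesq n \<sigma> (\<lambda>x. U x i) (\<lambda>x. U x i)) + y
        - (\<Sum>x<n. (cmod ((\<Sum>z<n. \<sigma> x z * U z i) - of_real y * U x i))\<^sup>2) / y \<le> h i))"
proof -
  have "\<exists>V q. spectral n \<sigma> V q"
    by (rule spectral_exists) (rule op_psd_hermitian[OF \<sigma>(1)])
  then obtain V q where S: "spectral n \<sigma> V q" by blast
  have V: "unitary_on n V" using S by (simp add: spectral_def)
  have q0: "0 \<le> q a" if "a < n" for a by (rule spectral_psd_nonneg[OF S \<sigma>(1) that])
  have "complex_of_real (\<Sum>k<n. q k) = 1" using spectral_trace[OF S] \<sigma>(3) by simp
  then have "(\<Sum>k<n. q k) = 1" using of_real_eq_1_iff by blast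
  then have q1: "q a \<le> 1" if "a < n" for a
    using member_le_sum[of a "{..<n}" q] q0 that by auto
  define w where "w a i = (cmod (overlap n V U a i))\<^sup>2" for a i
  \<comment> \<open>The share of u_i in the entropy. As the weights are doubly stochastic, the
    shares add up to the entropy, and each is an average to which the tangent bounds at any y
    apply.\<close>
  define h where "h i = (\<Sum>a<n. w a i * - (q a * ln (q a)))" for i
  have w0: "0 \<le> w a i" for a i by (simp add: w_def)
  have w1: "(\<Sum>a<n. w a i) = 1" if "i < n" for i
    unfolding w_def by (rule overlap_sum_left[OF V U that])
  have mean: "Re (sesq n \<sigma> (\<lambda>x. U x i) (\<lambda>x. U x i)) = (\<Sum>a<n. w a i * q a)" for i
    by (simp add: overlap_mean[OF S] w_def)
  have var: "(\<Sum>x<n. (cmod ((\<Sum>z<n. \<sigma> x z * U z i) - of_real y * U x i))\<^sup>2) = (\<Sum>a<n. w a i * (q a - y)\<^sup>2)" for i y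
    by (simp add: overlap_variance[OF S] w_def)
  have "(\<Sum>i<n. h i) = (\<Sum>a<n. (\<Sum>i<n. w a i) * - (q a * ln (q a)))"
    unfolding h_def sum_distrib_right by (rule sum.swap)
  also have "\<dots> = (\<Sum>a<n. 1 * - (q a * ln (q a)))"
    by (intro sum.cong refl arg_cong2[where f = "(*)"]) (simp add: w_def overlap_sum_right[OF V U])
  finally have ent: "entropy \<sigma> = (\<Sum>i<n. h i)"
    by (simp add: entropy_spectral[OF \<sigma>(2) S] sum_negf)
  have h0: "0 \<le> h i" for i
    unfolding h_def
  proof (intro sum_nonneg mult_nonneg_nonneg w0)
    fix a assume "a \<in> {..<n}"
    then have "0 \<le> q a" "q a \<le> 1" using q0 q1 by auto
    then show "0 \<le> - (q a * ln (q a))"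
      by (cases "q a = 0") (auto simp: mult_nonneg_nonpos)
  qed
  have lin: "(\<Sum>a<n. w a i * (- (q a * c) - q a + y)) = - ((\<Sum>a<n. w a i * q a) * c) - (\<Sum>a<n. w a i * q a) + y" if "i < n" for i c y
  proof -
    have "(\<Sum>a<n. w a i * (- (q a * c) - q a + y)) = - ((\<Sum>a<n. w a i * q a) * c) - (\<Sum>a<n. w a i * q a) + (\<Sum>a<n. w a i) * y"
      unfolding sum_distrib_right sum_negf[symmetric] sum_subtractf[symmetric] sum.distrib[symmetric]
      by (intro sum.cong refl) (simp add: algebra_simps)
    then show ?thesis using w1[OF that] by simp
  qed
  have up: "h i \<le> - ((\<Sum>a<n. w a i * q a) * ln y) - (\<Sum>a<n. w a i * q a) + y" if "i < n" "0 < y" for i y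
    unfolding lin[OF that(1), symmetric] h_def
    using w0 q0 neg_xlnx_le_tangent[OF _ that(2)] by (intro sum_mono mult_left_mono) auto
  have low: "- ((\<Sum>a<n. w a i * q a) * ln y) - (\<Sum>a<n. w a i * q a) + y - (\<Sum>a<n. w a i * (q a - y)\<^sup>2) / y \<le> h i" if "i < n" "0 < y" for i y
  proof -
    have "(\<Sum>a<n. w a i * (- (q a * ln y) - q a + y)) - (\<Sum>a<n. w a i * (q a - y)\<^sup>2) / y
      = (\<Sum>a<n. w a i * (- (q a * ln y) - q a + y - (q a - y)\<^sup>2 / y))"
      unfolding sum_divide_distrib sum_subtractf[symmetric] by (intro sum.cong refl) (simp add: algebra_simps)
    also have "\<dots> \<le> h i"
      unfolding h_def using w0 q0 neg_xlnx_ge_tangent[OF _ that(2)] by (intro sum_mono mult_left_mono) auto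
    finally show ?thesis unfolding lin[OF that(1)] .
  qed
  have "0 \<le> (\<Sum>a<n. w a i * q a)" for i
    using w0 q0 by (intro sum_nonneg) auto
  then show ?thesis
    unfolding mean var using ent h0 up low by (intro exI[of _ h]) auto
qed


section \<open>The right derivative of the entropy\<close>

lemma eventually_unit_interval: "\<forall>\<^sub>F t in at_right (0::real). t \<in> {0<..<1}"
  by (rule eventually_at_right_real) simp

text \<open>Both tangent bounds are taken at y = p. The mean moves by \<open>t * l\<close> and the
  residual \<open>v\<close> is at most of order \<open>t\<^sup>2\<close>, so both bounds have the
  same slope at 0.\<close>

lemma slope_positive_eigenvalue:
  fixes h r v :: "real \<Rightarrow> real"
  assumes p: "0 < p" and r: "\<And>t. t \<in> {0<..<1} \<Longrightarrow> \<bar>r t - p - t * l\<bar> \<le> B * t\<^sup>2"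
    and v: "\<And>t. t \<in> {0<..<1} \<Longrightarrow> v t \<le> B' * t\<^sup>2"
    and up: "\<And>t. t \<in> {0<..<1} \<Longrightarrow> h t \<le> - (r t * ln p) - r t + p"
    and low: "\<And>t. t \<in> {0<..<1} \<Longrightarrow> - (r t * ln p) - r t + p - v t / p \<le> h t"
  shows "((\<lambda>t. (h t + p * ln p) / t) \<longlongrightarrow> - (l * (ln p + 1))) (at_right 0)"
proof -
  have id: "((\<lambda>t::real. c * t) \<longlongrightarrow> 0) (at_right 0)" for c
    by (rule tendsto_mult_right_zero) (rule tendsto_ident_at)
  have r_lim: "((\<lambda>t. (r t - p) / t) \<longlongrightarrow> l) (at_right 0)"
  proof (rule Lim_transform[OF tendsto_const], rule Lim_null_comparison[OF _ id[of B]])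
    show "\<forall>\<^sub>F t in at_right 0. norm ((r t - p) / t - l) \<le> B * t"
      using eventually_unit_interval
    proof eventually_elim
      case (elim t)
      then have "(r t - p) / t - l = (r t - p - t * l) / t" by (simp add: field_simps)
      then have "norm ((r t - p) / t - l) = \<bar>r t - p - t * l\<bar> / t" using elim by simp
      also have "\<dots> \<le> B * t\<^sup>2 / t" using r[OF elim] elim by (intro divide_right_mono) auto
      also have "\<dots> = B * t" using elim by (simp add: power2_eq_square)
      finally show ?case .
    qed
  qed
  have up_lim: "((\<lambda>t. - ((r t - p) / t * (ln p + 1))) \<longlongrightarrow> - (l * (ln p + 1))) (at_right 0)"
    by (intro tendsto_intros r_lim)
  have low_lim: "((\<lambda>t. - ((r t - p) / t * (ln p + 1)) - B' / p * t) \<longlongrightarrow> - (l * (ln p + 1)) - 0) (at_right 0)"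
    by (intro tendsto_diff up_lim id)
  show ?thesis
  proof (rule tendsto_sandwich[OF _ _ low_lim[unfolded diff_zero] up_lim])
    show "\<forall>\<^sub>F t in at_right 0. - ((r t - p) / t * (ln p + 1)) - B' / p * t \<le> (h t + p * ln p) / t"
      using eventually_unit_interval
    proof eventually_elim
      case (elim t)
      have "v t / p \<le> B' * t\<^sup>2 / p" using v[OF elim] p by (intro divide_right_mono) auto
      then have "- (r t * ln p) - r t + p - B' * t\<^sup>2 / p \<le> h t" using low[OF elim] by linarith
      then have "(- ((r t - p) * (ln p + 1)) - B' * t\<^sup>2 / p) / t \<le> (h t + p * ln p) / t"
        using elim by (intro divide_right_mono) (auto simp: algebra_simps)
      moreover have "(- ((r t - p) * (ln p + 1)) - B' * t\<^sup>2 / p) / t = - ((r t - p) / t * (ln p + 1)) - B' / p * t"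
        using elim p by (simp add: field_simps power2_eq_square)
      ultimately show ?case by linarith
    qed
    show "\<forall>\<^sub>F t in at_right 0. (h t + p * ln p) / t \<le> - ((r t - p) / t * (ln p + 1))"
      using eventually_unit_interval
    proof eventually_elim
      case (elim t)
      have "(h t + p * ln p) / t \<le> - ((r t - p) * (ln p + 1)) / t"
        using elim up[OF elim] by (intro divide_right_mono) (auto simp: algebra_simps)
      then show ?case by simp
    qed
  qed
qed

text \<open>The tangent at \<open>t\<^sup>2\<close> bounds the contribution of an eigenvalue of order \<open>t\<^sup>2\<close> by \<open>O(t\<^sup>2 ln t)\<close>.\<close>

lemma slope_kernel_closed:
  fixes h r :: "real \<Rightarrow> real"
  assumes h: "\<And>t. t \<in> {0<..<1} \<Longrightarrow> 0 \<le> h t" and r0: "\<And>t. t \<in> {0<..<1} \<Longrightarrow> 0 \<le> r t"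
    and r: "\<And>t. t \<in> {0<..<1} \<Longrightarrow> r t \<le> B * t\<^sup>2"
    and up: "\<And>t. t \<in> {0<..<1} \<Longrightarrow> h t \<le> - (r t * ln (t\<^sup>2)) - r t + t\<^sup>2"
  shows "((\<lambda>t. h t / t) \<longlongrightarrow> 0) (at_right 0)"
proof (rule tendsto_sandwich[OF _ _ tendsto_const])
  have "((\<lambda>t::real. t * ln t) \<longlongrightarrow> 0) (at_right 0)" by real_asymp
  then have "((\<lambda>t. - 2 * B * (t * ln t) + t) \<longlongrightarrow> - 2 * B * 0 + 0) (at_right 0)"
    by (intro tendsto_add tendsto_mult tendsto_const tendsto_ident_at)
  then show "((\<lambda>t. - 2 * B * (t * ln t) + t) \<longlongrightarrow> 0) (at_right 0)" by simp
  show "\<forall>\<^sub>F t in at_right 0. 0 \<le> h t / t"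
    using eventually_unit_interval by eventually_elim (use h in auto)
  show "\<forall>\<^sub>F t in at_right 0. h t / t \<le> - 2 * B * (t * ln t) + t"
    using eventually_unit_interval
  proof eventually_elim
    case (elim t)
    have l: "ln (t\<^sup>2) = 2 * ln t" using elim by (simp add: ln_realpow)
    have "r t * (- 2 * ln t) \<le> B * t\<^sup>2 * (- 2 * ln t)"
      using r[OF elim] elim by (intro mult_right_mono) (auto intro: less_imp_le)
    then have "h t \<le> B * t\<^sup>2 * (- 2 * ln t) + t\<^sup>2"
      using up[OF elim] r0[OF elim] unfolding l by simp
    then have "h t / t \<le> (B * t\<^sup>2 * (- 2 * ln t) + t\<^sup>2) / t"
      using elim by (intro divide_right_mono) auto
    also have "\<dots> = - 2 * B * (t * ln t) + t"
      using elim by (simp add: field_simps power2_eq_square)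
    finally show ?case .
  qed
qed

text \<open>The lower bound at the moving point y = t, which has the order of the emerging
  eigenvalue: the error \<open>v t / t\<close> is at most of order t, while
  \<open>- (r t * ln t)\<close> contributes the divergent \<open>l * (- ln t)\<close> to the
  quotient.\<close>

lemma slope_kernel_open:
  fixes h r v :: "real \<Rightarrow> real"
  assumes l: "0 < l" and r: "\<And>t. t \<in> {0<..<1} \<Longrightarrow> \<bar>r t - t * l\<bar> \<le> B * t\<^sup>2"
    and v: "\<And>t. t \<in> {0<..<1} \<Longrightarrow> v t \<le> B' * t\<^sup>2"
    and low: "\<And>t. t \<in> {0<..<1} \<Longrightarrow> - (r t * ln t) - r t + t - v t / t \<le> h t"
  shows "filterlim (\<lambda>t. h t / t) at_top (at_right 0)"
proof -
  have "filterlim (\<lambda>t. l * (- ln t)) at_top (at_right 0)"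
    using l by (intro filterlim_tendsto_pos_mult_at_top[OF tendsto_const])
      (auto simp: filterlim_uminus_at_top ln_at_0)
  moreover have "((\<lambda>t::real. t * ln t) \<longlongrightarrow> 0) (at_right 0)" by real_asymp
  then have "((\<lambda>t. B * (t * ln t) - (l + B * t) + 1 - B') \<longlongrightarrow> B * 0 - (l + B * 0) + 1 - B') (at_right 0)"
    by (intro tendsto_intros)
  ultimately have "filterlim (\<lambda>t. (B * (t * ln t) - (l + B * t) + 1 - B') + l * (- ln t)) at_top (at_right 0)"
    using filterlim_tendsto_add_at_top by blast
  then show ?thesis
  proof (rule filterlim_at_top_mono)
    show "\<forall>\<^sub>F t in at_right 0. (B * (t * ln t) - (l + B * t) + 1 - B') + l * (- ln t) \<le> h t / t"
      using eventually_unit_interval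
    proof eventually_elim
      case (elim t)
      have t: "0 < t" "ln t < 0" using elim by auto
      have r1: "t * l - B * t\<^sup>2 \<le> r t" "r t \<le> t * l + B * t\<^sup>2" using r[OF elim] by (auto simp: abs_le_iff)
      have "(t * l - B * t\<^sup>2) * (- ln t) \<le> r t * (- ln t)"
        using r1 t by (intro mult_right_mono) auto
      moreover have "v t / t \<le> B' * t\<^sup>2 / t" using v[OF elim] t by (intro divide_right_mono) auto
      then have "v t / t \<le> B' * t" using t by (simp add: power2_eq_square)
      ultimately have "(t * l - B * t\<^sup>2) * (- ln t) - (t * l + B * t\<^sup>2) + t - B' * t \<le> h t"
        using low[OF elim] r1 by simp
      then have "((t * l - B * t\<^sup>2) * (- ln t) - (t * l + B * t\<^sup>2) + t - B' * t) / t \<le> h t / t"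
        using t by (intro divide_right_mono) auto
      moreover have "((t * l - B * t\<^sup>2) * (- ln t) - (t * l + B * t\<^sup>2) + t - B' * t) / t
        = (B * (t * ln t) - (l + B * t) + 1 - B') + l * (- ln t)"
        using t by (simp add: field_simps power2_eq_square)
      ultimately show ?case by linarith
    qed
  qed
qed

lemma sesq_diff:
  "sesq n A u v - sesq n B u v - c * sesq n G u v = (\<Sum>a<n. \<Sum>b<n. cnj (u a) * (A a b - B a b - c * G a b) * v b)"
proof -
  have "(\<Sum>a<n. \<Sum>b<n. cnj (u a) * (A a b - B a b - c * G a b) * v b)
    = (\<Sum>a<n. \<Sum>b<n. cnj (u a) * A a b * v b - cnj (u a) * B a b * v b - c * (cnj (u a) * G a b * v b))"
    by (intro sum.cong refl) (simp only: algebra_simps)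
  then show ?thesis by (simp only: sesq_def sum_subtractf sum_distrib_left)
qed

text \<open>The means need a quadratic error, since they are divided by t. For the residuals a bound
  of first order suffices, as they enter squared.\<close>

lemma attenuator_expansion_basis:
  assumes \<rho>: "supported n \<rho>" and S: "spectral n \<rho> U p"
    and l_def: "\<And>i. l i = (\<Sum>j<n. rate n U i j * p j) - p i * mean_number n U i"
  shows "\<exists>B\<ge>0. \<forall>t\<in>{0..1}. \<forall>i<n.
    \<bar>Re (sesq n (attenuator (exp (- t)) \<rho>) (\<lambda>x. U x i) (\<lambda>x. U x i)) - p i - t * l i\<bar> \<le> B * t\<^sup>2 \<and>
    (\<forall>x<n. cmod ((\<Sum>z<n. attenuator (exp (- t)) \<rho> x z * U z i) - of_real (p i) * U x i) \<le> B * t)"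
proof -
  have U: "unitary_on n U" using S by (simp add: spectral_def)
  obtain C where C0: "\<And>x y. 0 \<le> C x y"
    and C: "\<And>x y t. t \<in> {0..1} \<Longrightarrow> cmod (attenuator (exp (- t)) \<rho> x y - \<rho> x y - of_real t * attenuator_gen \<rho> x y) \<le> C x y * t\<^sup>2"
    using attenuator_expansion[OF \<rho>] by metis
  define B where "B = (\<Sum>x<n. \<Sum>y<n. C x y + cmod (attenuator_gen \<rho> x y))"
  have B_part: "(\<Sum>x<n. \<Sum>y<n. C x y) \<le> B"
    unfolding B_def by (intro sum_mono) auto
  have B_row: "(\<Sum>y<n. C x y + cmod (attenuator_gen \<rho> x y)) \<le> B" if "x < n" for x
    unfolding B_def using that C0
    by (intro member_le_sum[of x "{..<n}" "\<lambda>x. \<Sum>y<n. C x y + cmod (attenuator_gen \<rho> x y)"]) (auto intro!: sum_nonneg add_nonneg_nonneg)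
  have "B \<ge> 0" unfolding B_def using C0 by (intro sum_nonneg add_nonneg_nonneg) auto
  moreover have "\<bar>Re (sesq n (attenuator (exp (- t)) \<rho>) (\<lambda>x. U x i) (\<lambda>x. U x i)) - p i - t * l i\<bar> \<le> B * t\<^sup>2"
    if t: "t \<in> {0..1}" and i: "i < n" for t i
  proof -
    define u where "u x = U x i" for x
    have u1: "cmod (u x) \<le> 1" if "x < n" for x unfolding u_def by (rule unitary_on_entry_le[OF U that i])
    have 1: "Re (sesq n (attenuator (exp (- t)) \<rho>) u u) - p i - t * l i
      = Re (sesq n (attenuator (exp (- t)) \<rho>) u u - sesq n \<rho> u u - of_real t * sesq n (attenuator_gen \<rho>) u u)"
      unfolding u_def by (simp add: spectral_mean[OF S i] attenuator_gen_mean[OF \<rho> S i] l_def)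
    have "\<bar>Re (sesq n (attenuator (exp (- t)) \<rho>) u u) - p i - t * l i\<bar>
      \<le> cmod (\<Sum>x<n. \<Sum>y<n. cnj (u x) * (attenuator (exp (- t)) \<rho> x y - \<rho> x y - of_real t * attenuator_gen \<rho> x y) * u y)"
      unfolding 1 sesq_diff by (rule abs_Re_le_cmod)
    also have "\<dots> \<le> (\<Sum>x<n. \<Sum>y<n. C x y * t\<^sup>2)"
    proof (intro order_trans[OF norm_sum] sum_mono)
      fix x y assume xy: "x \<in> {..<n}" "y \<in> {..<n}"
      have "cmod (cnj (u x) * (attenuator (exp (- t)) \<rho> x y - \<rho> x y - of_real t * attenuator_gen \<rho> x y) * u y)
        \<le> 1 * (C x y * t\<^sup>2) * 1"
        unfolding norm_mult complex_mod_cnj using xy u1 C[OF t] C0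
        by (intro mult_mono) auto
      then show "cmod (cnj (u x) * (attenuator (exp (- t)) \<rho> x y - \<rho> x y - of_real t * attenuator_gen \<rho> x y) * u y)
        \<le> C x y * t\<^sup>2" by simp
    qed
    also have "\<dots> \<le> B * t\<^sup>2"
      unfolding sum_distrib_right[symmetric] using B_part by (intro mult_right_mono) auto
    finally show ?thesis unfolding u_def .
  qed
  moreover have "cmod ((\<Sum>z<n. attenuator (exp (- t)) \<rho> x z * U z i) - of_real (p i) * U x i) \<le> B * t"
    if t: "t \<in> {0..1}" and i: "i < n" and x: "x < n" for t i x
  proof -
    have "(\<Sum>z<n. attenuator (exp (- t)) \<rho> x z * U z i) - of_real (p i) * U x i
      = (\<Sum>z<n. (attenuator (exp (- t)) \<rho> x z - \<rho> x z) * U z i)"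
      unfolding spectral_eigen(1)[OF S x i, symmetric] sum_subtractf[symmetric]
      by (simp add: left_diff_distrib)
    also have "cmod \<dots> \<le> (\<Sum>z<n. (C x z + cmod (attenuator_gen \<rho> x z)) * t)"
    proof (intro order_trans[OF norm_sum] sum_mono)
      fix z assume z: "z \<in> {..<n}"
      have "cmod (attenuator (exp (- t)) \<rho> x z - \<rho> x z)
        \<le> cmod (attenuator (exp (- t)) \<rho> x z - \<rho> x z - of_real t * attenuator_gen \<rho> x z) + cmod (of_real t * attenuator_gen \<rho> x z)"
        by (metis norm_triangle_sub add.commute)
      also have "\<dots> \<le> C x z * t\<^sup>2 + t * cmod (attenuator_gen \<rho> x z)"
        using C[OF t, of x z] t by (simp add: norm_mult)
      also have "C x z * t\<^sup>2 \<le> C x z * t"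
        using t C0 by (intro mult_left_mono) (auto simp: power2_eq_square mult_left_le)
      finally have "cmod (attenuator (exp (- t)) \<rho> x z - \<rho> x z) \<le> (C x z + cmod (attenuator_gen \<rho> x z)) * t"
        by (simp add: algebra_simps)
      then have "cmod (attenuator (exp (- t)) \<rho> x z - \<rho> x z) * cmod (U z i) \<le> ((C x z + cmod (attenuator_gen \<rho> x z)) * t) * 1"
        using unitary_on_entry_le[OF U _ i, of z] z t C0 by (intro mult_mono) auto
      then show "cmod ((attenuator (exp (- t)) \<rho> x z - \<rho> x z) * U z i) \<le> (C x z + cmod (attenuator_gen \<rho> x z)) * t"
        by (simp add: norm_mult)
    qed
    also have "\<dots> \<le> B * t"
      unfolding sum_distrib_right[symmetric] using B_row[OF x] t by (intro mult_right_mono) auto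
    finally show ?thesis .
  qed
  ultimately show ?thesis by (intro exI[of _ B]) auto
qed

theorem theorem2:
  fixes \<rho> :: "nat op"
  assumes "quantum_state \<rho>" and "finite_support \<rho>"
  shows "\<exists>D :: ereal. has_right_derivative (\<lambda>t. entropy (attenuator (exp (- t)) \<rho>)) D 0
           \<and> D \<ge> ereal (f_iso (entropy \<rho>))"
proof -
  obtain N where "\<And>i j. N < i \<or> N < j \<Longrightarrow> \<rho> i j = 0"
    using assms(2) unfolding finite_support_def by blast
  define n where "n = Suc N"
  have sup: "supported n \<rho>"
    using \<open>\<And>i j. N < i \<or> N < j \<Longrightarrow> \<rho> i j = 0\<close> by (auto simp: supported_def n_def)
  have psd: "op_psd \<rho>" using assms(1) by (simp add: quantum_state_def)
  have tr: "(\<Sum>i<n. \<rho> i i) = 1"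
    using assms(1) infsum_lessThan[of n "\<lambda>i. \<rho> i i"] sup
    by (auto simp: quantum_state_def supported_def dest!: infsumI)
  have "\<exists>U p. spectral n \<rho> U p"
    by (rule spectral_exists) (rule op_psd_hermitian[OF psd])
  then obtain U p where S: "spectral n \<rho> U p" by blast
  have U: "unitary_on n U" using S by (simp add: spectral_def)
  have p0: "0 \<le> p i" if "i < n" for i by (rule spectral_psd_nonneg[OF S psd that])
  have "complex_of_real (\<Sum>k<n. p k) = 1" using spectral_trace[OF S] tr by simp
  then have p1: "(\<Sum>k<n. p k) = 1" using of_real_eq_1_iff by blast
  have ent: "entropy \<rho> = - (\<Sum>k<n. p k * ln (p k))" by (rule entropy_spectral[OF sup S])
  define l where "l i = (\<Sum>j<n. rate n U i j * p j) - p i * mean_number n U i" for i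
  define R where "R t = attenuator (exp (- t)) \<rho>" for t :: real
  define r where "r t i = Re (sesq n (R t) (\<lambda>x. U x i) (\<lambda>x. U x i))" for t i
  define v where "v t i y = (\<Sum>x<n. (cmod ((\<Sum>z<n. R t x z * U z i) - of_real y * U x i))\<^sup>2)" for t i y
  obtain B where B: "0 \<le> B"
    and rB: "\<And>t i. t \<in> {0<..<1} \<Longrightarrow> i < n \<Longrightarrow> \<bar>r t i - p i - t * l i\<bar> \<le> B * t\<^sup>2"
    and vB: "\<And>t i x. t \<in> {0<..<1} \<Longrightarrow> i < n \<Longrightarrow> x < n \<Longrightarrow>
      cmod ((\<Sum>z<n. R t x z * U z i) - of_real (p i) * U x i) \<le> B * t"
    using attenuator_expansion_basis[OF sup S l_def] unfolding r_def R_def by fastforce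
  have "\<exists>h. entropy (R t) = (\<Sum>i<n. h i) \<and> (\<forall>i<n. 0 \<le> h i \<and> 0 \<le> r t i \<and>
    (\<forall>y>0. h i \<le> - (r t i * ln y) - r t i + y \<and> - (r t i * ln y) - r t i + y - v t i y / y \<le> h i))"
    if t: "t \<in> {0<..<1}" for t
    unfolding r_def v_def
  proof (rule entropy_klein)
    have e: "0 \<le> exp (- t)" "exp (- t) \<le> 1" using t by auto
    show "op_psd (R t)" "supported n (R t)" "(\<Sum>i<n. R t i i) = 1"
      unfolding R_def using op_psd_attenuator[OF psd sup e] supported_attenuator[OF sup e] trace_attenuator[OF sup e] tr by auto
  qed (rule U)
  \<comment> \<open>The shares come from an eigenbasis chosen separately for each t; the bounds are
    all that is kept of it.\<close>
  then have "\<exists>H. \<forall>t\<in>{0<..<1}. entropy (R t) = (\<Sum>i<n. H t i) \<and> (\<forall>i<n. 0 \<le> H t i \<and> 0 \<le> r t i \<and>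
    (\<forall>y>0. H t i \<le> - (r t i * ln y) - r t i + y \<and> - (r t i * ln y) - r t i + y - v t i y / y \<le> H t i))"
    by (intro bchoice ballI)
  then obtain H where H: "\<And>t. t \<in> {0<..<1} \<Longrightarrow> entropy (R t) = (\<Sum>i<n. H t i)"
    and H0: "\<And>t i. t \<in> {0<..<1} \<Longrightarrow> i < n \<Longrightarrow> 0 \<le> H t i" and r0: "\<And>t i. t \<in> {0<..<1} \<Longrightarrow> i < n \<Longrightarrow> 0 \<le> r t i"
    and Hup: "\<And>t i y. t \<in> {0<..<1} \<Longrightarrow> i < n \<Longrightarrow> 0 < y \<Longrightarrow> H t i \<le> - (r t i * ln y) - r t i + y"
    and Hlow: "\<And>t i y. t \<in> {0<..<1} \<Longrightarrow> i < n \<Longrightarrow> 0 < y \<Longrightarrow> - (r t i * ln y) - r t i + y - v t i y / y \<le> H t i"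
    by blast
  \<comment> \<open>At t = 0 the error bound of the expansion is 0.\<close>
  have R0: "R 0 = \<rho>"
  proof (intro ext)
    fix i j
    obtain C where "\<forall>t\<in>{0..1}. cmod (attenuator (exp (- t)) \<rho> i j - \<rho> i j - of_real t * attenuator_gen \<rho> i j) \<le> C * t\<^sup>2"
      using attenuator_expansion[OF sup] by blast
    from bspec[OF this, of 0] show "R 0 i j = \<rho> i j" by (simp add: R_def)
  qed
  have v_bound: "v t i y \<le> real n * c\<^sup>2 * t\<^sup>2"
    if "\<And>x. x < n \<Longrightarrow> cmod ((\<Sum>z<n. R t x z * U z i) - of_real y * U x i) \<le> c * t" for t i y c
  proof -
    have "v t i y \<le> (\<Sum>x<n. (c * t)\<^sup>2)"
      unfolding v_def using that by (intro sum_mono power_mono) auto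
    then show ?thesis by (simp add: power_mult_distrib)
  qed
  define g where "g i t = (H t i + p i * ln (p i)) / t" for i t
  have slope: "(entropy (R t) - entropy (R 0)) / t = (\<Sum>i<n. g i t)" if "t \<in> {0<..<1}" for t
    unfolding g_def sum_divide_distrib[symmetric] by (simp add: H[OF that] R0 ent sum.distrib)
  define K where "K = {i. i < n \<and> 0 < p i}"
  have K: "finite K" "K \<subseteq> {..<n}" by (auto simp: K_def)
  have gK: "(g i \<longlongrightarrow> - (l i * (ln (p i) + 1))) (at_right 0)" if "i \<in> K" for i
  proof -
    have i: "i < n" "0 < p i" using that by (auto simp: K_def)
    show ?thesis
      unfolding g_def
      by (rule slope_positive_eigenvalue[where r = "\<lambda>t. r t i" and v = "\<lambda>t. v t i (p i)" and B = B and B' = "real n * B\<^sup>2"])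
        (use i rB Hup Hlow v_bound vB in auto)
  qed
  have ker: "p i = 0" if "i < n" "i \<notin> K" for i using p0[OF that(1)] that by (auto simp: K_def)
  have ker_l: "l i = (\<Sum>j<n. rate n U i j * p j)" if "p i = 0" for i using that by (simp add: l_def)
  have deriv: "has_right_derivative (\<lambda>t. entropy (attenuator (exp (- t)) \<rho>)) D 0"
    if "((\<lambda>t. ereal (\<Sum>i<n. g i t)) \<longlongrightarrow> D) (at_right 0)" for D
    unfolding has_right_derivative_def
  proof (rule Lim_transform_eventually[OF that])
    show "\<forall>\<^sub>F t in at_right 0. ereal (\<Sum>i<n. g i t)
       = ereal ((entropy (attenuator (exp (- (0 + t))) \<rho>) - entropy (attenuator (exp (- 0)) \<rho>)) / t)"
      using eventually_unit_interval by eventually_elim (use slope in \<open>simp add: R_def\<close>)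
  qed
  show ?thesis
  \<comment> \<open>The condition says that no jump leads from the range of \<rho> into its
    kernel.\<close>
  proof (cases "\<forall>i<n. p i = 0 \<longrightarrow> (\<Sum>j<n. rate n U i j * p j) = 0")
    case True
    have g0: "(g i \<longlongrightarrow> 0) (at_right 0)" if i: "i < n" "i \<notin> K" for i
    proof -
      have pi: "p i = 0" by (rule ker[OF i])
      have "l i = 0" using True i pi ker_l by simp
      then have "r t i \<le> B * t\<^sup>2" if "t \<in> {0<..<1}" for t
        using rB[OF that i(1)] pi by simp
      then have "((\<lambda>t. H t i / t) \<longlongrightarrow> 0) (at_right 0)"
        by (intro slope_kernel_closed[where r = "\<lambda>t. r t i" and B = B]) (use i H0 r0 Hup in auto)
      moreover have "g i = (\<lambda>t. H t i / t)" by (simp add: g_def pi fun_eq_iff)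
      ultimately show ?thesis by simp
    qed
    define D where "D = (\<Sum>i\<in>K. - (l i * (ln (p i) + 1)))"
    have "((\<lambda>t. \<Sum>i<n. g i t) \<longlongrightarrow> (\<Sum>i<n. if i \<in> K then - (l i * (ln (p i) + 1)) else 0)) (at_right 0)"
      by (intro tendsto_sum) (use gK g0 in auto)
    also have "(\<Sum>i<n. if i \<in> K then - (l i * (ln (p i) + 1)) else 0) = D"
      unfolding D_def using K by (intro sum.mono_neutral_cong_right) auto
    finally have "has_right_derivative (\<lambda>t. entropy (attenuator (exp (- t)) \<rho>)) (ereal D) 0"
      by (intro deriv) simp
    moreover have "f_iso (entropy \<rho>) \<le> D"
      using support_flow_bound[OF U p0 p1] True unfolding ent D_def K_def l_def by simp
    ultimately show ?thesis by (intro exI[of _ "ereal D"]) simp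
  next
    case False
    then obtain k where k: "k < n" "p k = 0" and "(\<Sum>j<n. rate n U k j * p j) \<noteq> 0" by blast
    moreover have "0 \<le> (\<Sum>j<n. rate n U k j * p j)"
      using p0 by (intro sum_nonneg mult_nonneg_nonneg) (auto simp: rate_def)
    ultimately have lk: "0 < l k" by (simp add: ker_l)
    have "filterlim (\<lambda>t. H t k / t) at_top (at_right 0)"
    \<comment> \<open>The reference point is y = t instead of the eigenvalue 0; this changes the
      residual by at most t in each component, hence the constant \<open>B + 1\<close>.\<close>
    proof (rule slope_kernel_open[where r = "\<lambda>t. r t k" and v = "\<lambda>t. v t k t" and B = B and B' = "real n * (B + 1)\<^sup>2"])
      fix t :: real assume t: "t \<in> {0<..<1}"
      show "\<bar>r t k - t * l k\<bar> \<le> B * t\<^sup>2" using rB[OF t k(1)] k by simp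
      show "v t k t \<le> real n * (B + 1)\<^sup>2 * t\<^sup>2"
      proof (rule v_bound)
        fix x assume x: "x < n"
        have "cmod ((\<Sum>z<n. R t x z * U z k) - of_real t * U x k) \<le> cmod (\<Sum>z<n. R t x z * U z k) + t * cmod (U x k)"
          using norm_triangle_ineq4[of "\<Sum>z<n. R t x z * U z k" "of_real t * U x k"] t by (simp add: norm_mult)
        also have "\<dots> \<le> B * t + t * 1"
          using vB[OF t k(1) x] k unitary_on_entry_le[OF U x k(1)] t by (intro add_mono mult_left_mono) auto
        finally show "cmod ((\<Sum>z<n. R t x z * U z k) - of_real t * U x k) \<le> (B + 1) * t"
          by (simp add: algebra_simps)
      qed
      show "- (r t k * ln t) - r t k + t - v t k t / t \<le> H t k" using Hlow[OF t k(1)] t by simp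
    qed (rule lk)
    then have "filterlim (\<lambda>t. (\<Sum>i\<in>K. g i t) + H t k / t) at_top (at_right 0)"
      by (intro filterlim_tendsto_add_at_top[OF tendsto_sum[OF gK]])
    then have "filterlim (\<lambda>t. \<Sum>i<n. g i t) at_top (at_right 0)"
    proof (rule filterlim_at_top_mono)
      \<comment> \<open>The other vectors of the kernel contribute nonnegative terms, so a single
        one with a positive rate is enough.\<close>
      show "\<forall>\<^sub>F t in at_right 0. (\<Sum>i\<in>K. g i t) + H t k / t \<le> (\<Sum>i<n. g i t)"
        using eventually_unit_interval
      proof eventually_elim
        case (elim t)
        have kK: "k \<notin> K" using k by (simp add: K_def)
        have "(\<Sum>i\<in>K. g i t) + H t k / t = (\<Sum>i\<in>insert k K. g i t)"
          using K kK k by (simp add: g_def)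
        also have "\<dots> \<le> (\<Sum>i<n. g i t)"
          using K k elim H0[OF elim] ker by (intro sum_mono2) (auto simp: g_def)
        finally show ?case .
      qed
    qed
    then have "((\<lambda>t. ereal (\<Sum>i<n. g i t)) \<longlongrightarrow> \<infinity>) (at_right 0)"
      by (simp add: tendsto_PInfty filterlim_at_top_dense)
    then have "has_right_derivative (\<lambda>t. entropy (attenuator (exp (- t)) \<rho>)) \<infinity> 0"
      by (rule deriv)
    then show ?thesis by (intro exI[of _ \<infinity>]) simp
  qed
qed

end
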